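(* Let $p\ge1$, $1\le s$, $\sigma>0$ and $\Sigma\in\mathbb{R}^{p\times p}$ a covariance matrix. Let $\Theta_s=\{\beta\in\mathbb{R}^p\setminus\{0\}:\sum_{j=1}^p\mathbb{I}\{\beta_j\ne0\}\le s\}$. For $\beta\in\Theta_s$ let $P_\beta$ be the law of $(X,y)\in\mathbb{R}^p\times\mathbb{R}$ with $X\sim N(0,\Sigma)$ and $y\mid X\sim N(\beta^TX,\sigma^2)$. For $\epsilon\in[0,1)$ and an arbitrary distribution $Q$ on $\mathbb{R}^p\times\mathbb{R}$, let $(X_1,y_1),\dots,(X_n,y_n)$ be i.i.d. from $\mathbb{P}_{(\epsilon,\beta,Q)}=(1-\epsilon)P_\beta+\epsilon Q$. For $\mathcal{U}\subset\mathbb{R}^p\setminus\{0\}$ and a distribution $\mathbb{P}$ of $(X,y)$ define the regression depth $\mathcal{D}_{\mathcal{U}}(\beta,\mathbb{P})=\inf_{u\in\mathcal{U}}\mathbb{P}\{u^TX(y-X^T\beta)\ge0\}$, and let $\hat\beta$ be any maximizer over $\beta\in\Theta_s$ of $\mathcal{D}_{\Theta_{2s}}(\beta,\mathbb{P}_n)$, where $\mathbb{P}_n$ is the empirical measure of the sample. Let $\kappa=\inf_{|\mathrm{supp}(v)|=2s}\|\Sigma^{1/2}v\|/\|v\|$. Then there exist absolute constants $c_0,C,C'>0$ such that whenever $\epsilon^2+\frac{s\log(ep/s)}{n}\le c_0$, $$\|\Sigma^{1/2}(\hat\beta-\beta)\|^2\le C\sigma^2\Big(\frac{s\log(ep/s)}{n}\vee\epsilon^2\Big),\qquad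 \|\hat\beta-\beta\|^2\le C\frac{\sigma^2}{\kappa^2}\Big(\frac{s\log(ep/s)}{n}\vee\epsilon^2\Big),$$ $$\|\hat\beta-\beta\|_1^2\le C\frac{\sigma^2}{\kappa^2}\Big(\frac{s^2\log(ep/s)}{n}\vee s\epsilon^2\Big),$$ with $\mathbb{P}_{(\epsilon,\beta,Q)}$-probability at least $1-\exp\big(-C'(s\log(ep/s)+n\epsilon^2)\big)$, uniformly over all $Q$ and all $\beta\in\Theta_s$.
   Context: $\|\cdot\|$ is the Euclidean norm, $\|\cdot\|_1$ the $\ell_1$ norm, $\mathrm{supp}(v)=\{j:v_j\ne0\}$, $a\vee b=\max(a,b)$.
   Formalization: κ is taken as the infimum over nonzero v with |supp(v)| ≤ 2s (equal to the stated one when 2s ≤ p; the stated set is empty when 2s > p), s ≤ p and n ≥ 1 are assumed, and the κ bounds are multiplied through by κ². *)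

theory Defs
  imports "HOL-Probability.Probability"
begin

text \<open>Vectors in R^p are functions nat => real; only the coordinates j < p matter.
  Matrices in R^{p x p} are functions nat => nat => real (entries i,j < p).\<close>

definition dotp :: "nat \<Rightarrow> (nat \<Rightarrow> real) \<Rightarrow> (nat \<Rightarrow> real) \<Rightarrow> real" where
  "dotp p u v = (\<Sum>j<p. u j * v j)"

definition l2norm :: "nat \<Rightarrow> (nat \<Rightarrow> real) \<Rightarrow> real" where
  "l2norm p v = sqrt (\<Sum>j<p. (v j)^2)"

definition l1norm :: "nat \<Rightarrow> (nat \<Rightarrow> real) \<Rightarrow> real" where
  "l1norm p v = (\<Sum>j<p. \<bar>v j\<bar>)"

definition supp :: "nat \<Rightarrow> (nat \<Rightarrow> real) \<Rightarrow> nat set" where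
  "supp p v = {j. j < p \<and> v j \<noteq> 0}"

definition Theta :: "nat \<Rightarrow> nat \<Rightarrow> (nat \<Rightarrow> real) set" where
  "Theta p s = {b. supp p b \<noteq> {} \<and> card (supp p b) \<le> s}"

definition quadf :: "nat \<Rightarrow> (nat \<Rightarrow> nat \<Rightarrow> real) \<Rightarrow> (nat \<Rightarrow> real) \<Rightarrow> real" where
  "quadf p Sg v = (\<Sum>i<p. \<Sum>j<p. v i * Sg i j * v j)"

definition is_cov_matrix :: "nat \<Rightarrow> (nat \<Rightarrow> nat \<Rightarrow> real) \<Rightarrow> bool" where
  "is_cov_matrix p Sg \<longleftrightarrow>
     (\<forall>i<p. \<forall>j<p. Sg i j = Sg j i) \<and> (\<forall>v. quadf p Sg v \<ge> 0)"

text \<open>norm of Sg^{1/2} v (Sg^{1/2} the symmetric PSD square root):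
  it equals sqrt (v^T Sg v)\<close>
definition Sigma_half_norm :: "nat \<Rightarrow> (nat \<Rightarrow> nat \<Rightarrow> real) \<Rightarrow> (nat \<Rightarrow> real) \<Rightarrow> real" where
  "Sigma_half_norm p Sg v = sqrt (quadf p Sg v)"

definition kappa :: "nat \<Rightarrow> nat \<Rightarrow> (nat \<Rightarrow> nat \<Rightarrow> real) \<Rightarrow> real" where
  "kappa p s Sg = (INF v\<in>Theta p (2 * s). Sigma_half_norm p Sg v / l2norm p v)"

definition Xspace :: "nat \<Rightarrow> (nat \<Rightarrow> real) measure" where
  "Xspace p = PiM {..<p} (\<lambda>_. borel)"

definition XYspace :: "nat \<Rightarrow> ((nat \<Rightarrow> real) \<times> real) measure" where
  "XYspace p = Xspace p \<Otimes>\<^sub>M (borel :: real measure)"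

definition stdG :: "real measure" where
  "stdG = density lborel std_normal_density"

text \<open>a factor A with A A^T = Sg (exists for PSD Sg); the law of A Z does not depend
  on the choice\<close>
definition cov_factor :: "nat \<Rightarrow> (nat \<Rightarrow> nat \<Rightarrow> real) \<Rightarrow> (nat \<Rightarrow> nat \<Rightarrow> real)" where
  "cov_factor p Sg = (SOME A. \<forall>i<p. \<forall>j<p. (\<Sum>k<p. A i k * A j k) = Sg i j)"

definition matvec :: "nat \<Rightarrow> (nat \<Rightarrow> nat \<Rightarrow> real) \<Rightarrow> (nat \<Rightarrow> real) \<Rightarrow> (nat \<Rightarrow> real)" where
  "matvec p A z = (\<lambda>i\<in>{..<p}. \<Sum>k<p. A i k * z k)"

definition gauss_vec :: "nat \<Rightarrow> (nat \<Rightarrow> nat \<Rightarrow> real) \<Rightarrow> (nat \<Rightarrow> real) measure" where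
  "gauss_vec p Sg = distr (PiM {..<p} (\<lambda>_. stdG)) (Xspace p) (matvec p (cov_factor p Sg))"

definition P_beta :: "nat \<Rightarrow> (nat \<Rightarrow> nat \<Rightarrow> real) \<Rightarrow> real \<Rightarrow> (nat \<Rightarrow> real)
    \<Rightarrow> ((nat \<Rightarrow> real) \<times> real) measure" where
  "P_beta p Sg sg beta =
     distr (gauss_vec p Sg \<Otimes>\<^sub>M stdG) (XYspace p) (\<lambda>(x, xi). (x, dotp p beta x + sg * xi))"

definition mixture :: "real \<Rightarrow> 'a measure \<Rightarrow> 'a measure \<Rightarrow> 'a measure" where
  "mixture eps P Q = measure_of (space P) (sets P)
     (\<lambda>A. ennreal (1 - eps) * emeasure P A + ennreal eps * emeasure Q A)"

definition sample_law :: "nat \<Rightarrow> 'a measure \<Rightarrow> (nat \<Rightarrow> 'a) measure" where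
  "sample_law n P = PiM {..<n} (\<lambda>_. P)"

definition emp_prob :: "nat \<Rightarrow> (nat \<Rightarrow> 'a) \<Rightarrow> 'a set \<Rightarrow> real" where
  "emp_prob n omega A = real (card {i. i < n \<and> omega i \<in> A}) / real n"

definition emp_depth :: "nat \<Rightarrow> (nat \<Rightarrow> real) set \<Rightarrow> nat \<Rightarrow> (nat \<Rightarrow> (nat \<Rightarrow> real) \<times> real)
    \<Rightarrow> (nat \<Rightarrow> real) \<Rightarrow> real" where
  "emp_depth p U n omega beta =
     (INF u\<in>U. emp_prob n omega {(x, y). dotp p u x * (y - dotp p x beta) \<ge> 0})"

definition is_depth_max :: "nat \<Rightarrow> nat \<Rightarrow> nat \<Rightarrow> (nat \<Rightarrow> (nat \<Rightarrow> real) \<times> real)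
    \<Rightarrow> (nat \<Rightarrow> real) \<Rightarrow> bool" where
  "is_depth_max p s n omega b \<longleftrightarrow> b \<in> Theta p s \<and>
     (\<forall>beta\<in>Theta p s. emp_depth p (Theta p (2 * s)) n omega beta
                         \<le> emp_depth p (Theta p (2 * s)) n omega b)"

end

theory Submission
  imports Defs
begin

text \<open>
  The deepest candidate \<open>b\<close> is compared with \<open>beta\<close> in the single direction \<open>b - beta\<close>.
  Write \<open>r\<close> for the standardised residual \<open>(y - x\<^sup>T beta) / sg\<close>, \<open>g\<close> for \<open>x\<^sup>T v\<close> with \<open>v\<^sup>T Sg v = 1\<close>,
  and let \<open>tau\<close> be the \<open>Sg\<close>-norm of \<open>b - beta\<close>. The half-space event of the depth of \<open>beta\<close> is
  \<open>g * r \<ge> 0\<close>, of probability 1/2; that of \<open>b\<close> in direction \<open>b - beta\<close> is \<open>g * r \<ge> t * g\<^sup>2\<close> with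
  \<open>t = tau / sg\<close>, of probability at most \<open>1/2 - c * t\<close>, and it decreases in \<open>t\<close>. So if empirical and
  true probabilities agree up to a multiple of \<open>y = sqrt (s * ln (e * p / s) / n + eps\<^sup>2)\<close> uniformly over
  sparse directions, for the two values \<open>t = 0\<close> and \<open>t = C * y\<close>, then a maximiser satisfies \<open>tau \<le> C * y * sg\<close>.

  The uniform deviation, without a logarithmic loss in \<open>n\<close>, comes from chaining along nets of the unit
  \<open>Sg\<close>-spheres of the coordinate subspaces, at radii \<open>8^-k\<close>. Two directions at distance \<open>8^-k\<close> disagree
  only if a Gaussian variable falls in a window of width \<open>4^-k\<close> or the difference exceeds \<open>4^-k\<close>, hence
  with probability \<open>O(4^-k)\<close>, and Bernstein's exponent \<open>2^k * y\<close> makes the \<open>k\<close>-th link cost \<open>O(k * 2^-k * n * y)\<close>.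
  The chain stops when \<open>2^k * y\<close> is of order 1; below that scale only the number of small values at net
  points and the empirical second moment matter. Contaminated observations are located by a latent
  Bernoulli variable and discarded: there are at most \<open>8 * n * y\<close> of them.
\<close>

text \<open>Windows of width \<open>4^-k\<close> for radii \<open>8^-k\<close> equalise the two ways
  in which a link can flip: Chebyshev gives \<open>64^-k / 16^-k = 4^-k\<close> for a large
  difference, the order of the window itself. A link then has variance at most
  \<open>5 / 4^k\<close>, and the exponent \<open>2^k * y\<close> turns this into
  \<open>5 * n * y^2\<close> on every level, so only the entropy of the nets grows with
  \<open>k\<close>. The chain has to stop near \<open>2^k * y = 1/2\<close> because the quadratic
  bound for \<open>exp\<close> holds for bounded exponents only. The obstacle is that the clean
  observations sit at random indices and that maximisers are arbitrary. Therefore probability enters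
  only through a finite set of pairs \<open>(h, D)\<close> fixed before the sample; once the sums
  over an index set obey their thresholds, the rest is deterministic and holds for all directions
  and all maximisers at once. The common budget is \<open>Lam = n * y^2\<close>, in the end equal to
  \<open>s * ln (e * p / s) + n * eps^2\<close>: entropy, tails and contamination are all paid in
  multiples of it, which is how \<open>n * eps^2\<close> enters the probability bound.\<close>

section \<open>Sparse supports and nets of quadratic-form spheres\<close>

text \<open>Give \<open>S\<close> the weight \<open>x ^ card S\<close> with
  \<open>x = s / p\<close>. Every counted set weighs at least \<open>x ^ (2 * s)\<close>, while all
  subsets together weigh \<open>(1 + x) ^ p <= exp s\<close>.\<close>

lemma card_sparse_subsets:
  fixes p s :: nat
  assumes "1 \<le> s" "s \<le> p"
  shows "real (card {S. S \<subseteq> {..<p} \<and> card S \<le> 2 * s})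
    \<le> exp (2 * (real s * ln (exp 1 * real p / real s)))"
proof -
  define x where "x = real s / real p"
  have x: "0 < x" "x \<le> 1" using assms by (auto simp: x_def)
  let ?F = "{S. S \<subseteq> {..<p} \<and> card S \<le> 2 * s}"
  have fin: "finite ?F" by (rule finite_subset[of _ "Pow {..<p}"]) auto
  have "real (card ?F) * x ^ (2 * s) = (\<Sum>S\<in>?F. x ^ (2 * s))" by simp
  also have "\<dots> \<le> (\<Sum>S\<in>?F. x ^ card S)"
    using x by (intro sum_mono power_decreasing) auto
  also have "\<dots> \<le> (\<Sum>S\<in>Pow {..<p}. x ^ card S)"
    using x by (intro sum_mono2) auto
  also have "\<dots> = (\<Sum>S\<in>Pow {..<p}. (\<Prod>j\<in>S. x) * (\<Prod>j\<in>{..<p} - S. 1))"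
    by (intro sum.cong) simp_all
  also have "\<dots> = (1 + x) ^ p"
    by (subst prod_add[symmetric]) (simp_all add: add.commute)
  also have "\<dots> \<le> exp x ^ p"
    using x by (intro power_mono) (auto intro: exp_ge_add_one_self)
  also have "\<dots> = exp (real s)"
    using assms by (simp add: x_def flip: exp_of_nat_mult)
  finally have *: "real (card ?F) * x ^ (2 * s) \<le> exp (real s)" .
  have "real (card ?F) \<le> exp (real s) / x ^ (2 * s)"
    using * x by (simp add: field_simps)
  also have "x ^ (2 * s) = exp (2 * real s * ln x)"
    using x by (simp add: powr_def flip: powr_realpow)
  also have "exp (real s) / exp (2 * real s * ln x) = exp (real s - 2 * real s * ln x)"
    by (simp add: exp_diff)
  also have "\<dots> \<le> exp (2 * (real s * (1 - ln x)))" using assms by (simp add: algebra_simps)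
  also have "1 - ln x = ln (exp 1 * real p / real s)"
    using assms by (simp add: x_def ln_div ln_mult)
  finally show ?thesis .
qed

text \<open>Cholesky factorisation by induction: the Schur complement of the pivot \<open>d\<close>
  is again positive semidefinite, and its factor is bordered by the column
  \<open>c / sqrt d\<close>. A zero pivot forces \<open>c = 0\<close>; division by zero, being 0,
  then gives the right entries without a case distinction in the construction.\<close>

lemma psd_factor:
  fixes Sg :: "'a \<Rightarrow> 'a \<Rightarrow> real"
  assumes "finite I" "\<And>i j. i \<in> I \<Longrightarrow> j \<in> I \<Longrightarrow> Sg i j = Sg j i"
    "\<And>v. 0 \<le> (\<Sum>i\<in>I. \<Sum>j\<in>I. v i * Sg i j * v j)"
  shows "\<exists>A. \<forall>i\<in>I. \<forall>j\<in>I. (\<Sum>k\<in>I. A i k * A j k) = Sg i j"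
  using assms
proof (induction I arbitrary: Sg rule: finite_induct)
  case empty
  then show ?case by simp
next
  case (insert x F)
  define d where "d = Sg x x"
  define c where "c = (\<lambda>i. Sg i x)"
  have sym: "Sg x i = c i" if "i \<in> F" for i using insert.prems(1) that by (auto simp: c_def)
  have expand: "(\<Sum>i\<in>insert x F. \<Sum>j\<in>insert x F. v i * Sg i j * v j) =
     d * (v x)^2 + 2 * v x * (\<Sum>i\<in>F. c i * v i) + (\<Sum>i\<in>F. \<Sum>j\<in>F. v i * Sg i j * v j)" for v
    using insert.hyps sym
    by (simp add: sum.distrib d_def c_def power2_eq_square sum_distrib_left algebra_simps)
  have d0: "0 \<le> d"
    using insert.prems(2)[of "\<lambda>i. if i = x then 1 else 0"] insert.hyps
    unfolding expand by (simp add: if_distrib[of "\<lambda>z. _ * z"] sum.delta cong: if_cong)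
  have c0: "c i = 0" if "i \<in> F" "d = 0" for i
  proof (rule ccontr)
    assume "c i \<noteq> 0"
    \<comment> \<open>With \<open>d = 0\<close> the form at \<open>t * e_x + e_i\<close> is affine
      in \<open>t\<close>; this choice makes it \<open>-1\<close>.\<close>
    define t where "t = - (Sg i i + 1) / (2 * c i)"
    define v where "v = (\<lambda>j. if j = x then t else if j = i then 1 else 0 :: real)"
    have "x \<notin> F" using insert.hyps by simp
    then have "(\<Sum>j\<in>F. c j * v j) = (\<Sum>j\<in>F. if j = i then c i else 0)"
      by (intro sum.cong) (auto simp: v_def)
    then have 1: "(\<Sum>j\<in>F. c j * v j) = c i" using that insert.hyps by simp
    have 2: "(\<Sum>j\<in>F. \<Sum>k\<in>F. v j * Sg j k * v k) = (\<Sum>j\<in>F. if j = i then Sg i i else 0)"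
    proof (intro sum.cong refl)
      fix j assume j: "j \<in> F"
      have "(\<Sum>k\<in>F. v j * Sg j k * v k) = (\<Sum>k\<in>F. if k = i then v j * Sg j i else 0)"
        using \<open>x \<notin> F\<close> by (intro sum.cong) (auto simp: v_def)
      then show "(\<Sum>k\<in>F. v j * Sg j k * v k) = (if j = i then Sg i i else 0)"
        using that insert.hyps j \<open>x \<notin> F\<close> by (auto simp: v_def)
    qed
    have "0 \<le> d * (v x)^2 + 2 * v x * c i + Sg i i"
      using insert.prems(2)[of v] that insert.hyps unfolding expand 1 2 by simp
    also have "\<dots> = - 1" using that \<open>c i \<noteq> 0\<close> by (simp add: v_def t_def field_simps)
    finally show False by simp
  qed
  have "\<exists>A. \<forall>i\<in>F. \<forall>j\<in>F. (\<Sum>k\<in>F. A i k * A j k) = Sg i j - c i * c j / d"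
  proof (rule insert.IH)
    fix i j assume "i \<in> F" "j \<in> F"
    then show "Sg i j - c i * c j / d = Sg j i - c j * c i / d"
      using insert.prems(1)[of i j] by simp
  next
    fix v :: "'a \<Rightarrow> real"
    \<comment> \<open>The value at \<open>x\<close> completes the square, so that the form at
      \<open>w\<close> is the Schur complement at \<open>v\<close>; for \<open>d = 0\<close> it is
      0.\<close>
    define w where "w = (\<lambda>i. if i = x then - (\<Sum>i\<in>F. c i * v i) / d else v i)"
    have w: "(\<Sum>i\<in>F. c i * w i) = (\<Sum>i\<in>F. c i * v i)"
      "(\<Sum>i\<in>F. \<Sum>j\<in>F. w i * Sg i j * w j) = (\<Sum>i\<in>F. \<Sum>j\<in>F. v i * Sg i j * v j)"
      using insert.hyps by (auto simp: w_def intro!: sum.cong)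
    have "0 \<le> d * (w x)^2 + 2 * w x * (\<Sum>i\<in>F. c i * v i) + (\<Sum>i\<in>F. \<Sum>j\<in>F. v i * Sg i j * v j)"
      using insert.prems(2)[of w] unfolding expand w .
    also have "\<dots> = (\<Sum>i\<in>F. \<Sum>j\<in>F. v i * Sg i j * v j) - (\<Sum>i\<in>F. c i * v i)^2 / d"
      by (cases "d = 0") (auto simp: w_def power2_eq_square field_simps)
    also have "\<dots> = (\<Sum>i\<in>F. \<Sum>j\<in>F. v i * (Sg i j - c i * c j / d) * v j)"
      by (simp add: power2_eq_square sum_product sum_divide_distrib sum_subtractf algebra_simps)
    finally show "0 \<le> (\<Sum>i\<in>F. \<Sum>j\<in>F. v i * (Sg i j - c i * c j / d) * v j)" .
  qed
  then obtain A where A: "\<And>i j. i \<in> F \<Longrightarrow> j \<in> F \<Longrightarrow> (\<Sum>k\<in>F. A i k * A j k) = Sg i j - c i * c j / d"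
    by blast
  define B where "B = (\<lambda>i k. if k = x then (if i = x then sqrt d else c i / sqrt d)
      else if i = x then 0 else A i k)"
  have "(\<Sum>k\<in>insert x F. B i k * B j k) = Sg i j" if ij: "i \<in> insert x F" "j \<in> insert x F" for i j
  proof -
    have x: "x \<notin> F" using insert.hyps by simp
    have split: "(\<Sum>k\<in>insert x F. B i k * B j k) = B i x * B j x + (\<Sum>k\<in>F. B i k * B j k)"
      using insert.hyps by simp
    show ?thesis
    proof (cases "i = x")
      case True
      have "(\<Sum>k\<in>F. B i k * B j k) = 0" using True x by (intro sum.neutral) (auto simp: B_def)
      then show ?thesis unfolding split using True ij d0 sym[of j] c0[of j]
        by (cases "d = 0"; cases "j = x") (auto simp: B_def d_def)
    next
      case i: False
      show ?thesis
      proof (cases "j = x")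
        case True
        have "(\<Sum>k\<in>F. B i k * B j k) = 0" using True x by (intro sum.neutral) (auto simp: B_def)
        then show ?thesis unfolding split using True ij d0 i c0[of i]
          by (cases "d = 0") (auto simp: B_def c_def)
      next
        case False
        have "(\<Sum>k\<in>F. B i k * B j k) = (\<Sum>k\<in>F. A i k * A j k)"
          using False i x by (intro sum.cong) (auto simp: B_def)
        then show ?thesis unfolding split using A[of i j] ij i False d0 by (simp add: B_def)
      qed
    qed
  qed
  then show ?case by blast
qed

text \<open>The count compares the indicator of the ball with \<open>exp (card S - (\<Sum>j\<in>S. \<bar>m j\<bar>) / R)\<close>,
  whose sum over the lattice is a product of geometric series.\<close>

lemma card_int_l1_ball:
  fixes R :: real
  assumes "finite S" "1 \<le> R"
  defines "B \<equiv> {m \<in> S \<rightarrow>\<^sub>E (UNIV :: int set). (\<Sum>j\<in>S. \<bar>real_of_int (m j)\<bar>) \<le> R * card S}"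
  shows "finite B" "real (card B) \<le> (exp 1 * (2 * R + 1)) ^ card S"
proof -
  \<comment> \<open>A box containing the ball makes the sum over lattice points finite, so that it
    factors over the coordinates.\<close>
  define N where "N = nat \<lceil>R * card S\<rceil>"
  let ?P = "S \<rightarrow>\<^sub>E {- int N..int N}"
  have sub: "B \<subseteq> ?P"
  proof (rule subsetI, rule PiE_I)
    fix m j assume m: "m \<in> B" and j: "j \<in> S"
    have "\<bar>real_of_int (m j)\<bar> \<le> (\<Sum>j\<in>S. \<bar>real_of_int (m j)\<bar>)"
      using assms(1) j by (intro member_le_sum) auto
    also have "\<dots> \<le> R * card S" using m by (simp add: B_def)
    finally have "\<bar>real_of_int (m j)\<bar> \<le> R * card S" .
    then show "m j \<in> {- int N..int N}" unfolding N_def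
      by (simp add: abs_le_iff) linarith
  qed (auto simp: B_def PiE_def extensional_def)
  have finP: "finite ?P" using assms(1) by (intro finite_PiE) auto
  show fin: "finite B" by (rule finite_subset[OF sub finP])
  define q where "q = exp (- 1 / R)"
  have q: "0 < q" "q < 1" using assms by (auto simp: q_def)
  \<comment> \<open>Each half of the series is at most
    \<open>q / (1 - q) = 1 / (exp (1 / R) - 1) <= R\<close>.\<close>
  have geo: "(\<Sum>m=- int N..int N. q powr \<bar>real_of_int m\<bar>) \<le> 2 * R + 1"
  proof -
    have "{- int N..int N} = insert 0 ((\<lambda>i. int i) ` {1..N} \<union> (\<lambda>i. - int i) ` {1..N})"
    proof (rule set_eqI, rule iffI)
      fix m assume m: "m \<in> {- int N..int N}"
      consider "m = 0" | "m > 0" | "m < 0" by linarith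
      then show "m \<in> insert 0 ((\<lambda>i. int i) ` {1..N} \<union> (\<lambda>i. - int i) ` {1..N})"
      proof cases
        case 2
        then have "m = int (nat m)" "nat m \<in> {1..N}" using m by auto
        then show ?thesis by blast
      next
        case 3
        then have "m = - int (nat (- m))" "nat (- m) \<in> {1..N}" using m by auto
        then show ?thesis by blast
      qed auto
    qed auto
    then have "(\<Sum>m=- int N..int N. q powr \<bar>real_of_int m\<bar>)
      = 1 + ((\<Sum>m\<in>(\<lambda>i. int i) ` {1..N}. q powr \<bar>real_of_int m\<bar>)
           + (\<Sum>m\<in>(\<lambda>i. - int i) ` {1..N}. q powr \<bar>real_of_int m\<bar>))"
      using q by (simp, subst sum.insert, simp, force, subst sum.union_disjoint) auto
    also have "(\<Sum>m\<in>(\<lambda>i. int i) ` {1..N}. q powr \<bar>real_of_int m\<bar>) = (\<Sum>i=1..N. q ^ i)"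
      using q by (subst sum.reindex) (auto simp: powr_realpow inj_on_def)
    also have "(\<Sum>m\<in>(\<lambda>i. - int i) ` {1..N}. q powr \<bar>real_of_int m\<bar>) = (\<Sum>i=1..N. q ^ i)"
      using q by (subst sum.reindex) (auto simp: powr_realpow inj_on_def)
    also have "(\<Sum>i=1..N. q ^ i) \<le> R"
    proof -
      have "(\<Sum>i=1..N. q ^ i) = q * (\<Sum>i<N. q ^ i)"
        by (simp add: sum_distrib_left sum.atLeast1_atMost_eq)
      also have "\<dots> = q * ((1 - q ^ N) / (1 - q))"
        using q sum_gp_strict[of q N] by simp
      also have "\<dots> \<le> q * (1 / (1 - q))"
        using q by (intro mult_left_mono divide_right_mono) auto
      also have "\<dots> = 1 / (exp (1 / R) - 1)"
        using q by (simp add: q_def exp_minus field_simps)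
      also have "\<dots> \<le> 1 / (1 / R)"
        using assms exp_ge_add_one_self[of "1/R"] by (intro divide_left_mono mult_pos_pos) (auto simp: field_simps)
      finally show ?thesis by simp
    qed
    finally show ?thesis by simp
  qed
  have "real (card B) = (\<Sum>m\<in>B. 1)" by simp
  also have "\<dots> \<le> (\<Sum>m\<in>B. exp 1 ^ card S * (\<Prod>j\<in>S. q powr \<bar>real_of_int (m j)\<bar>))"
  proof (rule sum_mono)
    fix m assume m: "m \<in> B"
    have "(\<Prod>j\<in>S. q powr \<bar>real_of_int (m j)\<bar>) = exp (- (\<Sum>j\<in>S. \<bar>real_of_int (m j)\<bar>) / R)"
      using assms(1) by (simp add: q_def powr_def exp_sum sum_negf sum_divide_distrib flip: sum_negf)
    also have "exp 1 ^ card S * \<dots> = exp (card S - (\<Sum>j\<in>S. \<bar>real_of_int (m j)\<bar>) / R)"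
      by (simp add: exp_diff exp_minus field_simps flip: exp_of_nat_mult)
    finally show "1 \<le> exp 1 ^ card S * (\<Prod>j\<in>S. q powr \<bar>real_of_int (m j)\<bar>)"
      using m assms(2) by (simp add: B_def field_simps)
  qed
  also have "\<dots> \<le> (\<Sum>m\<in>?P. exp 1 ^ card S * (\<Prod>j\<in>S. q powr \<bar>real_of_int (m j)\<bar>))"
    using finP sub by (intro sum_mono2) (auto intro!: prod_nonneg mult_nonneg_nonneg)
  also have "\<dots> = exp 1 ^ card S * (\<Sum>m=- int N..int N. q powr \<bar>real_of_int m\<bar>) ^ card S"
    unfolding sum_distrib_left[symmetric] using assms(1)
    by (subst prod_sum_PiE[symmetric]) auto
  also have "\<dots> \<le> exp 1 ^ card S * (2 * R + 1) ^ card S"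
    by (intro mult_left_mono power_mono geo sum_nonneg) auto
  finally show "real (card B) \<le> (exp 1 * (2 * R + 1)) ^ card S"
    by (simp add: power_mult_distrib)
qed

section \<open>Nets of the unit spheres of a quadratic form on coordinate subspaces\<close>

definition supported_on :: "nat set \<Rightarrow> (nat \<Rightarrow> real) \<Rightarrow> bool" where
  "supported_on S v \<longleftrightarrow> (\<forall>j. j \<notin> S \<longrightarrow> v j = 0)"

text \<open>\<open>1 / 64 ^ k\<close> is the square of the radius \<open>8^-k\<close>. Net points
  lie on the unit sphere itself, so the Gaussian estimates apply to them without rescaling; where
  the form vanishes on \<open>S\<close> the empty net qualifies.\<close>

definition sphere_net :: "nat \<Rightarrow> (nat \<Rightarrow> nat \<Rightarrow> real) \<Rightarrow> nat set \<Rightarrow> nat \<Rightarrow> (nat \<Rightarrow> real) set \<Rightarrow> bool" where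
  "sphere_net p Sg S k N \<longleftrightarrow> finite N \<and> (\<forall>g\<in>N. supported_on S g \<and> quadf p Sg g = 1)
     \<and> real (card N) \<le> exp (3 * real (card S) * real (k + 1))
     \<and> (\<forall>v. supported_on S v \<longrightarrow> quadf p Sg v = 1 \<longrightarrow> (\<exists>g\<in>N. quadf p Sg (v - g) \<le> 1 / 64 ^ k))"

lemma quadf_supported:
  assumes "supported_on S v" "S \<subseteq> {..<p}"
  shows "quadf p Sg v = (\<Sum>i\<in>S. \<Sum>j\<in>S. v i * Sg i j * v j)"
proof -
  have "quadf p Sg v = (\<Sum>i\<in>S. \<Sum>j<p. v i * Sg i j * v j)"
    unfolding quadf_def using assms
    by (intro sum.mono_neutral_right) (auto simp: supported_on_def)
  also have "\<dots> = (\<Sum>i\<in>S. \<Sum>j\<in>S. v i * Sg i j * v j)"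
    using assms by (intro sum.cong refl sum.mono_neutral_right) (auto simp: supported_on_def)
  finally show ?thesis .
qed

lemma quadf_factor:
  fixes A :: "nat \<Rightarrow> nat \<Rightarrow> real"
  assumes "\<And>i j. i \<in> S \<Longrightarrow> j \<in> S \<Longrightarrow> (\<Sum>k\<in>S. A i k * A j k) = Sg i j"
  shows "(\<Sum>i\<in>S. \<Sum>j\<in>S. v i * Sg i j * v j) = (\<Sum>k\<in>S. (\<Sum>i\<in>S. v i * A i k)\<^sup>2)"
proof -
  have "(\<Sum>k\<in>S. (\<Sum>i\<in>S. v i * A i k)\<^sup>2) = (\<Sum>k\<in>S. \<Sum>i\<in>S. \<Sum>j\<in>S. v i * A i k * (v j * A j k))"
    by (simp add: power2_eq_square sum_product)
  also have "\<dots> = (\<Sum>i\<in>S. \<Sum>j\<in>S. \<Sum>k\<in>S. v i * A i k * (v j * A j k))"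
    by (subst sum.swap) (intro sum.cong refl sum.swap)
  also have "\<dots> = (\<Sum>i\<in>S. \<Sum>j\<in>S. v i * Sg i j * v j)"
    by (intro sum.cong refl) (simp add: assms[symmetric] sum_distrib_left sum_distrib_right algebra_simps)
  finally show ?thesis by simp
qed

text \<open>A factor of \<open>Sg\<close> on \<open>S\<close> turns the form into a sum of squares:
  \<open>W\<close> sends the sphere into the Euclidean one. Cubes of side \<open>h\<close> have
  squared diameter \<open>d * h^2 = 64^-k\<close>, and one point of the sphere is kept per occupied
  cube. By Cauchy-Schwarz the \<open>l1\<close> norm of a unit vector is at most
  \<open>sqrt d\<close>, so the cube labels lie in an integer \<open>l1\<close> ball of radius
  \<open>2 * 8^k * d\<close>, whose size is only exponential in \<open>d\<close>.\<close>

lemma sphere_net_exists: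
  assumes cov: "is_cov_matrix p Sg" and S: "S \<subseteq> {..<p}"
  shows "\<exists>N. sphere_net p Sg S k N"
proof -
  have finS: "finite S" using S finite_subset by blast
  have psd: "0 \<le> (\<Sum>i\<in>S. \<Sum>j\<in>S. v i * Sg i j * v j)" for v
  proof -
    define w where "w = (\<lambda>j. if j \<in> S then v j else 0)"
    have "0 \<le> quadf p Sg w" using cov by (simp add: is_cov_matrix_def)
    also have "\<dots> = (\<Sum>i\<in>S. \<Sum>j\<in>S. w i * Sg i j * w j)"
      by (rule quadf_supported) (use S in \<open>auto simp: w_def supported_on_def\<close>)
    also have "\<dots> = (\<Sum>i\<in>S. \<Sum>j\<in>S. v i * Sg i j * v j)"
      by (intro sum.cong) (auto simp: w_def)
    finally show ?thesis .
  qed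
  obtain A where A: "\<And>i j. i \<in> S \<Longrightarrow> j \<in> S \<Longrightarrow> (\<Sum>k\<in>S. A i k * A j k) = Sg i j"
    using psd_factor[of S Sg, OF finS _ psd] cov S unfolding is_cov_matrix_def by blast
  define W where "W = (\<lambda>v k. \<Sum>i\<in>S. v i * A i k)"
  have quadW: "quadf p Sg v = (\<Sum>k\<in>S. (W v k)\<^sup>2)" if "supported_on S v" for v
    unfolding quadf_supported[OF that S] W_def by (rule quadf_factor[OF A])
  define d where "d = card S"
  define h where "h = 1 / (8 ^ k * sqrt (real d))"
  define cell where "cell = (\<lambda>v. \<lambda>j\<in>S. \<lfloor>W v j / h\<rfloor>)"
  define U where "U = {v. supported_on S v \<and> quadf p Sg v = 1}"
  define B where "B = {m \<in> S \<rightarrow>\<^sub>E (UNIV :: int set). (\<Sum>j\<in>S. \<bar>real_of_int (m j)\<bar>) \<le> (2 * 8 ^ k :: real) * card S}"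
  have R: "1 \<le> 2 * (8::real) ^ k" using one_le_power[of "8::real" k] by linarith
  have B: "finite B" "real (card B) \<le> (exp 1 * (2 * (2 * 8 ^ k) + 1)) ^ card S"
    unfolding B_def using card_int_l1_ball[OF finS, of "2 * 8 ^ k"] R by auto
  have dpos: "d > 0" if "v \<in> U" for v
    using that quadW[of v] finS by (auto simp: U_def d_def card_gt_0_iff)
  have cellB: "cell v \<in> B" if v: "v \<in> U" for v
  proof -
    have d: "d > 0" using dpos[OF v] .
    have h: "h > 0" using d by (simp add: h_def)
    have W1: "(\<Sum>j\<in>S. (W v j)\<^sup>2) = 1" using v quadW[of v] by (simp add: U_def)
    have l1: "(\<Sum>j\<in>S. \<bar>W v j\<bar>) \<le> sqrt (real d)"
    proof -
      have "(\<Sum>j\<in>S. \<bar>W v j\<bar>)\<^sup>2 \<le> (\<Sum>j\<in>S. \<bar>W v j\<bar>\<^sup>2) * (\<Sum>j\<in>S. 1\<^sup>2)"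
        using Cauchy_Schwarz_ineq_sum[of "\<lambda>j. \<bar>W v j\<bar>" "\<lambda>j. 1" S] by simp
      also have "\<dots> = real d" using W1 by (simp add: d_def)
      finally show ?thesis by (rule real_le_rsqrt)
    qed
    have "(\<Sum>j\<in>S. \<bar>real_of_int (cell v j)\<bar>) \<le> (\<Sum>j\<in>S. \<bar>W v j\<bar> / h + 1)"
    proof (rule sum_mono)
      fix j assume "j \<in> S"
      have "\<bar>real_of_int \<lfloor>W v j / h\<rfloor>\<bar> \<le> \<bar>W v j / h\<bar> + 1" by linarith
      then show "\<bar>real_of_int (cell v j)\<bar> \<le> \<bar>W v j\<bar> / h + 1" using \<open>j \<in> S\<close> h by (simp add: cell_def)
    qed
    also have "\<dots> = (\<Sum>j\<in>S. \<bar>W v j\<bar>) / h + d"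
      by (simp add: sum.distrib sum_divide_distrib d_def)
    also have "\<dots> \<le> sqrt (real d) / h + d" using l1 h by (simp add: divide_right_mono)
    also have "\<dots> = (8 ^ k + 1 :: real) * d" by (simp add: h_def algebra_simps)
    also have "\<dots> \<le> (2 * 8 ^ k :: real) * d" using R by (intro mult_right_mono) auto
    finally show ?thesis by (simp add: B_def d_def cell_def)
  qed
  define N where "N = inv_into U cell ` (cell ` U)"
  have fin: "finite (cell ` U)" using B cellB by (meson finite_subset image_subsetI)
  have "sphere_net p Sg S k N" unfolding sphere_net_def
  proof (intro conjI allI impI)
    show "finite N" using fin by (simp add: N_def)
    show "\<forall>g\<in>N. supported_on S g \<and> quadf p Sg g = 1"
    proof
      fix g assume "g \<in> N"
      then have "g \<in> U" by (auto simp: N_def intro: inv_into_into)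
      then show "supported_on S g \<and> quadf p Sg g = 1" by (simp add: U_def)
    qed
    have "card N \<le> card (cell ` U)" unfolding N_def using fin by (rule card_image_le)
    also have "\<dots> \<le> card B" using cellB B by (intro card_mono) auto
    finally have "real (card N) \<le> (exp 1 * (2 * (2 * 8 ^ k) + 1)) ^ card S" using B by linarith
    also have "\<dots> \<le> (exp (3 * real (k + 1))) ^ card S"
    proof (rule power_mono)
      \<comment> \<open>The factor 3 in the exponent of \<open>sphere_net\<close> comes from
        \<open>5 <= exp 2\<close> and \<open>8 <= exp 3\<close>.\<close>
      have e: "(2::real) \<le> exp 1" using exp_ge_add_one_self[of 1] by simp

      have "exp 1 * (2 * (2 * 8 ^ k) + 1) \<le> exp 1 * (5 * (8::real) ^ k)"
        by (intro mult_left_mono) auto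
      also have "\<dots> \<le> exp 1 * (exp 2 * exp 3 ^ k)"
      proof (intro mult_left_mono mult_mono power_mono)
        show "(5::real) \<le> exp 2" using exp_lower_Taylor_quadratic[of "2::real"] by simp
        have "(2::real) ^ 3 \<le> exp 1 ^ 3" using e by (intro power_mono) auto
        then show "(8::real) \<le> exp 3" by (simp flip: exp_of_nat_mult)
      qed auto
      also have "\<dots> = exp (3 * real (k + 1))"
        by (simp add: algebra_simps flip: exp_add exp_of_nat_mult)
      finally show "exp 1 * (2 * (2 * 8 ^ k) + 1) \<le> exp (3 * real (k + 1))" .
    qed simp
    also have "\<dots> = exp (3 * real (card S) * real (k + 1))"
      by (simp add: algebra_simps flip: exp_of_nat_mult)
    finally show "real (card N) \<le> exp (3 * real (card S) * real (k + 1))" .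
  next
    fix v assume v: "supported_on S v" "quadf p Sg v = 1"
    then have vU: "v \<in> U" by (simp add: U_def)
    define g where "g = inv_into U cell (cell v)"
    have gN: "g \<in> N" using vU by (auto simp: N_def g_def)
    have gU: "g \<in> U" unfolding g_def using vU by (intro inv_into_into) auto
    have gc: "cell g = cell v" using f_inv_into_f[of "cell v" cell U] vU by (simp add: g_def)
    have d: "d > 0" using dpos[OF vU] .
    have h: "h > 0" using d by (simp add: h_def)
    have "supported_on S (v - g)" using v gU by (auto simp: U_def supported_on_def)
    then have "quadf p Sg (v - g) = (\<Sum>k\<in>S. (W (v - g) k)\<^sup>2)" by (rule quadW)
    also have "\<dots> \<le> (\<Sum>k\<in>S. h\<^sup>2)"
    proof (rule sum_mono)
      fix j assume j: "j \<in> S"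
      have "\<lfloor>W g j / h\<rfloor> = \<lfloor>W v j / h\<rfloor>" using fun_cong[OF gc, of j] j by (simp add: cell_def)
      then have "\<bar>W v j / h - W g j / h\<bar> \<le> 1" by linarith
      then have "\<bar>W v j - W g j\<bar> \<le> h" using h by (simp add: field_simps flip: diff_divide_distrib)
      moreover have "W (v - g) j = W v j - W g j"
        by (simp add: W_def algebra_simps sum_subtractf)
      ultimately show "(W (v - g) j)\<^sup>2 \<le> h\<^sup>2" by (metis abs_ge_zero power2_abs power_mono)
    qed
    also have "\<dots> = d * h\<^sup>2" by (simp add: d_def)
    also have "\<dots> = 1 / 64 ^ k" using d by (simp add: h_def power_mult_distrib power_divide flip: power_mult)
       (simp add: power_mult mult.commute[of k])
    finally show "\<exists>g\<in>N. quadf p Sg (v - g) \<le> 1 / 64 ^ k" using gN by blast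
  qed
  then show ?thesis by blast
qed

section \<open>Exponential tests under contamination\<close>

text \<open>Chernoff bound for the failure of the test \<open>(\<Sum>i. h (\<omega> i)) \<le> D\<close> over the uncontaminated
  indices; contaminated ones contribute the factor 1, whence the maximum.\<close>

definition test_cost :: "nat \<Rightarrow> 'a measure \<Rightarrow> ('a \<Rightarrow> real) \<times> real \<Rightarrow> ennreal" where
  "test_cost n P \<tau> = ennreal (exp (- snd \<tau>)) * (max 1 (\<integral>\<^sup>+x. ennreal (exp (fst \<tau> x)) \<partial>P)) ^ n"

lemma chernoff_PiM:
  fixes k :: "'a \<Rightarrow> real"
  assumes "prob_space N" and [measurable]: "k \<in> borel_measurable N"
  shows "emeasure (PiM {..<n} (\<lambda>_. N)) {w \<in> space (PiM {..<n} (\<lambda>_. N)). (\<Sum>i<n. k (w i)) > D}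
    \<le> ennreal (exp (- D)) * (\<integral>\<^sup>+x. ennreal (exp (k x)) \<partial>N) ^ n"
proof -
  let ?M = "PiM {..<n} (\<lambda>_. N)"
  interpret N: prob_space N by fact
  interpret product_sigma_finite "\<lambda>_::nat. N"
    by (simp add: product_sigma_finite_def N.sigma_finite_measure_axioms)
  let ?B = "{w \<in> space ?M. (\<Sum>i<n. k (w i)) > D}"
  have [measurable]: "?B \<in> sets ?M" by measurable
  have "emeasure ?M ?B = (\<integral>\<^sup>+w. indicator ?B w \<partial>?M)" by simp
  also have "\<dots> \<le> (\<integral>\<^sup>+w. ennreal (exp (- D)) * (\<Prod>i<n. ennreal (exp (k (w i)))) \<partial>?M)"
  proof (rule nn_integral_mono)
    fix w assume w: "w \<in> space ?M"
    show "indicator ?B w \<le> ennreal (exp (- D)) * (\<Prod>i<n. ennreal (exp (k (w i))))"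
    proof (cases "w \<in> ?B")
      case True
      have "1 \<le> exp ((\<Sum>i<n. k (w i)) - D)" using True by simp
      also have "\<dots> = exp (- D) * (\<Prod>i<n. exp (k (w i)))"
        by (simp add: exp_diff exp_minus exp_sum field_simps)
      finally have "ennreal 1 \<le> ennreal (exp (- D) * (\<Prod>i<n. exp (k (w i))))"
        by (rule ennreal_leI)
      then show ?thesis using True by (simp add: ennreal_mult prod_nonneg prod_ennreal)
    qed simp
  qed
  also have "\<dots> = ennreal (exp (- D)) * (\<integral>\<^sup>+w. (\<Prod>i<n. ennreal (exp (k (w i)))) \<partial>?M)"
    by (rule nn_integral_cmult) measurable
  also have "(\<integral>\<^sup>+w. (\<Prod>i<n. ennreal (exp (k (w i)))) \<partial>?M) = (\<Prod>i<n. \<integral>\<^sup>+x. ennreal (exp (k x)) \<partial>N)"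
    by (rule product_nn_integral_prod) auto
  finally show ?thesis by simp
qed

text \<open>A draw \<open>(b, x, q)\<close> is observed as \<open>q\<close> if the contamination flag \<open>b\<close> is set and as \<open>x\<close> otherwise.\<close>

definition latent_law :: "real \<Rightarrow> 'a measure \<Rightarrow> 'a measure \<Rightarrow> (bool \<times> 'a \<times> 'a) measure" where
  "latent_law eps P Q = measure_pmf (bernoulli_pmf eps) \<Otimes>\<^sub>M (P \<Otimes>\<^sub>M Q)"

definition observe :: "bool \<times> 'a \<times> 'a \<Rightarrow> 'a" where
  "observe w = (if fst w then snd (snd w) else fst (snd w))"

context
  fixes P Q :: "'a measure" and eps :: real
  assumes P: "prob_space P" and Q: "prob_space Q" and setsQ: "sets Q = sets P"
    and eps: "0 \<le> eps" "eps \<le> 1"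
begin

interpretation P: prob_space P by (rule P)
interpretation Q: prob_space Q by (rule Q)
interpretation PQ: pair_prob_space P Q ..

lemma prob_space_latent_law: "prob_space (latent_law eps P Q)"
proof -
  interpret BP: pair_prob_space "measure_pmf (bernoulli_pmf eps)" "P \<Otimes>\<^sub>M Q" ..
  show ?thesis unfolding latent_law_def by unfold_locales
qed

lemma measurable_observe [measurable]: "observe \<in> measurable (latent_law eps P Q) P"
proof -
  have 1: "(\<lambda>w. fst (snd w)) \<in> measurable (latent_law eps P Q) P"
    unfolding latent_law_def by measurable
  have "(\<lambda>w. snd (snd w)) \<in> measurable (latent_law eps P Q) Q"
    unfolding latent_law_def by measurable
  then have 2: "(\<lambda>w. snd (snd w)) \<in> measurable (latent_law eps P Q) P"
    using setsQ measurable_cong_sets by blast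
  have 3: "Measurable.pred (latent_law eps P Q) fst" unfolding latent_law_def by measurable
  show ?thesis unfolding observe_def[abs_def] using 1 2 3 by measurable
qed

lemma nn_integral_latent_law:
  assumes [measurable]: "f \<in> borel_measurable (latent_law eps P Q)"
    and g [measurable]: "g \<in> borel_measurable P" "h \<in> borel_measurable Q"
    and f: "\<And>x q. f (False, x, q) = g x" "\<And>x q. f (True, x, q) = h q"
  shows "(\<integral>\<^sup>+w. f w \<partial>latent_law eps P Q)
    = ennreal (1 - eps) * (\<integral>\<^sup>+x. g x \<partial>P) + ennreal eps * (\<integral>\<^sup>+x. h x \<partial>Q)"
proof -
  have "(\<integral>\<^sup>+w. f w \<partial>latent_law eps P Q)
      = (\<integral>\<^sup>+b. \<integral>\<^sup>+z. f (b, z) \<partial>(P \<Otimes>\<^sub>M Q) \<partial>measure_pmf (bernoulli_pmf eps))"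
    using assms(1) unfolding latent_law_def
    by (subst PQ.nn_integral_fst[symmetric]) auto
  also have "\<dots> = ennreal (1 - eps) * (\<integral>\<^sup>+z. f (False, z) \<partial>(P \<Otimes>\<^sub>M Q))
      + ennreal eps * (\<integral>\<^sup>+z. f (True, z) \<partial>(P \<Otimes>\<^sub>M Q))"
    using eps by (subst nn_integral_bernoulli_pmf) (auto simp: mult.commute add.commute)
  also have "(\<integral>\<^sup>+z. f (False, z) \<partial>(P \<Otimes>\<^sub>M Q)) = (\<integral>\<^sup>+z. g (fst z) \<partial>(P \<Otimes>\<^sub>M Q))"
    by (intro nn_integral_cong) (auto simp: f split_beta)
  also have "\<dots> = (\<integral>\<^sup>+x. g x \<partial>P)"
    by (subst Q.nn_integral_fst[symmetric]) (auto simp: Q.emeasure_space_1)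
  also have "(\<integral>\<^sup>+z. f (True, z) \<partial>(P \<Otimes>\<^sub>M Q)) = (\<integral>\<^sup>+z. h (snd z) \<partial>(P \<Otimes>\<^sub>M Q))"
    by (intro nn_integral_cong) (auto simp: f split_beta)
  also have "\<dots> = (\<integral>\<^sup>+x. h x \<partial>Q)"
    by (subst Q.nn_integral_fst[symmetric]) (auto simp: P.emeasure_space_1)
  finally show ?thesis .
qed

text \<open>This coupling makes it possible to point at the contaminated indices of a sample. It
  also settles that the set function inside \<open>mixture\<close> is a measure, since
  \<open>measure_of\<close> falls back to the zero measure otherwise.\<close>

lemma mixture_eq_distr: "mixture eps P Q = distr (latent_law eps P Q) P observe"
proof -
  have "mixture eps P Q = measure_of (space P) (sets P) (emeasure (distr (latent_law eps P Q) P observe))"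
    unfolding mixture_def
  proof (rule measure_of_eq)
    fix A assume "A \<in> sigma_sets (space P) (sets P)"
    then have A [measurable]: "A \<in> sets P" by (simp add: sets.sigma_sets_eq)
    have [measurable]: "A \<in> sets Q" using A setsQ by simp
    have meas: "(\<lambda>w. indicator A (observe w) :: ennreal) \<in> borel_measurable (latent_law eps P Q)"
      by measurable
    have "emeasure (distr (latent_law eps P Q) P observe) A
        = (\<integral>\<^sup>+x. indicator A x \<partial>distr (latent_law eps P Q) P observe)" by simp
    also have "\<dots> = (\<integral>\<^sup>+w. indicator A (observe w) \<partial>latent_law eps P Q)"
      by (rule nn_integral_distr) auto
    also have "\<dots> = ennreal (1 - eps) * (\<integral>\<^sup>+x. indicator A x \<partial>P) + ennreal eps * (\<integral>\<^sup>+x. indicator A x \<partial>Q)"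
      by (rule nn_integral_latent_law[OF meas]) (auto simp: observe_def)
    finally show "ennreal (1 - eps) * emeasure P A + ennreal eps * emeasure Q A
        = emeasure (distr (latent_law eps P Q) P observe) A" by simp
  qed (simp add: sets.space_closed)
  also have "\<dots> = distr (latent_law eps P Q) P observe"
    using measure_of_of_measure[of "distr (latent_law eps P Q) P observe"] by simp
  finally show ?thesis .
qed

lemma latent_chernoff:
  assumes [measurable]: "h \<in> borel_measurable P"
  shows "emeasure (PiM {..<n} (\<lambda>_. latent_law eps P Q))
      {w \<in> space (PiM {..<n} (\<lambda>_. latent_law eps P Q)).
         (\<Sum>i<n. if fst (w i) then 0 else h (fst (snd (w i)))) > D} \<le> test_cost n P (h, D)"
proof -
  let ?N = "latent_law eps P Q"
  let ?I = "\<integral>\<^sup>+x. ennreal (exp (h x)) \<partial>P"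
  have [measurable]: "(\<lambda>w. if fst w then 0 else h (fst (snd w))) \<in> borel_measurable ?N"
    unfolding latent_law_def by measurable
  have "(\<integral>\<^sup>+w. ennreal (exp (if fst w then 0 else h (fst (snd w)))) \<partial>?N)
      = ennreal (1 - eps) * ?I + ennreal eps * (\<integral>\<^sup>+x. 1 \<partial>Q)"
    by (rule nn_integral_latent_law) auto
  also have "\<dots> \<le> ennreal (1 - eps) * max 1 ?I + ennreal eps * max 1 ?I"
    by (intro add_mono mult_left_mono) (auto simp: Q.emeasure_space_1)
  also have "\<dots> = max 1 ?I"
    using eps by (simp flip: distrib_right ennreal_plus)
  finally have le: "(\<integral>\<^sup>+w. ennreal (exp (if fst w then 0 else h (fst (snd w)))) \<partial>?N) \<le> max 1 ?I" .
  show ?thesis unfolding test_cost_def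
    by (rule order_trans[OF chernoff_PiM[OF prob_space_latent_law]])
      (auto intro!: mult_left_mono power_mono le)
qed

text \<open>The flag has exponential moment \<open>1 + eps * (exp 1 - 1) <= exp (2 * eps)\<close>,
  so exponent 1 is enough for a threshold that is a multiple of \<open>n * y\<close>.\<close>

lemma latent_contamination:
  "emeasure (PiM {..<n} (\<lambda>_. latent_law eps P Q))
      {w \<in> space (PiM {..<n} (\<lambda>_. latent_law eps P Q)).
         (\<Sum>i<n. if fst (w i) then 1 else 0) > m} \<le> ennreal (exp (2 * real n * eps - m))"
proof -
  let ?N = "latent_law eps P Q"
  have [measurable]: "(\<lambda>w. if fst w then 1 else 0 :: real) \<in> borel_measurable ?N"
    unfolding latent_law_def by measurable
  have "(\<integral>\<^sup>+w. ennreal (exp (if fst w then 1 else 0)) \<partial>?N)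
      = ennreal (1 - eps) * (\<integral>\<^sup>+x. 1 \<partial>P) + ennreal eps * (\<integral>\<^sup>+x. ennreal (exp 1) \<partial>Q)"
    by (rule nn_integral_latent_law) auto
  also have "\<dots> = ennreal (1 - eps + eps * exp 1)"
    using eps by (simp add: Q.emeasure_space_1 P.emeasure_space_1 flip: ennreal_mult ennreal_plus)
  also have "\<dots> \<le> ennreal (exp (2 * eps))"
  proof (rule ennreal_leI)
    have "1 - eps + eps * exp 1 \<le> 1 + 2 * eps"
      using eps exp_le mult_left_mono[of "exp 1" 3 eps] by simp
    also have "\<dots> \<le> exp (2 * eps)" by (rule exp_ge_add_one_self)
    finally show "1 - eps + eps * exp 1 \<le> exp (2 * eps)" .
  qed
  finally have le: "(\<integral>\<^sup>+w. ennreal (exp (if fst w then 1 else 0)) \<partial>?N) \<le> ennreal (exp (2 * eps))" .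
  have "ennreal (exp (- m)) * (\<integral>\<^sup>+w. ennreal (exp (if fst w then 1 else 0)) \<partial>?N) ^ n
     \<le> ennreal (exp (- m)) * ennreal (exp (2 * eps)) ^ n"
    by (intro mult_left_mono power_mono le) auto
  also have "\<dots> = ennreal (exp (2 * real n * eps - m))"
    by (simp add: ennreal_power exp_diff exp_minus field_simps flip: ennreal_mult exp_of_nat_mult)
  finally show ?thesis
    by (rule order_trans[OF chernoff_PiM[OF prob_space_latent_law], rotated]) simp
qed

text \<open>The passage from probability to pointwise statements. The flags are not functions of the
  observations, so the contaminated indices appear as an existential \<open>J\<close>; this makes
  \<open>E\<close> a finite union of measurable events in the sample space, while the tests are
  estimated on the latent space.\<close>

theorem contaminated_tests:
  fixes T :: "(('a \<Rightarrow> real) \<times> real) set"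
  assumes "finite T" and T: "\<And>h D. (h, D) \<in> T \<Longrightarrow> h \<in> borel_measurable P"
    and cost: "(\<Sum>\<tau>\<in>T. test_cost n P \<tau>) \<le> ennreal \<delta>" and "0 \<le> \<delta>"
    and R [measurable]: "Measurable.pred P R" "AE x in P. R x"
  shows "\<exists>E\<in>sets (sample_law n (mixture eps P Q)).
    measure (sample_law n (mixture eps P Q)) E \<ge> 1 - \<delta> - exp (2 * real n * eps - m) \<and>
    (\<forall>\<omega>\<in>E. \<exists>J\<subseteq>{..<n}. real (card J) \<le> m \<and> (\<forall>(h, D)\<in>T. (\<Sum>i\<in>{..<n} - J. h (\<omega> i)) \<le> D)
       \<and> (\<forall>i\<in>{..<n} - J. R (\<omega> i)))"
proof -
  let ?N = "latent_law eps P Q"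
  let ?W = "PiM {..<n} (\<lambda>_. ?N)"
  let ?S = "PiM {..<n} (\<lambda>_. P)"
  interpret N: prob_space ?N by (rule prob_space_latent_law)
  interpret W: prob_space ?W by (rule prob_space_PiM) (rule N.prob_space_axioms)
  have law: "sample_law n (mixture eps P Q) = distr ?W ?S (compose {..<n} observe)"
    unfolding sample_law_def mixture_eq_distr
    by (rule distr_PiM_finite_prob_space'[symmetric]) (auto intro: P.prob_space_axioms N.prob_space_axioms)
  have obs [measurable]: "compose {..<n} observe \<in> measurable ?W ?S"
    unfolding compose_def by measurable
  define good where "good = (\<lambda>\<omega> J. real (card J) \<le> m \<and> (\<forall>(h, D)\<in>T. (\<Sum>i\<in>{..<n} - J. h (\<omega> i)) \<le> D)
       \<and> (\<forall>i\<in>{..<n} - J. R (\<omega> i)))"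
  define E where "E = {\<omega> \<in> space ?S. \<exists>J\<in>Pow {..<n}. good \<omega> J}"
  have good_meas: "Measurable.pred ?S (\<lambda>\<omega>. good \<omega> J)" if J: "J \<in> Pow {..<n}" for J
  proof -
    have 1: "Measurable.pred ?S (\<lambda>\<omega>. \<forall>\<tau>\<in>T. (\<Sum>i\<in>{..<n} - J. fst \<tau> (\<omega> i)) \<le> snd \<tau>)"
    proof (rule pred_intros_finite(3)[OF \<open>finite T\<close>])
      fix \<tau> assume "\<tau> \<in> T"
      then have [measurable]: "fst \<tau> \<in> borel_measurable P" using T[of "fst \<tau>" "snd \<tau>"] by simp
      show "Measurable.pred ?S (\<lambda>\<omega>. (\<Sum>i\<in>{..<n} - J. fst \<tau> (\<omega> i)) \<le> snd \<tau>)" by measurable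
    qed
    have 2: "Measurable.pred ?S (\<lambda>\<omega>. \<forall>i\<in>{..<n} - J. R (\<omega> i))" by measurable
    show ?thesis unfolding good_def split_beta using 1 2 by measurable
  qed
  have E [measurable]: "E \<in> sets ?S"
    unfolding E_def using good_meas by measurable
  let ?V = "compose {..<n} observe -` E \<inter> space ?W"
  have V: "?V \<in> sets ?W" using E obs by (rule measurable_sets[rotated])
  define bad0 where "bad0 = {w \<in> space ?W. (\<Sum>i<n. if fst (w i) then 1 else 0) > m}"
  define bad where "bad = (\<lambda>\<tau> :: ('a \<Rightarrow> real) \<times> real. {w \<in> space ?W.
      (\<Sum>i<n. if fst (w i) then 0 else (fst \<tau>) (fst (snd (w i)))) > snd \<tau>})"
  have bad0_sets: "bad0 \<in> sets ?W"
  proof -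
    have [measurable]: "(\<lambda>w. if fst w then 1 else 0 :: real) \<in> borel_measurable ?N"
      unfolding latent_law_def by measurable
    show ?thesis unfolding bad0_def by measurable
  qed
  have bad_sets: "bad \<tau> \<in> sets ?W" if "\<tau> \<in> T" for \<tau>
  proof -
    have [measurable]: "fst \<tau> \<in> borel_measurable P" using T[of "fst \<tau>" "snd \<tau>"] that by simp
    have [measurable]: "(\<lambda>w. if fst w then 0 else (fst \<tau>) (fst (snd w))) \<in> borel_measurable ?N"
      unfolding latent_law_def by measurable
    show ?thesis unfolding bad_def by measurable
  qed
  have "AE w in ?N. R (fst (snd w))"
  proof -
    have [measurable]: "Measurable.pred ?N (\<lambda>w. R (fst (snd w)))"
      unfolding latent_law_def by measurable
    have *: "(\<integral>\<^sup>+w. indicator {w. \<not> R (fst (snd w))} w \<partial>?N) = 0"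
    proof -
      have "(\<integral>\<^sup>+z. indicator {z. \<not> R (fst z)} z \<partial>(P \<Otimes>\<^sub>M Q)) = (\<integral>\<^sup>+x. indicator {x. \<not> R x} x \<partial>P)"
        by (subst Q.nn_integral_fst[symmetric]) (auto simp: Q.emeasure_space_1 indicator_def intro!: nn_integral_cong)
      also have "\<dots> = 0"
        using R by (subst nn_integral_0_iff_AE) (auto simp: indicator_def)
      finally have "(\<integral>\<^sup>+z. indicator {z. \<not> R (fst z)} z \<partial>(P \<Otimes>\<^sub>M Q)) = 0" .
      moreover have "(\<integral>\<^sup>+w. indicator {w. \<not> R (fst (snd w))} w \<partial>?N)
        = (\<integral>\<^sup>+b. \<integral>\<^sup>+z. indicator {z. \<not> R (fst z)} z \<partial>(P \<Otimes>\<^sub>M Q) \<partial>measure_pmf (bernoulli_pmf eps))"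
        unfolding latent_law_def
        by (subst PQ.nn_integral_fst[symmetric]) (auto simp: indicator_def intro!: nn_integral_cong)
      ultimately show ?thesis by simp
    qed
    show ?thesis using *
      by (subst (asm) nn_integral_0_iff_AE) (auto simp: indicator_def split: if_splits)
  qed
  then have "AE w in ?W. R (fst (snd (w i)))" if "i < n" for i
    using that by (intro AE_PiM_component) (auto intro: N.prob_space_axioms)
  then have "AE w in ?W. \<forall>i\<in>{..<n}. R (fst (snd (w i)))"
    by (intro AE_finite_allI) auto
  then have incl: "AE w in ?W. w \<in> space ?W - ?V \<longrightarrow> w \<in> bad0 \<union> (\<Union>\<tau>\<in>T. bad \<tau>)"
  proof eventually_elim
    case (elim w)
    show ?case
    proof (rule impI, rule ccontr)
      assume w: "w \<in> space ?W - ?V" and nb: "w \<notin> bad0 \<union> (\<Union>\<tau>\<in>T. bad \<tau>)"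
      \<comment> \<open>The flagged indices serve as \<open>J\<close>: elsewhere the observation is
        the draw from \<open>P\<close>, so both test sums have the same terms.\<close>
      define J where "J = {i\<in>{..<n}. fst (w i)}"
      have cardJ: "(\<Sum>i<n. if fst (w i) then 1 else 0 :: real) = real (card J)"
        by (simp add: J_def sum.If_cases Int_def)
      have "good (compose {..<n} observe w) J" unfolding good_def
      proof (intro conjI ballI, goal_cases)
        case 1
        show ?case using nb w cardJ unfolding bad0_def by auto
      next
        case (2 \<tau>)
        have "(\<Sum>i\<in>{..<n} - J. fst \<tau> (compose {..<n} observe w i))
            = (\<Sum>i<n. if fst (w i) then 0 else (fst \<tau>) (fst (snd (w i))))"
          by (rule sum.mono_neutral_cong_left) (auto simp: J_def compose_def observe_def)
        also have "\<dots> \<le> snd \<tau>" using 2 nb w unfolding bad_def by auto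
        finally show ?case by (simp add: split_beta)
      next
        case (3 i)
        then show ?case using elim by (auto simp: J_def compose_def observe_def)
      qed
      moreover have "compose {..<n} observe w \<in> space ?S"
        using w measurable_space[OF obs, of w] by blast
      ultimately have "w \<in> ?V" using w by (auto simp: E_def J_def)
      then show False using w by simp
    qed
  qed
  have "emeasure ?W (space ?W - ?V) \<le> emeasure ?W (bad0 \<union> (\<Union>\<tau>\<in>T. bad \<tau>))"
    using incl bad0_sets bad_sets \<open>finite T\<close>
    by (intro emeasure_mono_AE sets.Un sets.finite_UN) simp_all
  also have "\<dots> \<le> emeasure ?W bad0 + (\<Sum>\<tau>\<in>T. emeasure ?W (bad \<tau>))"
    using bad0_sets bad_sets \<open>finite T\<close>
    by (intro order_trans[OF emeasure_subadditive] add_left_mono emeasure_subadditive_finite) auto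
  also have "\<dots> \<le> ennreal (exp (2 * real n * eps - m)) + (\<Sum>\<tau>\<in>T. test_cost n P \<tau>)"
  proof (intro add_mono sum_mono)
    show "emeasure ?W bad0 \<le> ennreal (exp (2 * real n * eps - m))"
      unfolding bad0_def by (rule latent_contamination)
    fix \<tau> assume "\<tau> \<in> T"
    then have "fst \<tau> \<in> borel_measurable P" using T[of "fst \<tau>" "snd \<tau>"] by simp
    from latent_chernoff[OF this, of n "snd \<tau>"]
    show "emeasure ?W (bad \<tau>) \<le> test_cost n P \<tau>" unfolding bad_def by simp
  qed
  also have "\<dots> \<le> ennreal (exp (2 * real n * eps - m)) + ennreal \<delta>"
    by (intro add_left_mono cost)
  also have "\<dots> = ennreal (exp (2 * real n * eps - m) + \<delta>)"
    using \<open>0 \<le> \<delta>\<close> by (intro ennreal_plus[symmetric]) auto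
  finally have "measure ?W (space ?W - ?V) \<le> exp (2 * real n * eps - m) + \<delta>"
    using \<open>0 \<le> \<delta>\<close> by (simp add: W.emeasure_eq_measure del: ennreal_plus)
  then have "measure ?W ?V \<ge> 1 - \<delta> - exp (2 * real n * eps - m)"
    using W.prob_compl[OF V] by linarith
  then have "measure (sample_law n (mixture eps P Q)) E \<ge> 1 - \<delta> - exp (2 * real n * eps - m)"
    unfolding law using E obs by (simp add: measure_distr)
  moreover have "E \<in> sets (sample_law n (mixture eps P Q))" unfolding law using E by simp
  moreover have "\<forall>\<omega>\<in>E. \<exists>J\<subseteq>{..<n}. good \<omega> J" unfolding E_def by blast
  ultimately show ?thesis unfolding good_def by blast
qed

end

section \<open>The standard Gaussian law in one and two dimensions\<close>

lemma prob_space_stdG: "prob_space stdG"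
  unfolding stdG_def by (rule prob_space_normal_density) simp

lemma sets_stdG [simp, measurable_cong]: "sets stdG = sets borel"
  by (simp add: stdG_def)

lemma space_stdG [simp]: "space stdG = UNIV"
  by (simp add: stdG_def)

interpretation stdG: prob_space stdG by (rule prob_space_stdG)

lemma prob_space_stdG2: "prob_space (stdG \<Otimes>\<^sub>M stdG)"
proof -
  interpret G: pair_prob_space stdG stdG ..
  show ?thesis by unfold_locales
qed

interpretation stdG2: prob_space "stdG \<Otimes>\<^sub>M stdG" by (rule prob_space_stdG2)

lemma distributed_stdG: "distributed stdG lborel (\<lambda>x. x) std_normal_density"
  unfolding distributed_def stdG_def by (auto simp: distr_id2 intro!: distr_id2)

lemma distr_uminus_stdG: "distr stdG borel uminus = stdG"
proof -
  have "distributed stdG lborel (\<lambda>x. 0 + (- 1) * x) (normal_density (0 + (- 1) * 0) (\<bar>- 1\<bar> * 1))"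
    by (rule stdG.normal_density_affine[OF distributed_stdG]) auto
  then have "distr stdG lborel uminus = stdG"
    unfolding distributed_def by (simp add: stdG_def)
  then show ?thesis by (metis distr_cong sets_lborel)
qed

lemma distr_linear_stdG:
  assumes fin: "finite I" and a: "(\<Sum>k\<in>I. (a k)\<^sup>2) = 1"
  shows "distr (PiM I (\<lambda>_. stdG)) borel (\<lambda>z. \<Sum>k\<in>I. a k * z k) = stdG"
proof -
  let ?M = "PiM I (\<lambda>_. stdG)"
  interpret M: prob_space ?M by (rule prob_space_PiM) (rule prob_space_stdG)
  have coord: "distr ?M borel (\<lambda>z. z k) = stdG" if "k \<in> I" for k
  proof -
    have "distr ?M borel (\<lambda>z. z k) = distr ?M stdG (\<lambda>z. z k)" by (rule distr_cong) auto
    then show ?thesis using that distr_PiM_component[of I "\<lambda>_. stdG" k] prob_space_stdG by simp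
  qed
  \<comment> \<open>Vanishing coefficients are dropped because \<open>sum_indep_normal\<close> wants
    positive standard deviations.\<close>
  define K where "K = {k\<in>I. a k \<noteq> 0}"
  have K: "finite K" "K \<subseteq> I" using fin by (auto simp: K_def)
  have sumK: "(\<Sum>k\<in>K. (a k)\<^sup>2) = 1"
    unfolding a[symmetric] using fin by (intro sum.mono_neutral_left) (auto simp: K_def)
  then have neK: "K \<noteq> {}" by auto
  \<comment> \<open>Independence of the coordinates is read off from their joint law being the
    product of the marginals.\<close>
  have "M.indep_vars (\<lambda>_. borel) (\<lambda>k z. z k) I"
  proof (subst M.indep_vars_iff_distr_eq_PiM')
    show "I \<noteq> {}" using neK K by auto
    show "M.random_variable borel (\<lambda>z. z k)" if "k \<in> I" for k using that by measurable
    have "distr ?M (PiM I (\<lambda>_. borel)) (\<lambda>z. \<lambda>i\<in>I. z i) = distr ?M ?M (\<lambda>z. z)"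
      by (rule distr_cong) (auto simp: space_PiM PiE_def extensional_restrict cong: sets_PiM_cong)
    also have "\<dots> = ?M" by simp
    also have "\<dots> = PiM I (\<lambda>i. distr ?M borel (\<lambda>z. z i))"
      by (rule PiM_cong) (auto simp: coord)
    finally show "distr ?M (PiM I (\<lambda>_. borel)) (\<lambda>z. \<lambda>i\<in>I. z i) = PiM I (\<lambda>i. distr ?M borel (\<lambda>z. z i))" .
  qed
  then have "M.indep_vars (\<lambda>_. borel) (\<lambda>k z. z k) K"
    by (rule M.indep_vars_subset) (rule K)
  then have ind: "M.indep_vars (\<lambda>_. borel) (\<lambda>k z. a k * z k) K"
    by (rule M.indep_vars_compose2) auto
  have dist: "distributed ?M lborel (\<lambda>z. a k * z k) (normal_density 0 \<bar>a k\<bar>)" if k: "k \<in> K" for k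
  proof -
    have kI: "k \<in> I" using k K by auto
    have "distr ?M lborel (\<lambda>z. z k) = distr ?M borel (\<lambda>z. z k)" by (rule distr_cong) auto
    then have "distributed ?M lborel (\<lambda>z. z k) std_normal_density"
      unfolding distributed_def using coord[OF kI] kI by (simp add: stdG_def)
    then have "distributed ?M lborel (\<lambda>z. 0 + a k * z k) (normal_density (0 + a k * 0) (\<bar>a k\<bar> * 1))"
      by (rule M.normal_density_affine) (use k in \<open>auto simp: K_def\<close>)
    then show ?thesis by simp
  qed
  have "distributed ?M lborel (\<lambda>z. \<Sum>k\<in>K. a k * z k) (normal_density (\<Sum>k\<in>K. 0) (sqrt (\<Sum>k\<in>K. \<bar>a k\<bar>\<^sup>2)))"
    by (rule M.sum_indep_normal[OF K(1) neK ind _ dist]) (auto simp: K_def)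
  then have "distr ?M lborel (\<lambda>z. \<Sum>k\<in>K. a k * z k) = stdG"
    by (simp add: sumK distributed_def stdG_def)
  moreover have "(\<Sum>k\<in>K. a k * z k) = (\<Sum>k\<in>I. a k * z k)" for z
    using fin by (intro sum.mono_neutral_left) (auto simp: K_def)
  moreover have "distr ?M borel (\<lambda>z. \<Sum>k\<in>I. a k * z k) = distr ?M lborel (\<lambda>z. \<Sum>k\<in>I. a k * z k)"
    by (rule distr_cong) auto
  ultimately show ?thesis by simp
qed

lemma std_normal_density_le: "std_normal_density x \<le> 1 / 2"
proof -
  have "4 \<le> 2 * pi" using pi_ge_two by simp
  then have "2 \<le> sqrt (2 * pi)" by (intro real_le_rsqrt) simp
  have "std_normal_density x \<le> 1 / sqrt (2 * pi) * 1"
    unfolding std_normal_density_def by (intro mult_left_mono) auto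
  also have "\<dots> \<le> 1 / 2" using \<open>2 \<le> sqrt (2 * pi)\<close> by (simp add: field_simps)
  finally show ?thesis .
qed

text \<open>A density of at most 1/2 on an interval of length \<open>2 * a\<close>.\<close>

lemma stdG_interval_le:
  assumes "0 \<le> a"
  shows "measure stdG {x. \<bar>x - c\<bar> \<le> a} \<le> a"
proof -
  have eq: "{x. \<bar>x - c\<bar> \<le> a} = {c - a..c + a}" by auto
  have "emeasure stdG {c - a..c + a} = (\<integral>\<^sup>+x. ennreal (std_normal_density x) * indicator {c - a..c + a} x \<partial>lborel)"
    unfolding stdG_def by (rule emeasure_density) auto
  also have "\<dots> \<le> (\<integral>\<^sup>+x. ennreal (1 / 2) * indicator {c - a..c + a} x \<partial>lborel)"
    by (intro nn_integral_mono mult_right_mono ennreal_leI std_normal_density_le) auto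
  also have "\<dots> = ennreal (1 / 2) * emeasure lborel {c - a..c + a}"
    by (rule nn_integral_cmult_indicator) simp
  also have "emeasure lborel {c - a..c + a} = ennreal (2 * a)" using assms by simp
  also have "ennreal (1 / 2) * ennreal (2 * a) = ennreal (1 / 2 * (2 * a))"
    using assms by (intro ennreal_mult[symmetric]) auto
  also have "\<dots> = ennreal a" by simp
  finally show ?thesis unfolding eq using assms by (simp add: stdG.emeasure_eq_measure)
qed

lemma stdG_interval_ge:
  assumes "\<And>x. c \<le> x \<Longrightarrow> x \<le> d \<Longrightarrow> q \<le> std_normal_density x" "0 \<le> q" "c \<le> d"
  shows "q * (d - c) \<le> measure stdG {c<..<d}"
proof -
  have "ennreal (q * (d - c)) = ennreal q * emeasure lborel {c<..<d}"
    using assms by (simp add: ennreal_mult)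
  also have "\<dots> = (\<integral>\<^sup>+x. ennreal q * indicator {c<..<d} x \<partial>lborel)"
    by (rule nn_integral_cmult_indicator[symmetric]) simp
  also have "\<dots> \<le> (\<integral>\<^sup>+x. ennreal (std_normal_density x) * indicator {c<..<d} x \<partial>lborel)"
    by (intro nn_integral_mono) (auto intro!: ennreal_leI assms simp: indicator_def)
  also have "\<dots> = emeasure stdG {c<..<d}"
    unfolding stdG_def by (rule emeasure_density[symmetric]) auto
  finally show ?thesis by (simp add: stdG.emeasure_eq_measure)
qed

lemma nn_integral_stdG_square: "(\<integral>\<^sup>+x. ennreal (x\<^sup>2) \<partial>stdG) = 1"
proof -
  have hb: "has_bochner_integral lborel (\<lambda>x. std_normal_density x * x\<^sup>2) 1"
    using std_normal_moment_even[of 1] by simp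
  have "(\<integral>\<^sup>+x. ennreal (x\<^sup>2) \<partial>stdG) = (\<integral>\<^sup>+x. ennreal (std_normal_density x) * ennreal (x\<^sup>2) \<partial>lborel)"
    unfolding stdG_def by (rule nn_integral_density) auto
  also have "\<dots> = (\<integral>\<^sup>+x. ennreal (std_normal_density x * x\<^sup>2) \<partial>lborel)"
    by (simp add: ennreal_mult)
  also have "\<dots> = ennreal (\<integral>x. std_normal_density x * x\<^sup>2 \<partial>lborel)"
    using hb by (intro nn_integral_eq_integral) (auto simp: has_bochner_integral_iff)
  also have "\<dots> = 1" using hb by (simp add: has_bochner_integral_iff)
  finally show ?thesis .
qed

lemma stdG_tail_le:
  assumes "0 < b"
  shows "measure stdG {x. \<bar>x\<bar> > b} \<le> 1 / b\<^sup>2"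
proof -
  have m: "{x::real. \<bar>x\<bar> > b} \<in> sets stdG" by simp
  have "emeasure stdG {x. \<bar>x\<bar> > b} = (\<integral>\<^sup>+x. indicator {x. \<bar>x\<bar> > b} x \<partial>stdG)" using m by simp
  also have "\<dots> \<le> (\<integral>\<^sup>+x. ennreal (1 / b\<^sup>2) * ennreal (x\<^sup>2) \<partial>stdG)"
  proof (rule nn_integral_mono)
    fix x
    show "indicator {x. \<bar>x\<bar> > b} x \<le> ennreal (1 / b\<^sup>2) * ennreal (x\<^sup>2)"
    proof (cases "\<bar>x\<bar> > b")
      case True
      then have "b\<^sup>2 \<le> x\<^sup>2" using assms by (metis abs_le_square_iff abs_of_pos less_imp_le)
      then have "1 \<le> 1 / b\<^sup>2 * x\<^sup>2" using assms by (simp add: field_simps)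
      then have "ennreal 1 \<le> ennreal (1 / b\<^sup>2 * x\<^sup>2)" by (rule ennreal_leI)
      then show ?thesis using True by (simp add: ennreal_mult flip: ennreal_mult)
    qed simp
  qed
  also have "\<dots> = ennreal (1 / b\<^sup>2) * (\<integral>\<^sup>+x. ennreal (x\<^sup>2) \<partial>stdG)"
    by (rule nn_integral_cmult) simp
  finally show ?thesis by (simp add: nn_integral_stdG_square stdG.emeasure_eq_measure)
qed

text \<open>The tilt doubles the variance: \<open>exp (x^2 / 4)\<close> times the standard density
  is \<open>sqrt 2\<close> times the density of variance 2, and \<open>sqrt 2 <= exp (1 / 2)\<close>
  because \<open>2 <= exp 1\<close>.\<close>

lemma nn_integral_stdG_exp_square: "(\<integral>\<^sup>+x. ennreal (exp (x\<^sup>2 / 4)) \<partial>stdG) \<le> ennreal (exp (1 / 2))"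
proof -
  have eq: "std_normal_density x * exp (x\<^sup>2 / 4) = sqrt 2 * normal_density 0 (sqrt 2) x" for x
  proof -
    have "std_normal_density x * exp (x\<^sup>2 / 4) = 1 / sqrt (2 * pi) * exp (- x\<^sup>2 / 2 + x\<^sup>2 / 4)"
      by (simp add: std_normal_density_def flip: exp_add)
    also have "- x\<^sup>2 / 2 + x\<^sup>2 / 4 = - x\<^sup>2 / 4" by simp
    finally show ?thesis by (simp add: normal_density_def real_sqrt_mult field_simps)
  qed
  have "(\<integral>\<^sup>+x. ennreal (exp (x\<^sup>2 / 4)) \<partial>stdG)
      = (\<integral>\<^sup>+x. ennreal (std_normal_density x) * ennreal (exp (x\<^sup>2 / 4)) \<partial>lborel)"
    unfolding stdG_def by (rule nn_integral_density) auto
  also have "\<dots> = (\<integral>\<^sup>+x. ennreal (sqrt 2) * ennreal (normal_density 0 (sqrt 2) x) \<partial>lborel)"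
    by (simp add: eq flip: ennreal_mult')
  also have "\<dots> = ennreal (sqrt 2) * (\<integral>\<^sup>+x. ennreal (normal_density 0 (sqrt 2) x) \<partial>lborel)"
    by (rule nn_integral_cmult) simp
  also have "(\<integral>\<^sup>+x. ennreal (normal_density 0 (sqrt 2) x) \<partial>lborel) = 1"
    by (subst nn_integral_eq_integral) auto
  also have "ennreal (sqrt 2) * 1 \<le> ennreal (exp (1 / 2))"
  proof -
    have "(2::real) \<le> exp 1" using exp_ge_add_one_self[of 1] by simp
    also have "\<dots> = (exp (1 / 2))\<^sup>2" by (simp add: power2_eq_square flip: exp_add)
    finally show ?thesis by (simp add: ennreal_leI real_le_lsqrt)
  qed
  finally show ?thesis .
qed

lemma stdG_singleton: "measure stdG {0} = 0"
  using stdG_interval_le[of 0 0] by (simp add: measure_le_0_iff)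

lemma stdG_half_line: "measure stdG {0..} = 1 / 2" "measure stdG {..0} = 1 / 2"
proof -
  have "measure stdG {..0} = measure (distr stdG borel uminus) {..0}"
    by (simp add: distr_uminus_stdG)
  also have "\<dots> = measure stdG (uminus -` {..0} \<inter> space stdG)" by (rule measure_distr) auto
  also have "uminus -` {..0} \<inter> space stdG = {0::real..}" by auto
  finally have sym: "measure stdG {..0} = measure stdG {0..}" .
  have un: "{..0} = {..<0} \<union> {0::real}" by auto
  have "measure stdG {..0} = measure stdG {..<0} + measure stdG {0}"
    unfolding un by (rule stdG.finite_measure_Union) auto
  moreover have "measure stdG ({..<0} \<union> {0..}) = measure stdG {..<0} + measure stdG {0..}"
    by (rule stdG.finite_measure_Union) auto
  moreover have "{..<0} \<union> {0::real..} = UNIV" by auto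
  ultimately show "measure stdG {0..} = 1 / 2" "measure stdG {..0} = 1 / 2"
    using sym stdG.prob_space by (auto simp: stdG_singleton)
qed

section \<open>Quadrants, strips and wedges in the Gaussian plane\<close>

abbreviation stdG2 :: "(real \<times> real) measure" where "stdG2 \<equiv> stdG \<Otimes>\<^sub>M stdG"

lemma stdG2_Times:
  assumes "A \<in> sets borel" "B \<in> sets borel"
  shows "measure stdG2 (A \<times> B) = measure stdG A * measure stdG B"
  using assms stdG.emeasure_pair_measure_Times[of A stdG B]
  by (simp add: measure_def enn2real_mult)

lemma stdG2_quadrants: "measure stdG2 {(g, r). g * r \<ge> 0} = 1 / 2"
proof -
  let ?A = "{0<..} \<times> {0..} :: (real \<times> real) set" and ?B = "{..<0} \<times> {..0} :: (real \<times> real) set"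
  let ?C = "{0} \<times> UNIV :: (real \<times> real) set"
  have compl: "measure stdG (UNIV - A) = 1 - measure stdG A" if "A \<in> sets borel" for A
    using stdG.prob_compl[of A] that by simp
  have "UNIV - {..0} = {0::real<..}" "UNIV - {0..} = {..<0::real}" by auto
  then have half: "measure stdG {0<..} = 1 / 2" "measure stdG {..<0} = 1 / 2"
    using compl[of "{..0}"] compl[of "{0..}"] by (simp_all add: stdG_half_line)
  have eq: "{(g, r). g * r \<ge> 0} = (?A \<union> ?B) \<union> ?C"
    by (auto simp: zero_le_mult_iff)
  have "measure stdG2 ((?A \<union> ?B) \<union> ?C) = measure stdG2 (?A \<union> ?B) + measure stdG2 ?C"
    by (rule stdG2.finite_measure_Union) auto
  also have "measure stdG2 (?A \<union> ?B) = measure stdG2 ?A + measure stdG2 ?B"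
    by (rule stdG2.finite_measure_Union) auto
  finally show ?thesis unfolding eq by (simp add: stdG2_Times half stdG_half_line stdG_singleton)
qed

text \<open>Given \<open>g\<close>, the second window is an interval of half-width \<open>a\<close>
  for \<open>r\<close> centred at \<open>t * g\<close>; the interval bound is uniform in the centre,
  hence the estimate is uniform in \<open>t\<close>.\<close>

lemma stdG2_flip_strip:
  assumes "0 \<le> a"
  shows "measure stdG2 {(g, r). \<bar>g\<bar> \<le> a \<or> \<bar>r - t * g\<bar> \<le> a} \<le> 2 * a"
proof -
  let ?A = "{(g, r). \<bar>g\<bar> \<le> a} :: (real \<times> real) set" and ?B = "{(g, r). \<bar>r - t * g\<bar> \<le> a}"
  have sp: "space stdG2 = UNIV" by (simp add: space_pair_measure)
  have Am: "?A \<in> sets stdG2" and Bm: "?B \<in> sets stdG2"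
  proof -
    have "Measurable.pred stdG2 (\<lambda>x. \<bar>fst x\<bar> \<le> a)" "Measurable.pred stdG2 (\<lambda>x. \<bar>snd x - t * fst x\<bar> \<le> a)"
      by measurable
    then show "?A \<in> sets stdG2" "?B \<in> sets stdG2" by (simp_all add: pred_def sp case_prod_unfold)
  qed
  have "{(g, r). \<bar>g\<bar> \<le> a \<or> \<bar>r - t * g\<bar> \<le> a} = ?A \<union> ?B" by auto
  then have "measure stdG2 {(g, r). \<bar>g\<bar> \<le> a \<or> \<bar>r - t * g\<bar> \<le> a} \<le> measure stdG2 ?A + measure stdG2 ?B"
    using measure_Un_le[OF Am Bm] by simp
  moreover have "measure stdG2 ?A \<le> a"
  proof -
    have "?A = {x. \<bar>x - 0\<bar> \<le> a} \<times> UNIV" by auto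
    then have "measure stdG2 ?A = measure stdG {x. \<bar>x - 0\<bar> \<le> a} * measure stdG UNIV"
      using stdG2_Times[of "{x. \<bar>x - 0\<bar> \<le> a}" UNIV] by simp
    then show ?thesis using stdG_interval_le[OF assms, of 0] stdG.prob_space by simp
  qed
  moreover have "measure stdG2 ?B \<le> a"
  proof -
    have "emeasure stdG2 ?B = (\<integral>\<^sup>+g. emeasure stdG (Pair g -` ?B) \<partial>stdG)"
      by (rule stdG.emeasure_pair_measure_alt[OF Bm])
    also have "\<dots> \<le> (\<integral>\<^sup>+g. ennreal a \<partial>stdG)"
    proof (rule nn_integral_mono)
      fix g
      have "Pair g -` ?B = {x. \<bar>x - t * g\<bar> \<le> a}" by auto
      then show "emeasure stdG (Pair g -` ?B) \<le> ennreal a"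
        using stdG_interval_le[OF assms, of "t * g"] by (simp add: stdG.emeasure_eq_measure ennreal_leI)
    qed
    also have "\<dots> = ennreal a" using stdG.emeasure_space_1 by simp
    finally show ?thesis using assms by (simp add: stdG2.emeasure_eq_measure)
  qed
  ultimately show ?thesis by simp
qed

text \<open>The wedge loses at least the box \<open>1 < g < 2\<close>, \<open>0 < r < t\<close>, where the densities are bounded below
  by their values at 2 and 1.\<close>

definition slope_const :: real where
  "slope_const = std_normal_density 2 * std_normal_density 1"

lemma slope_const_pos: "0 < slope_const"
  unfolding slope_const_def by (intro mult_pos_pos normal_density_pos) auto

lemma std_normal_density_mono_abs:
  assumes "0 \<le> x" "x \<le> b"
  shows "std_normal_density b \<le> std_normal_density x"
  unfolding std_normal_density_def using assms
  by (intro mult_left_mono) (auto intro: power_mono)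

lemma stdG2_wedge_le:
  assumes "0 \<le> t" "t \<le> 1"
  shows "measure stdG2 {(g, r). g * r \<ge> t * g\<^sup>2} \<le> 1 / 2 - slope_const * t"
proof -
  let ?W = "{1<..<2} \<times> {0<..<t}" and ?H = "{(g, r). g * r \<ge> 0} :: (real \<times> real) set"
  have sp: "space stdG2 = UNIV" by (simp add: space_pair_measure)
  have Hm: "?H \<in> sets stdG2"
  proof -
    have "Measurable.pred stdG2 (\<lambda>x. fst x * snd x \<ge> 0)" by measurable
    then show ?thesis by (simp add: pred_def sp case_prod_unfold)
  qed
  have sub: "{(g, r). g * r \<ge> t * g\<^sup>2} \<subseteq> ?H - ?W"
  proof (rule subsetI, clarify)
    fix g r :: real assume gr: "g * r \<ge> t * g\<^sup>2"
    have "(g, r) \<notin> ?W"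
    proof
      assume "(g, r) \<in> ?W"
      then have g: "1 < g" and r: "r < t" by auto
      have "g * r < g * t" using g r by simp
      also have "\<dots> \<le> g * t * g" using mult_left_mono[of 1 g "g * t"] g assms by simp
      finally show False using gr by (simp add: power2_eq_square algebra_simps)
    qed
    moreover have "0 \<le> t * g\<^sup>2" using assms by simp
    ultimately show "(g, r) \<in> ?H - ?W" using gr by auto
  qed
  have WH: "?W \<subseteq> ?H" by auto
  have "measure stdG2 {(g, r). g * r \<ge> t * g\<^sup>2} \<le> measure stdG2 (?H - ?W)"
    using Hm by (intro stdG2.finite_measure_mono sub) auto
  also have "\<dots> = measure stdG2 ?H - measure stdG2 ?W"
    using Hm by (intro stdG2.finite_measure_Diff WH) auto
  also have "measure stdG2 ?W = measure stdG {1<..<2} * measure stdG {0<..<t}"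
    by (simp add: stdG2_Times)
  finally have "measure stdG2 {(g, r). g * r \<ge> t * g\<^sup>2}
      \<le> measure stdG2 ?H - measure stdG {1<..<2} * measure stdG {0<..<t}" .
  moreover have "std_normal_density 2 * (2 - 1) * (std_normal_density 1 * (t - 0)) \<le> measure stdG {1<..<2} * measure stdG {0<..<t}"
    using assms by (intro mult_mono stdG_interval_ge std_normal_density_mono_abs) (auto intro!: mult_nonneg_nonneg)
  ultimately show ?thesis by (simp add: stdG2_quadrants slope_const_def)
qed

section \<open>Linear functionals under the regression model\<close>

lemma cov_factor_spec:
  assumes "is_cov_matrix p Sg" "i < p" "j < p"
  shows "(\<Sum>k<p. cov_factor p Sg i k * cov_factor p Sg j k) = Sg i j"
proof -
  have "\<exists>A. \<forall>i\<in>{..<p}. \<forall>j\<in>{..<p}. (\<Sum>k\<in>{..<p}. A i k * A j k) = Sg i j"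
    using assms by (intro psd_factor) (auto simp: is_cov_matrix_def quadf_def)
  then have "\<exists>A. \<forall>i<p. \<forall>j<p. (\<Sum>k<p. A i k * A j k) = Sg i j" by (simp add: Ball_def)
  from someI_ex[OF this] show ?thesis using assms by (simp add: cov_factor_def)
qed

lemma quadf_cov_factor:
  assumes "is_cov_matrix p Sg"
  shows "quadf p Sg v = (\<Sum>k<p. (\<Sum>i<p. v i * cov_factor p Sg i k)\<^sup>2)"
  unfolding quadf_def using cov_factor_spec[OF assms] by (intro quadf_factor) auto

lemma dotp_matvec: "dotp p v (matvec p A z) = (\<Sum>k<p. (\<Sum>i<p. v i * A i k) * z k)"
  unfolding dotp_def matvec_def
  by (simp add: sum_distrib_left sum_distrib_right mult.assoc) (rule sum.swap)

lemma dotp_commute: "dotp p u v = dotp p v u"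
  by (simp add: dotp_def mult.commute)

lemma measurable_dotp [measurable]: "dotp p v \<in> borel_measurable (Xspace p)"
  unfolding dotp_def Xspace_def by measurable

definition resid :: "nat \<Rightarrow> real \<Rightarrow> (nat \<Rightarrow> real) \<Rightarrow> (nat \<Rightarrow> real) \<times> real \<Rightarrow> real" where
  "resid p sg beta w = (snd w - dotp p (fst w) beta) / sg"

lemma measurable_fst_XY [measurable]: "fst \<in> measurable (XYspace p) (Xspace p)"
  unfolding XYspace_def by measurable

lemma measurable_resid [measurable]: "resid p sg beta \<in> borel_measurable (XYspace p)"
proof -
  have "(\<lambda>w. dotp p (fst w) beta) \<in> borel_measurable (XYspace p)"
    unfolding dotp_commute[of p _ beta] by measurable
  moreover have "snd \<in> borel_measurable (XYspace p)" unfolding XYspace_def by measurable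
  ultimately show ?thesis unfolding resid_def by measurable
qed

abbreviation dirvar :: "nat \<Rightarrow> (nat \<Rightarrow> real) \<Rightarrow> (nat \<Rightarrow> real) \<times> real \<Rightarrow> real" where
  "dirvar p v w \<equiv> dotp p v (fst w)"

text \<open>Almost surely \<open>x\<close> lies in the range of the covariance factor, so \<open>dotp p v x\<close> is controlled by the
  quadratic form even where the latter degenerates. Rational directions keep the property measurable.\<close>

definition dominated :: "nat \<Rightarrow> (nat \<Rightarrow> nat \<Rightarrow> real) \<Rightarrow> (nat \<Rightarrow> real) \<Rightarrow> bool" where
  "dominated p Sg x \<longleftrightarrow> (\<exists>M::nat. \<forall>v\<in>{..<p} \<rightarrow>\<^sub>E \<rat>. (dotp p v x)\<^sup>2 \<le> real M * quadf p Sg v)"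

text \<open>Both sides are continuous in \<open>v\<close>, and the rounded vectors
  \<open>w m\<close> have rational coordinates and converge to \<open>v\<close>.\<close>

lemma dominatedD:
  assumes "dominated p Sg x"
  obtains M where "0 \<le> M" "\<And>v. (dotp p v x)\<^sup>2 \<le> M * quadf p Sg v"
proof -
  obtain M :: nat where M: "\<And>v. v \<in> {..<p} \<rightarrow>\<^sub>E \<rat> \<Longrightarrow> (dotp p v x)\<^sup>2 \<le> real M * quadf p Sg v"
    using assms by (auto simp: dominated_def)
  have "(dotp p v x)\<^sup>2 \<le> real M * quadf p Sg v" for v
  proof -
    define w where "w = (\<lambda>m::nat. \<lambda>j\<in>{..<p}. real_of_int \<lfloor>v j * Suc m\<rfloor> / Suc m)"
    have w: "(\<lambda>m. w m j) \<longlonglongrightarrow> v j" if "j < p" for j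
    proof -
      have "(\<lambda>m. real_of_int \<lfloor>v j * Suc m\<rfloor> / Suc m) \<longlonglongrightarrow> v j"
      proof (rule tendsto_sandwich)
        show "\<forall>\<^sub>F m in sequentially. v j - 1 / Suc m \<le> real_of_int \<lfloor>v j * Suc m\<rfloor> / Suc m"
        proof (intro always_eventually allI)
          fix m
          have "v j * Suc m - 1 \<le> real_of_int \<lfloor>v j * Suc m\<rfloor>" by linarith
          then have "(v j * Suc m - 1) / Suc m \<le> real_of_int \<lfloor>v j * Suc m\<rfloor> / Suc m"
            by (rule divide_right_mono) simp
          then show "v j - 1 / Suc m \<le> real_of_int \<lfloor>v j * Suc m\<rfloor> / Suc m"
            by (simp add: diff_divide_distrib)
        qed
        show "\<forall>\<^sub>F m in sequentially. real_of_int \<lfloor>v j * Suc m\<rfloor> / Suc m \<le> v j"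
          by (intro always_eventually allI) (simp add: divide_le_eq)
        show "(\<lambda>m. v j - 1 / Suc m) \<longlonglongrightarrow> v j"
          using tendsto_diff[OF tendsto_const LIMSEQ_inverse_real_of_nat, of "v j"]
          by (simp add: inverse_eq_divide)
      qed simp
      then show ?thesis using that by (simp add: w_def)
    qed
    have wM: "(dotp p (w m) x)\<^sup>2 \<le> real M * quadf p Sg (w m)" for m
      by (rule M) (auto simp: w_def)
    have "(\<lambda>m. (dotp p (w m) x)\<^sup>2) \<longlonglongrightarrow> (dotp p v x)\<^sup>2"
      unfolding dotp_def by (intro tendsto_intros w) auto
    moreover have "(\<lambda>m. real M * quadf p Sg (w m)) \<longlonglongrightarrow> real M * quadf p Sg v"
      unfolding quadf_def by (intro tendsto_intros w) auto
    ultimately show ?thesis using wM by (intro LIMSEQ_le) auto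
  qed
  then show ?thesis using that[of "real M"] by simp
qed

lemma pred_dominated [measurable]: "Measurable.pred (Xspace p) (dominated p Sg)"
proof -
  have "countable ({..<p} \<rightarrow>\<^sub>E (\<rat> :: real set))" by (intro countable_PiE) (auto simp: countable_rat)
  then show ?thesis unfolding dominated_def by measurable
qed

text \<open>For \<open>x = A z\<close> the functional is the inner product of \<open>z\<close> with
  a vector whose squared length is the form; \<open>M\<close> is any natural number above the
  squared length of \<open>z\<close>.\<close>

lemma dominated_matvec:
  assumes "is_cov_matrix p Sg"
  shows "dominated p Sg (matvec p (cov_factor p Sg) z)"
proof -
  obtain M where M: "(\<Sum>k<p. (z k)\<^sup>2) \<le> real M" using real_arch_simple by blast
  have "(dotp p v (matvec p (cov_factor p Sg) z))\<^sup>2 \<le> real M * quadf p Sg v" for v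
  proof -
    have "(dotp p v (matvec p (cov_factor p Sg) z))\<^sup>2 \<le> quadf p Sg v * (\<Sum>k<p. (z k)\<^sup>2)"
      unfolding dotp_matvec quadf_cov_factor[OF assms] by (rule Cauchy_Schwarz_ineq_sum)
    also have "\<dots> \<le> quadf p Sg v * real M"
      using M assms by (intro mult_left_mono) (auto simp: is_cov_matrix_def)
    finally show ?thesis by (simp add: mult.commute)
  qed
  then show ?thesis unfolding dominated_def by blast
qed

lemma sets_P_beta [simp, measurable_cong]: "sets (P_beta p Sg sg beta) = sets (XYspace p)"
  unfolding P_beta_def by simp

lemma measurable_matvec [measurable]: "matvec p A \<in> measurable (PiM {..<p} (\<lambda>_. stdG)) (Xspace p)"
  unfolding matvec_def Xspace_def by measurable

section \<open>The regression model seen through one direction and the residual\<close>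

context
  fixes p :: nat and Sg :: "nat \<Rightarrow> nat \<Rightarrow> real" and sg :: real and beta :: "nat \<Rightarrow> real"
  assumes cov: "is_cov_matrix p Sg" and sg: "0 < sg"
begin

definition latent_map :: "(nat \<Rightarrow> real) \<times> real \<Rightarrow> (nat \<Rightarrow> real) \<times> real" where
  "latent_map = (\<lambda>(z, xi). (matvec p (cov_factor p Sg) z,
     dotp p beta (matvec p (cov_factor p Sg) z) + sg * xi))"

lemma measurable_latent_map [measurable]:
  "latent_map \<in> measurable (PiM {..<p} (\<lambda>_. stdG) \<Otimes>\<^sub>M stdG) (XYspace p)"
  unfolding latent_map_def XYspace_def by measurable

lemma P_beta_eq_distr: "P_beta p Sg sg beta = distr (PiM {..<p} (\<lambda>_. stdG) \<Otimes>\<^sub>M stdG) (XYspace p) latent_map"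
proof -
  let ?Z = "PiM {..<p} (\<lambda>_. stdG)"
  let ?A = "matvec p (cov_factor p Sg)"
  have id: "distr stdG stdG (\<lambda>x. x) = stdG" by simp
  have "gauss_vec p Sg \<Otimes>\<^sub>M stdG = distr ?Z (Xspace p) ?A \<Otimes>\<^sub>M distr stdG stdG (\<lambda>x. x)"
    by (simp add: gauss_vec_def)
  also have "\<dots> = distr (?Z \<Otimes>\<^sub>M stdG) (Xspace p \<Otimes>\<^sub>M stdG) (\<lambda>(z, xi). (?A z, xi))"
    by (rule pair_measure_distr) (auto simp: stdG.sigma_finite_measure_axioms)
  finally have eq: "gauss_vec p Sg \<Otimes>\<^sub>M stdG = \<dots>" .
  have [measurable]: "(\<lambda>(x, xi). (x, dotp p beta x + sg * xi)) \<in> measurable (Xspace p \<Otimes>\<^sub>M stdG) (XYspace p)"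
    unfolding XYspace_def by measurable
  show ?thesis unfolding P_beta_def eq
    by (subst distr_distr) (auto simp: latent_map_def comp_def split_beta intro!: distr_cong)
qed

lemma prob_space_P_beta: "prob_space (P_beta p Sg sg beta)"
proof -
  interpret Z: prob_space "PiM {..<p} (\<lambda>_. stdG)" by (rule prob_space_PiM) (rule prob_space_stdG)
  interpret ZG: pair_prob_space "PiM {..<p} (\<lambda>_. stdG)" stdG ..
  have "prob_space (PiM {..<p} (\<lambda>_. stdG) \<Otimes>\<^sub>M stdG)" by unfold_locales
  then show ?thesis unfolding P_beta_eq_distr by (rule prob_space.prob_space_distr) measurable
qed

lemma AE_dominated: "AE w in P_beta p Sg sg beta. dominated p Sg (fst w)"
proof -
  have "{w \<in> space (XYspace p). dominated p Sg (fst w)} \<in> sets (XYspace p)" by measurable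
  then show ?thesis unfolding P_beta_eq_distr
    by (subst AE_distr_iff[OF measurable_latent_map])
      (auto simp: latent_map_def dominated_matvec[OF cov] split_beta)
qed

text \<open>The standardised residual is the noise \<open>xi\<close> itself, independent of the
  design, and the direction variable is a linear form in \<open>z\<close> with coefficients of unit
  length. Hence the later probabilities for a unit direction are planar and free of
  \<open>p\<close>, \<open>Sg\<close> and \<open>beta\<close>.\<close>

lemma distr_P_beta_pair:
  assumes "quadf p Sg v = 1"
  shows "distr (P_beta p Sg sg beta) (borel \<Otimes>\<^sub>M borel) (\<lambda>w. (dirvar p v w, resid p sg beta w)) = stdG2"
proof -
  let ?Z = "PiM {..<p} (\<lambda>_. stdG)"
  let ?a = "\<lambda>k. \<Sum>i<p. v i * cov_factor p Sg i k"
  have "distr (P_beta p Sg sg beta) (borel \<Otimes>\<^sub>M borel) (\<lambda>w. (dirvar p v w, resid p sg beta w))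
    = distr (?Z \<Otimes>\<^sub>M stdG) (borel \<Otimes>\<^sub>M borel) (\<lambda>(z, xi). (\<Sum>k<p. ?a k * z k, xi))"
    unfolding P_beta_eq_distr
  proof (subst distr_distr[OF _ measurable_latent_map])
    show "(\<lambda>w. (dirvar p v w, resid p sg beta w)) \<in> measurable (XYspace p) (borel \<Otimes>\<^sub>M borel)"
      by measurable
    have "(\<lambda>w. (dirvar p v w, resid p sg beta w)) \<circ> latent_map = (\<lambda>(z, xi). (\<Sum>k<p. ?a k * z k, xi))"
      using sg by (auto simp: fun_eq_iff latent_map_def resid_def dotp_matvec[of p v]
          dotp_commute[of p "matvec _ _ _" beta])
    then show "distr (?Z \<Otimes>\<^sub>M stdG) (borel \<Otimes>\<^sub>M borel)
       ((\<lambda>w. (dirvar p v w, resid p sg beta w)) \<circ> latent_map)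
     = distr (?Z \<Otimes>\<^sub>M stdG) (borel \<Otimes>\<^sub>M borel) (\<lambda>(z, xi). (\<Sum>k<p. ?a k * z k, xi))" by simp
  qed
  also have "\<dots> = distr ?Z borel (\<lambda>z. \<Sum>k<p. ?a k * z k) \<Otimes>\<^sub>M distr stdG borel (\<lambda>x. x)"
  proof (rule pair_measure_distr[symmetric])
    show "sigma_finite_measure (distr stdG borel (\<lambda>x. x))"
      by (intro prob_space_imp_sigma_finite stdG.prob_space_distr) simp
  qed measurable
  also have "distr ?Z borel (\<lambda>z. \<Sum>k<p. ?a k * z k) = stdG"
    using assms by (intro distr_linear_stdG) (auto simp: quadf_cov_factor[OF cov])
  also have "distr stdG borel (\<lambda>x. x) = stdG" by (rule distr_id2) simp
  finally show ?thesis .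
qed

lemma distr_P_beta_dirvar:
  assumes "quadf p Sg v = 1"
  shows "distr (P_beta p Sg sg beta) borel (dirvar p v) = stdG"
proof -
  have "distr (P_beta p Sg sg beta) borel (dirvar p v)
      = distr (distr (P_beta p Sg sg beta) (borel \<Otimes>\<^sub>M borel) (\<lambda>w. (dirvar p v w, resid p sg beta w))) borel fst"
    by (subst distr_distr) (auto simp: comp_def)
  also have "\<dots> = distr stdG2 stdG fst" unfolding distr_P_beta_pair[OF assms] by (rule distr_cong) auto
  also have "\<dots> = stdG" by (rule stdG.distr_pair_fst)
  finally show ?thesis .
qed

lemma measure_P_beta_pair:
  assumes "quadf p Sg v = 1" "B \<in> sets (borel \<Otimes>\<^sub>M borel)"
  shows "measure (P_beta p Sg sg beta) {w \<in> space (P_beta p Sg sg beta). (dirvar p v w, resid p sg beta w) \<in> B} = measure stdG2 B"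
  unfolding distr_P_beta_pair[OF assms(1), symmetric] using assms(2)
  by (subst measure_distr) (auto intro!: arg_cong[where f="measure (P_beta p Sg sg beta)"])

lemma P_beta_flip_strip:
  assumes "quadf p Sg v = 1" "0 \<le> a"
  shows "measure (P_beta p Sg sg beta) {w \<in> space (P_beta p Sg sg beta). \<bar>dirvar p v w\<bar> \<le> a \<or> \<bar>resid p sg beta w - t * dirvar p v w\<bar> \<le> a} \<le> 2 * a"
proof -
  let ?B = "{(g, r). \<bar>g\<bar> \<le> a \<or> \<bar>r - t * g\<bar> \<le> a} :: (real \<times> real) set"
  have "Measurable.pred (borel \<Otimes>\<^sub>M borel) (\<lambda>x::real\<times>real. \<bar>fst x\<bar> \<le> a \<or> \<bar>snd x - t * fst x\<bar> \<le> a)"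
    by measurable
  then have "?B \<in> sets (borel \<Otimes>\<^sub>M borel)"
    by (simp add: pred_def space_pair_measure case_prod_unfold)
  from measure_P_beta_pair[OF assms(1) this] show ?thesis
    using stdG2_flip_strip[OF assms(2), of t] by simp
qed

lemma wedge_sets: "{(g, r). g * r \<ge> t * g\<^sup>2} \<in> sets (borel \<Otimes>\<^sub>M borel :: (real \<times> real) measure)"
proof -
  have "Measurable.pred (borel \<Otimes>\<^sub>M borel) (\<lambda>x::real\<times>real. fst x * snd x \<ge> t * (fst x)\<^sup>2)"
    by measurable
  then show ?thesis by (simp add: pred_def space_pair_measure case_prod_unfold)
qed

lemma P_beta_wedge_zero:
  assumes "quadf p Sg v = 1"
  shows "measure (P_beta p Sg sg beta) {w \<in> space (P_beta p Sg sg beta). dirvar p v w * resid p sg beta w \<ge> 0} = 1 / 2"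
  using measure_P_beta_pair[OF assms wedge_sets[of 0]] stdG2_quadrants by simp

lemma P_beta_wedge_le:
  assumes "quadf p Sg v = 1" "0 \<le> t" "t \<le> 1"
  shows "measure (P_beta p Sg sg beta) {w \<in> space (P_beta p Sg sg beta). dirvar p v w * resid p sg beta w \<ge> t * (dirvar p v w)\<^sup>2} \<le> 1 / 2 - slope_const * t"
  using measure_P_beta_pair[OF assms(1) wedge_sets[of t]] stdG2_wedge_le[OF assms(2,3)] by simp

lemma nn_integral_P_beta_exp_square:
  assumes "quadf p Sg v = 1"
  shows "(\<integral>\<^sup>+w. ennreal (exp ((dirvar p v w)\<^sup>2 / 4)) \<partial>P_beta p Sg sg beta) \<le> ennreal (exp (1 / 2))"
proof -
  have "(\<integral>\<^sup>+w. ennreal (exp ((dirvar p v w)\<^sup>2 / 4)) \<partial>P_beta p Sg sg beta) = (\<integral>\<^sup>+x. ennreal (exp (x\<^sup>2 / 4)) \<partial>distr (P_beta p Sg sg beta) borel (dirvar p v))"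
    by (rule nn_integral_distr[symmetric]) auto
  then show ?thesis using nn_integral_stdG_exp_square by (simp add: distr_P_beta_dirvar[OF assms])
qed

text \<open>Chebyshev for the normalised direction. A difference of directions can have vanishing
  form even when it is nonzero; normalising then fails, and almost sure domination gives probability
  0.\<close>

lemma P_beta_tail_le:
  assumes "0 < a"
  shows "measure (P_beta p Sg sg beta) {w \<in> space (P_beta p Sg sg beta). \<bar>dirvar p v w\<bar> > a} \<le> quadf p Sg v / a\<^sup>2"
proof (cases "quadf p Sg v = 0")
  case True
  interpret prob_space "P_beta p Sg sg beta" by (rule prob_space_P_beta)
  have m: "{w \<in> space (P_beta p Sg sg beta). \<bar>dirvar p v w\<bar> > a} \<in> sets (P_beta p Sg sg beta)" by measurable
  have "AE w in P_beta p Sg sg beta. \<not> \<bar>dirvar p v w\<bar> > a"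
    using AE_dominated
  proof eventually_elim
    case (elim w)
    then obtain M where "(dirvar p v w)\<^sup>2 \<le> M * quadf p Sg v" by (rule dominatedD) blast
    then show ?case using True assms by simp
  qed
  then have "measure (P_beta p Sg sg beta) {w \<in> space (P_beta p Sg sg beta). \<bar>dirvar p v w\<bar> > a} = 0"
    using m by (subst prob_Collect_eq_0) auto
  then show ?thesis using True by simp
next
  case False
  define q where "q = sqrt (quadf p Sg v)"
  have quad0: "quadf p Sg v \<ge> 0" using cov by (simp add: is_cov_matrix_def)
  have q: "0 < q" "q\<^sup>2 = quadf p Sg v" using False quad0 by (auto simp: q_def)
  define u where "u = (\<lambda>j. v j / q)"
  have "quadf p Sg u = quadf p Sg v / q\<^sup>2"
    by (simp add: quadf_def u_def power2_eq_square sum_divide_distrib)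
  then have u: "quadf p Sg u = 1" using q False by simp
  have vu: "dirvar p v w = q * dirvar p u w" for w
    using q by (simp add: dotp_def u_def sum_distrib_left)
  have "measure (P_beta p Sg sg beta) {w \<in> space (P_beta p Sg sg beta). \<bar>dirvar p v w\<bar> > a} = measure (distr (P_beta p Sg sg beta) borel (dirvar p u)) {x. \<bar>x\<bar> > a / q}"
    using q by (subst measure_distr)
      (auto intro!: arg_cong[where f="measure (P_beta p Sg sg beta)"] simp: vu abs_mult field_simps)
  also have "\<dots> \<le> 1 / (a / q)\<^sup>2"
    unfolding distr_P_beta_dirvar[OF u] using assms q by (intro stdG_tail_le) simp
  also have "\<dots> = quadf p Sg v / a\<^sup>2" using q by (simp add: power_divide)
  finally show ?thesis .
qed

end

section \<open>Chaining\<close>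

lemma exp_le_quadratic:
  fixes x :: real
  assumes "\<bar>x\<bar> \<le> 1"
  shows "exp x \<le> 1 + x + x\<^sup>2"
proof (cases "0 \<le> x")
  case True
  then show ?thesis using assms by (intro exp_bound) auto
next
  case False
  define z where "z = - x"
  have z: "0 \<le> z" using False by (simp add: z_def)
  \<comment> \<open>For \<open>x = -z\<close> the claim is
    \<open>1 <= exp z * (1 - z + z^2)\<close>; already the quadratic Taylor polynomial of
    \<open>exp\<close> makes this product at least 1.\<close>
  have "1 \<le> 1 + z\<^sup>2 / 2 + z ^ 3 / 2 + z ^ 4 / 2" using z by simp
  also have "\<dots> = (1 + z + z\<^sup>2 / 2) * (1 - z + z\<^sup>2)" by (simp add: field_simps power2_eq_square power3_eq_cube power4_eq_xxxx)
  also have "\<dots> \<le> exp z * (1 - z + z\<^sup>2)"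
  proof (rule mult_right_mono)
    show "1 + z + z\<^sup>2 / 2 \<le> exp z" using z by (rule exp_lower_Taylor_quadratic)
    have "0 \<le> (1 - z / 2)\<^sup>2 + 3 / 4 * z\<^sup>2" by simp
    also have "\<dots> = 1 - z + z\<^sup>2" by (simp add: power2_eq_square field_simps)
    finally show "0 \<le> 1 - z + z\<^sup>2" .
  qed
  finally have "exp (- z) \<le> 1 - z + z\<^sup>2" by (simp add: exp_minus field_simps)
  then show ?thesis by (simp add: z_def)
qed

text \<open>Bernstein's bound with the second moment replaced by the probability of being nonzero,
  which dominates it as \<open>|f| <= 1\<close>. Since \<open>|f - m| <= 2\<close>, exponents up to
  1/2 stay in the range of the quadratic bound for \<open>exp\<close>.\<close>

lemma (in prob_space) exp_moment_bounded:
  assumes f [measurable]: "f \<in> borel_measurable M" and f1: "\<And>x. \<bar>f x\<bar> \<le> 1"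
    and V: "prob {x \<in> space M. f x \<noteq> 0} \<le> V" and lam: "\<bar>lam\<bar> \<le> 1 / 2"
  shows "(\<integral>\<^sup>+x. ennreal (exp (lam * (f x - expectation f))) \<partial>M) \<le> ennreal (exp (lam\<^sup>2 * V))"
proof -
  define m where "m = expectation f"
  have int: "integrable M f"
    by (rule integrable_const_bound[of _ 1]) (auto simp: f1)
  have int2: "integrable M (\<lambda>x. (f x)\<^sup>2)"
    by (rule integrable_const_bound[of _ 1]) (auto simp: f1 abs_square_le_1)
  have m1: "\<bar>m\<bar> \<le> 1"
  proof -
    have "\<bar>m\<bar> \<le> expectation (\<lambda>x. \<bar>f x\<bar>)" unfolding m_def by (rule integral_abs_bound)
    also have "\<dots> \<le> expectation (\<lambda>x. 1)" using int by (intro integral_mono) (auto simp: f1)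
    finally show ?thesis by (simp add: prob_space)
  qed
  let ?X = "\<lambda>x. lam * (f x - m)"
  have X: "\<bar>?X x\<bar> \<le> 1" for x
  proof -
    have "\<bar>f x - m\<bar> \<le> 2" using f1[of x] m1 by linarith
    then have "\<bar>lam\<bar> * \<bar>f x - m\<bar> \<le> 1 / 2 * 2" using lam by (intro mult_mono) auto
    then show ?thesis by (simp add: abs_mult)
  qed
  have intQ: "integrable M (\<lambda>x. 1 + ?X x + (?X x)\<^sup>2)"
    using int int2 by (simp add: power_mult_distrib power2_diff algebra_simps)
  have "(\<integral>\<^sup>+x. ennreal (exp (?X x)) \<partial>M) \<le> (\<integral>\<^sup>+x. ennreal (1 + ?X x + (?X x)\<^sup>2) \<partial>M)"
    by (intro nn_integral_mono ennreal_leI exp_le_quadratic X)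
  also have "\<dots> = ennreal (expectation (\<lambda>x. 1 + ?X x + (?X x)\<^sup>2))"
  proof (rule nn_integral_eq_integral[OF intQ], rule AE_I2)
    fix x
    show "0 \<le> 1 + ?X x + (?X x)\<^sup>2" using exp_le_quadratic[OF X[of x]] exp_ge_zero order_trans by blast
  qed
  also have "\<dots> \<le> ennreal (exp (lam\<^sup>2 * V))"
  proof (rule ennreal_leI)
    have eq: "1 + ?X x + (?X x)\<^sup>2 = (1 - lam * m + lam\<^sup>2 * m\<^sup>2) + (lam - 2 * lam\<^sup>2 * m) * f x + lam\<^sup>2 * (f x)\<^sup>2" for x
      by (simp add: power2_eq_square algebra_simps)
    have "expectation (\<lambda>x. 1 + ?X x + (?X x)\<^sup>2)
        = (1 - lam * m + lam\<^sup>2 * m\<^sup>2) + (lam - 2 * lam\<^sup>2 * m) * m + lam\<^sup>2 * expectation (\<lambda>x. (f x)\<^sup>2)"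
      unfolding eq using int int2 by (simp add: prob_space m_def)
    also have "\<dots> = 1 - lam\<^sup>2 * m\<^sup>2 + lam\<^sup>2 * expectation (\<lambda>x. (f x)\<^sup>2)"
      by (simp add: power2_eq_square algebra_simps)
    also have "\<dots> \<le> 1 + lam\<^sup>2 * expectation (\<lambda>x. (f x)\<^sup>2)" by simp
    also have "expectation (\<lambda>x. (f x)\<^sup>2) \<le> expectation (indicator {x \<in> space M. f x \<noteq> 0})"
    proof (rule integral_mono[OF int2])
      show "integrable M (indicator {x \<in> space M. f x \<noteq> 0} :: _ \<Rightarrow> real)"
        by (auto intro!: integrable_real_indicator simp: less_top[symmetric])
      fix x assume "x \<in> space M"
      then show "(f x)\<^sup>2 \<le> indicator {x \<in> space M. f x \<noteq> 0} x"
        using f1[of x] by (auto simp: indicator_def abs_square_le_1)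
    qed
    also have "\<dots> = prob {x \<in> space M. f x \<noteq> 0}" by simp
    finally have "expectation (\<lambda>x. 1 + ?X x + (?X x)\<^sup>2) \<le> 1 + lam\<^sup>2 * V"
      using V by (smt (verit) mult_left_mono zero_le_power2)
    also have "\<dots> \<le> exp (lam\<^sup>2 * V)" by (rule exp_ge_add_one_self)
    finally show "expectation (\<lambda>x. 1 + ?X x + (?X x)\<^sup>2) \<le> exp (lam\<^sup>2 * V)" .
  qed
  finally show ?thesis unfolding m_def .
qed

section \<open>Costs of finite test families and elementary estimates for chaining\<close>

lemma test_cost_le:
  assumes "(\<integral>\<^sup>+x. ennreal (exp (h x)) \<partial>P) \<le> ennreal (exp c)" "0 \<le> c"
  shows "test_cost n P (h, D) \<le> ennreal (exp (real n * c - D))"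
proof -
  have "max 1 (\<integral>\<^sup>+x. ennreal (exp (h x)) \<partial>P) \<le> ennreal (exp c)"
    using assms by (simp add: ennreal_leI flip: ennreal_1)
  then have "test_cost n P (h, D) \<le> ennreal (exp (- D)) * ennreal (exp c) ^ n"
    unfolding test_cost_def by (auto intro!: mult_left_mono power_mono)
  also have "\<dots> = ennreal (exp (real n * c - D))"
    by (simp add: ennreal_power exp_diff exp_minus field_simps flip: ennreal_mult exp_of_nat_mult)
  finally show ?thesis .
qed

lemma test_family_cost:
  assumes "finite X" "real (card X) \<le> exp u"
    and "\<And>x. x \<in> X \<Longrightarrow> test_cost n P (\<tau> x) \<le> ennreal (exp b)"
  shows "(\<Sum>\<tau>\<in>\<tau> ` X. test_cost n P \<tau>) \<le> ennreal (exp (u + b))"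
proof -
  have "(\<Sum>\<tau>\<in>\<tau> ` X. test_cost n P \<tau>) \<le> of_nat (card (\<tau> ` X)) * ennreal (exp b)"
    using assms(3) by (intro sum_bounded_above) auto
  also have "\<dots> \<le> of_nat (card X) * ennreal (exp b)"
    using assms(1) by (intro mult_right_mono) (auto intro: card_image_le of_nat_mono)
  also have "\<dots> = ennreal (real (card X) * exp b)"
    by (simp add: ennreal_mult ennreal_of_nat_eq_real_of_nat)
  also have "\<dots> \<le> ennreal (exp (u + b))"
    unfolding exp_add using assms(2) by (intro ennreal_leI mult_right_mono) auto
  finally show ?thesis .
qed

lemma test_cost_sum_Un:
  assumes "finite A" "finite B"
  shows "(\<Sum>\<tau>\<in>A \<union> B. test_cost n P \<tau>) \<le> (\<Sum>\<tau>\<in>A. test_cost n P \<tau>) + (\<Sum>\<tau>\<in>B. test_cost n P \<tau>)"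
  unfolding sum.union_inter[OF assms, symmetric] by simp

text \<open>Parallelogram identity with the other diagonal dropped.\<close>

lemma quadf_diff_le:
  assumes "is_cov_matrix p Sg"
  shows "quadf p Sg (v - w) \<le> 2 * quadf p Sg v + 2 * quadf p Sg w"
proof -
  have "0 \<le> quadf p Sg (\<lambda>j. v j + w j)" using assms by (simp add: is_cov_matrix_def)
  moreover have "quadf p Sg (\<lambda>j. v j + w j) + quadf p Sg (v - w) = 2 * quadf p Sg v + 2 * quadf p Sg w"
    unfolding quadf_def by (simp add: sum_distrib_left flip: sum.distrib) (simp add: algebra_simps)
  ultimately show ?thesis by simp
qed

lemma quadf_scale: "quadf p Sg (\<lambda>j. c * v j) = c\<^sup>2 * quadf p Sg v"
  unfolding quadf_def by (simp add: sum_distrib_left power2_eq_square algebra_simps)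

lemma dotp_scale: "dotp p (\<lambda>j. c * v j) x = c * dotp p v x"
  unfolding dotp_def by (simp add: sum_distrib_left algebra_simps)

lemma dotp_diff: "dotp p (v - w) x = dotp p v x - dotp p w x"
  unfolding dotp_def by (simp add: sum_subtractf algebra_simps)

text \<open>At the stopping level the window \<open>4^-K\<close> is of order \<open>y^2\<close>, one
  power of \<open>y\<close> below the accuracy sought.\<close>

lemma quarter_power_le:
  fixes y :: real
  assumes "1 / 2 < 2 ^ (K + 1) * y"
  shows "1 / 4 ^ K \<le> 16 * y\<^sup>2"
proof -
  have "1 / 2 ^ K \<le> 4 * y" using assms by (simp add: field_simps)
  then have "(1 / 2 ^ K)\<^sup>2 \<le> (4 * y)\<^sup>2" by (intro power_mono) auto
  then show ?thesis by (simp add: power_divide power2_eq_square flip: power_mult_distrib)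
qed

text \<open>The terms are entropy of order \<open>k\<close> over the exponent \<open>2^k\<close>;
  their bounded sum is why the number of levels leaves no logarithmic factor.\<close>

lemma sum_arith_geometric: "(\<Sum>k<K. real (k + 1) / 2 ^ k) \<le> 4"
proof -
  have "(\<Sum>k<K. real (k + 1) / 2 ^ k) = 4 - 2 * (real K + 2) / 2 ^ K"
  proof (induction K)
    case (Suc K)
    show ?case by (simp only: sum.lessThan_Suc Suc.IH) (simp add: field_simps)
  qed simp
  then show ?thesis by simp
qed

text \<open>If \<open>M\<close> bounds the normalised energy then, splitting \<open>v = g + (v - g)\<close> with \<open>g\<close> in the net,
  so does \<open>8 * B + M / 32\<close>; iterating from any finite bound leaves \<open>9 * B\<close>.\<close>

lemma energy_from_net:
  assumes cov: "is_cov_matrix p Sg" and net: "sphere_net p Sg S 1 N" and fin: "finite I"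
    and dom: "\<And>i. i \<in> I \<Longrightarrow> dominated p Sg (X i)"
    and bound: "\<And>g. g \<in> N \<Longrightarrow> (\<Sum>i\<in>I. (dotp p g (X i))\<^sup>2) \<le> 4 * B" and B: "0 \<le> B"
    and v: "supported_on S v"
  shows "(\<Sum>i\<in>I. (dotp p v (X i))\<^sup>2) \<le> 9 * B * quadf p Sg v"
proof -
  define G where "G = (\<lambda>v. \<Sum>i\<in>I. (dotp p v (X i))\<^sup>2)"
  have q0: "0 \<le> quadf p Sg v" for v using cov by (simp add: is_cov_matrix_def)
  have "\<forall>i\<in>I. \<exists>M. 0 \<le> M \<and> (\<forall>v. (dotp p v (X i))\<^sup>2 \<le> M * quadf p Sg v)"
    using dom dominatedD by metis
  then obtain M where M: "\<And>i. i \<in> I \<Longrightarrow> 0 \<le> M i" 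
    "\<And>i v. i \<in> I \<Longrightarrow> (dotp p v (X i))\<^sup>2 \<le> M i * quadf p Sg v" by metis
  \<comment> \<open>A data dependent but finite starting bound: the domination constants of the
    observations, added up.\<close>
  define M0 where "M0 = sum M I"
  have M0: "0 \<le> M0" unfolding M0_def using M(1) by (rule sum_nonneg)
  have step: "\<forall>v. supported_on S v \<longrightarrow> G v \<le> (9 * B + M0 / 2 ^ j) * quadf p Sg v" for j
  proof (induction j)
    case 0
    have "G v \<le> (9 * B + M0) * quadf p Sg v" for v
    proof -
      have "G v \<le> (\<Sum>i\<in>I. M i * quadf p Sg v)" unfolding G_def by (intro sum_mono M)
      also have "\<dots> = M0 * quadf p Sg v" by (simp add: M0_def sum_distrib_right)
      also have "\<dots> \<le> (9 * B + M0) * quadf p Sg v" using B q0 by (intro mult_right_mono) auto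
      finally show ?thesis .
    qed
    then show ?case by simp
  next
    case (Suc j)
    have unit: "G v \<le> 9 * B + M0 / 2 ^ Suc j" if v: "supported_on S v" "quadf p Sg v = 1" for v
    proof -
      obtain g where g: "g \<in> N" "quadf p Sg (v - g) \<le> 1 / 64"
        using net v by (auto simp: sphere_net_def)
      have "supported_on S (v - g)" using net g v by (auto simp: sphere_net_def supported_on_def)
      then have "G (v - g) \<le> (9 * B + M0 / 2 ^ j) * quadf p Sg (v - g)" using Suc.IH by blast
      also have "\<dots> \<le> (9 * B + M0 / 2 ^ j) * (1 / 64)"
        using B M0 g by (intro mult_left_mono) auto
      finally have 1: "G (v - g) \<le> (9 * B + M0 / 2 ^ j) / 64" by simp
      have "G v \<le> (\<Sum>i\<in>I. 2 * (dotp p g (X i))\<^sup>2 + 2 * (dotp p (v - g) (X i))\<^sup>2)"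
        unfolding G_def
      proof (rule sum_mono)
        fix i
        have "0 \<le> (dotp p g (X i) - dotp p (v - g) (X i))\<^sup>2" by simp
        then show "(dotp p v (X i))\<^sup>2 \<le> 2 * (dotp p g (X i))\<^sup>2 + 2 * (dotp p (v - g) (X i))\<^sup>2"
          by (simp add: dotp_diff power2_eq_square algebra_simps)
      qed
      also have "\<dots> = 2 * G g + 2 * G (v - g)" by (simp add: G_def sum.distrib sum_distrib_left)
      also have "\<dots> \<le> 8 * B + (9 * B + M0 / 2 ^ j) / 32"      proof -
        have "2 * x + 2 * z \<le> 8 * B + q / 32" if "z \<le> q / 64" "x \<le> 4 * B" for x z q :: real
          using that by linarith
        then show ?thesis using 1 bound[OF g(1)] unfolding G_def by blast
      qed
      \<comment> \<open>The constant 9 absorbs one round, since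
        \<open>8 * B + 9 * B / 32 <= 9 * B\<close>; the excess shrinks by 32, of which halving is
        recorded.\<close>
      also have "\<dots> \<le> 9 * B + M0 / 2 ^ Suc j" using B M0 by (simp add: field_simps)
      finally show ?thesis .
    qed
    show ?case
    proof (intro allI impI)
      fix v assume v: "supported_on S v"
      show "G v \<le> (9 * B + M0 / 2 ^ Suc j) * quadf p Sg v"
      proof (cases "quadf p Sg v = 0")
        \<comment> \<open>Here the right-hand side is 0 for every \<open>j\<close>, so the induction
          hypothesis is already the claim.\<close>
        case True
        then show ?thesis using Suc.IH v by fastforce
      next
        case False
        then have pos: "quadf p Sg v > 0" using q0[of v] by simp
        define c where "c = 1 / sqrt (quadf p Sg v)"
        have c: "c\<^sup>2 * quadf p Sg v = 1" using pos by (simp add: c_def power_divide)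
        have "G (\<lambda>j. c * v j) \<le> 9 * B + M0 / 2 ^ Suc j"
          by (rule unit) (use v c in \<open>auto simp: supported_on_def quadf_scale\<close>)
        moreover have "G (\<lambda>j. c * v j) = c\<^sup>2 * G v"
          by (simp add: G_def dotp_scale power_mult_distrib sum_distrib_left)
        ultimately have "quadf p Sg v * (c\<^sup>2 * G v) \<le> quadf p Sg v * (9 * B + M0 / 2 ^ Suc j)"
          using pos by (intro mult_left_mono) auto
        moreover have "quadf p Sg v * (c\<^sup>2 * G v) = (c\<^sup>2 * quadf p Sg v) * G v" by (simp only: mult_ac)
        ultimately have "(c\<^sup>2 * quadf p Sg v) * G v \<le> quadf p Sg v * (9 * B + M0 / 2 ^ Suc j)" by argo
        then show ?thesis unfolding c by (simp only: mult_1_left mult.commute)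
      qed
    qed
  qed
  have "G v \<le> 9 * B * quadf p Sg v"
  proof (rule LIMSEQ_le_const)
    have "(\<lambda>j. (9 * B + M0 * (1 / 2) ^ j) * quadf p Sg v) \<longlonglongrightarrow> (9 * B + M0 * 0) * quadf p Sg v"
      by (intro tendsto_intros LIMSEQ_power_zero) auto
    then show "(\<lambda>j. (9 * B + M0 / 2 ^ j) * quadf p Sg v) \<longlonglongrightarrow> 9 * B * quadf p Sg v"
      by (simp add: power_one_over field_simps)
    show "\<exists>N. \<forall>j\<ge>N. G v \<le> (9 * B + M0 / 2 ^ j) * quadf p Sg v" using step v by blast
  qed
  then show ?thesis by (simp add: G_def)
qed

text \<open>The half-space event of the candidate \<open>beta + t * sg * v\<close> in direction \<open>v\<close>, where \<open>quadf p Sg v = 1\<close>.\<close>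

definition wedge :: "nat \<Rightarrow> real \<Rightarrow> (nat \<Rightarrow> real) \<Rightarrow> real \<Rightarrow> (nat \<Rightarrow> real) \<Rightarrow> (nat \<Rightarrow> real) \<times> real \<Rightarrow> bool" where
  "wedge p sg beta t v w \<longleftrightarrow> dirvar p v w * resid p sg beta w \<ge> t * (dirvar p v w)\<^sup>2"

text \<open>The wedge is decided by the sign of \<open>g * (r - t * g)\<close>; the strip is where
  one of the two factors is within \<open>a\<close> of zero.\<close>

definition strip :: "nat \<Rightarrow> real \<Rightarrow> (nat \<Rightarrow> real) \<Rightarrow> real \<Rightarrow> real \<Rightarrow> (nat \<Rightarrow> real) \<Rightarrow> (nat \<Rightarrow> real) \<times> real \<Rightarrow> bool" where
  "strip p sg beta t a v w \<longleftrightarrow> \<bar>dirvar p v w\<bar> \<le> a \<or> \<bar>resid p sg beta w - t * dirvar p v w\<bar> \<le> a"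

lemma same_sign_near:
  fixes x x' a :: real
  assumes "\<bar>x - x'\<bar> \<le> a" "\<bar>x'\<bar> > a"
  shows "0 < x \<longleftrightarrow> 0 < x'" "x < 0 \<longleftrightarrow> x' < 0" "x \<noteq> 0" "x' \<noteq> 0"
  using assms by auto

text \<open>As \<open>t <= 1\<close>, a change of at most \<open>a\<close> in \<open>g\<close> moves
  \<open>r - t * g\<close> by at most \<open>a\<close> too. Off the strip neither factor can then
  change its sign.\<close>

lemma wedge_flip:
  assumes "0 \<le> t" "t \<le> 1" "wedge p sg beta t v w \<noteq> wedge p sg beta t v' w"
  shows "strip p sg beta t a v' w \<or> \<bar>dirvar p (v - v') w\<bar> > a"
proof (rule ccontr)
  assume neg: "\<not> (strip p sg beta t a v' w \<or> \<bar>dirvar p (v - v') w\<bar> > a)"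
  define g g' r where "g = dirvar p v w" and "g' = dirvar p v' w" and "r = resid p sg beta w"
  have 1: "\<bar>g - g'\<bar> \<le> a" "\<bar>g'\<bar> > a" "\<bar>r - t * g'\<bar> > a"
    using neg by (auto simp: strip_def dotp_diff g_def g'_def r_def)
  have "t * \<bar>g - g'\<bar> \<le> 1 * \<bar>g - g'\<bar>" using assms by (intro mult_right_mono) auto
  moreover have "(r - t * g) - (r - t * g') = - (t * (g - g'))" by (simp add: algebra_simps)
  ultimately have 2: "\<bar>(r - t * g) - (r - t * g')\<bar> \<le> a"
    using 1 assms by (simp add: abs_mult)
  have prod: "wedge p sg beta t u w \<longleftrightarrow> 0 \<le> dirvar p u w * (r - t * dirvar p u w)" for u
    by (simp add: wedge_def r_def power2_eq_square algebra_simps)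
  have "0 \<le> g * (r - t * g) \<longleftrightarrow> 0 \<le> g' * (r - t * g')"
  proof -
    have sgn: "0 \<le> x * z \<longleftrightarrow> (0 < x \<longleftrightarrow> 0 < z)" if "x \<noteq> 0" "z \<noteq> 0" for x z :: real
      using that by (auto simp: zero_le_mult_iff)
    show ?thesis
      using same_sign_near[OF 1(1,2)] same_sign_near[OF 2 1(3)] sgn[of g "r - t * g"] sgn[of g' "r - t * g'"]
      by blast
  qed
  then show False using assms(3) by (simp add: prod g_def g'_def)
qed

section \<open>Uniform deviation of wedge frequencies over sparse directions\<close>

context
  fixes p :: nat and Sg :: "nat \<Rightarrow> nat \<Rightarrow> real" and sg :: real and beta :: "nat \<Rightarrow> real" and t :: real
  assumes cov: "is_cov_matrix p Sg" and sg: "0 < sg" and t: "0 \<le> t" "t \<le> 1"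
begin

interpretation P: prob_space "P_beta p Sg sg beta"
  by (rule prob_space_P_beta[OF cov sg])

abbreviation (input) "ind v w \<equiv> (of_bool (wedge p sg beta t v w) :: real)"

definition wedge_prob :: "(nat \<Rightarrow> real) \<Rightarrow> real" where
  "wedge_prob v = measure (P_beta p Sg sg beta) {w \<in> space (P_beta p Sg sg beta). wedge p sg beta t v w}"

lemma pred_wedge [measurable]: "Measurable.pred (XYspace p) (wedge p sg beta t v)"
  unfolding wedge_def by measurable

lemma pred_strip [measurable]: "Measurable.pred (XYspace p) (strip p sg beta t a v)"
  unfolding strip_def by measurable

lemma expectation_wedge: "integral\<^sup>L (P_beta p Sg sg beta) (\<lambda>w. ind v w) = wedge_prob v"
proof -
  have "integral\<^sup>L (P_beta p Sg sg beta) (\<lambda>w. ind v w) = integral\<^sup>L (P_beta p Sg sg beta) (indicator {w \<in> space (P_beta p Sg sg beta). wedge p sg beta t v w})"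
    by (intro Bochner_Integration.integral_cong) (auto simp: indicator_def)
  then show ?thesis by (auto simp: wedge_prob_def intro!: arg_cong[where f="measure _"])
qed

lemma integrable_wedge: "integrable (P_beta p Sg sg beta) (\<lambda>w. ind v w)"
  by (rule P.integrable_const_bound[of _ 1]) auto

lemma wedge_flip_prob:
  assumes "quadf p Sg g = 1" "0 < a"
  shows "measure (P_beta p Sg sg beta) {w \<in> space (P_beta p Sg sg beta). wedge p sg beta t v w \<noteq> wedge p sg beta t g w} \<le> 2 * a + quadf p Sg (v - g) / a\<^sup>2"
proof -
  let ?A = "{w \<in> space (P_beta p Sg sg beta). strip p sg beta t a g w}" and ?B = "{w \<in> space (P_beta p Sg sg beta). \<bar>dirvar p (v - g) w\<bar> > a}"
  have AB: "?A \<in> sets (P_beta p Sg sg beta)" "?B \<in> sets (P_beta p Sg sg beta)" by measurable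
  have "measure (P_beta p Sg sg beta) {w \<in> space (P_beta p Sg sg beta). wedge p sg beta t v w \<noteq> wedge p sg beta t g w} \<le> measure (P_beta p Sg sg beta) (?A \<union> ?B)"
    using AB wedge_flip[OF t, of p sg beta v _ g a] by (intro P.finite_measure_mono) auto
  also have "\<dots> \<le> measure (P_beta p Sg sg beta) ?A + measure (P_beta p Sg sg beta) ?B" using AB by (rule measure_Un_le)
  also have "\<dots> \<le> 2 * a + quadf p Sg (v - g) / a\<^sup>2"
    using P_beta_flip_strip[OF cov sg assms(1), of a beta t] P_beta_tail_le[OF cov sg assms(2), of beta "v - g"] assms
    by (intro add_mono) (auto simp: strip_def)
  finally show ?thesis .
qed

lemma wedge_prob_diff:
  "\<bar>wedge_prob v - wedge_prob g\<bar> \<le> measure (P_beta p Sg sg beta) {w \<in> space (P_beta p Sg sg beta). wedge p sg beta t v w \<noteq> wedge p sg beta t g w}"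
proof -
  have "\<bar>wedge_prob v - wedge_prob g\<bar> = \<bar>integral\<^sup>L (P_beta p Sg sg beta) (\<lambda>w. ind v w - ind g w)\<bar>"
    using integrable_wedge by (simp add: expectation_wedge)
  also have "\<dots> \<le> integral\<^sup>L (P_beta p Sg sg beta) (\<lambda>w. \<bar>ind v w - ind g w\<bar>)" by (rule integral_abs_bound)
  also have "\<dots> = integral\<^sup>L (P_beta p Sg sg beta) (indicator {w \<in> space (P_beta p Sg sg beta). wedge p sg beta t v w \<noteq> wedge p sg beta t g w})"
    by (intro Bochner_Integration.integral_cong) (auto simp: indicator_def)
  also have "\<dots> = measure (P_beta p Sg sg beta) {w \<in> space (P_beta p Sg sg beta). wedge p sg beta t v w \<noteq> wedge p sg beta t g w}"
    by (auto intro!: arg_cong[where f="measure _"])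
  finally show ?thesis .
qed

text \<open>Deterministic: the hypotheses record passed tests, and \<open>B\<close> stands for the
  sample size. The centred sum \<open>Z\<close> is telescoped along close net points down to level
  \<open>K\<close>, with total \<open>20 + 30 * 4 = 140\<close> in units of \<open>B * y\<close>;
  the last jump, from level \<open>K\<close> to \<open>v\<close>, costs at most 60.\<close>

lemma chain_bound:
  fixes net :: "nat \<Rightarrow> (nat \<Rightarrow> real) set" and y B :: real
  assumes nets: "\<And>k. sphere_net p Sg S k (net k)" and fin: "finite I" "real (card I) \<le> B"
    and base: "\<And>g. g \<in> net 0 \<Longrightarrow> \<bar>\<Sum>i\<in>I. ind g (X i) - wedge_prob g\<bar> \<le> 20 * (B * y)"
    and link: "\<And>k a b. k < K \<Longrightarrow> a \<in> net k \<Longrightarrow> b \<in> net (k + 1) \<Longrightarrow> quadf p Sg (b - a) \<le> 3 / 64 ^ k \<Longrightarrow>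
        \<bar>\<Sum>i\<in>I. (ind b (X i) - ind a (X i)) - (wedge_prob b - wedge_prob a)\<bar> \<le> 30 * (real (k + 1) / 2 ^ k) * (B * y)"
    and strip: "\<And>g. g \<in> net K \<Longrightarrow> (\<Sum>i\<in>I. of_bool (strip p sg beta t (1 / 4 ^ K) g (X i))) \<le> 80 * real (K + 1) * (B * y\<^sup>2)"
    and energy: "\<And>v. supported_on S v \<Longrightarrow> (\<Sum>i\<in>I. (dirvar p v (X i))\<^sup>2) \<le> 9 * B * quadf p Sg v"
    and K: "2 ^ K * y \<le> 1 / 2" "1 / 2 < 2 ^ (K + 1) * y" and y: "0 < y" "y \<le> 1 / 10"
    and v: "supported_on S v" "quadf p Sg v = 1"
  shows "\<bar>\<Sum>i\<in>I. ind v (X i) - wedge_prob v\<bar> \<le> 200 * (B * y)"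
proof -
  have B: "0 \<le> B" using fin by linarith
  have "\<forall>k. \<exists>g\<in>net k. quadf p Sg (v - g) \<le> 1 / 64 ^ k"
    using nets v unfolding sphere_net_def by blast
  then obtain g where g: "\<And>k. g k \<in> net k" "\<And>k. quadf p Sg (v - g k) \<le> 1 / 64 ^ k" by metis
  have gs: "supported_on S (g k)" "quadf p Sg (g k) = 1" for k
    using nets[of k] g(1)[of k] by (auto simp: sphere_net_def)
  define Z where "Z = (\<lambda>u. \<Sum>i\<in>I. ind u (X i) - wedge_prob u)"
  have Zdiff: "Z b - Z a = (\<Sum>i\<in>I. (ind b (X i) - ind a (X i)) - (wedge_prob b - wedge_prob a))" for a b
    unfolding Z_def sum_subtractf[symmetric] by (intro sum.cong refl) simp
  have step: "\<bar>Z (g (k + 1)) - Z (g k)\<bar> \<le> 30 * (real (k + 1) / 2 ^ k) * (B * y)" if "k < K" for k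
    unfolding Zdiff
  proof (rule link[OF that g(1) g(1)])
    have "g (k + 1) - g k = (v - g k) - (v - g (k + 1))" by (simp add: fun_eq_iff)
    then have "quadf p Sg (g (k + 1) - g k) \<le> 2 * quadf p Sg (v - g k) + 2 * quadf p Sg (v - g (k + 1))"
      using quadf_diff_le[OF cov, of "v - g k" "v - g (k + 1)"] by simp
    also have "\<dots> \<le> 2 * (1 / 64 ^ k) + 2 * (1 / 64 ^ (k + 1))" using g(2)[of k] g(2)[of "k + 1"] by (intro add_mono mult_left_mono) auto
    also have "\<dots> \<le> 3 / 64 ^ k" by (simp add: field_simps)
    finally show "quadf p Sg (g (k + 1) - g k) \<le> 3 / 64 ^ k" .
  qed
  have chain: "\<bar>Z (g m)\<bar> \<le> 20 * (B * y) + 30 * (\<Sum>k<m. real (k + 1) / 2 ^ k) * (B * y)" if "m \<le> K" for m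
    using that
  proof (induction m)
    case 0
    then show ?case using base[OF g(1)] by (simp add: Z_def)
  next
    case (Suc m)
    then show ?case using step[of m] by (simp add: algebra_simps)
  qed
  have "30 * (\<Sum>k<K. real (k + 1) / 2 ^ k) * (B * y) \<le> 30 * 4 * (B * y)"
    using sum_arith_geometric[of K] B y by (intro mult_right_mono mult_left_mono) auto
  then have ZK: "\<bar>Z (g K)\<bar> \<le> 140 * (B * y)" using chain[OF order_refl] by linarith
  define a :: real where "a = 1 / 4 ^ K"
  have a: "0 < a" by (simp add: a_def)
  have a2: "1 / 64 ^ K / a\<^sup>2 = a"
  proof -
    have "(64::real) ^ K = 4 ^ K * 4 ^ K * 4 ^ K" by (simp flip: power_mult_distrib)
    then show ?thesis by (simp add: a_def power2_eq_square)
  qed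
  have ay: "a \<le> 16 * y\<^sup>2"
    unfolding a_def using K(2) by (rule quarter_power_le)
  \<comment> \<open>\<open>y <= 1 / 10\<close> turns the leftover \<open>16 * B * y^2\<close> into
    \<open>8 / 5 * (B * y)\<close>.\<close>
  have By2: "B * y\<^sup>2 \<le> B * y / 10"
    using mult_left_mono[OF y(2), of "B * y"] B y by (simp add: power2_eq_square mult.assoc)
  have Ba: "B * a \<le> 8 / 5 * (B * y)"
    using mult_left_mono[OF ay B] By2 by simp
  have qd: "quadf p Sg (v - g K) / a\<^sup>2 \<le> a"
    using divide_right_mono[OF g(2)[of K], of "a\<^sup>2"] a2 by simp
  have mu: "\<bar>wedge_prob v - wedge_prob (g K)\<bar> \<le> 3 * a"
    using wedge_prob_diff[of v "g K"] wedge_flip_prob[OF gs(2)[of K] a, of v] qd by linarith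
  have "\<bar>Z v - Z (g K)\<bar> \<le> (\<Sum>i\<in>I. \<bar>ind v (X i) - ind (g K) (X i)\<bar> + \<bar>wedge_prob v - wedge_prob (g K)\<bar>)"
    unfolding Zdiff by (intro order_trans[OF sum_abs] sum_mono) linarith
  \<comment> \<open>No union bound reaches arbitrary \<open>v\<close>. A flip is charged to the
    strip of the net point or, as in Markov's inequality, to the squared difference, whose sum the
    energy bound controls for all directions.\<close>
  also have "\<dots> \<le> (\<Sum>i\<in>I. of_bool (strip p sg beta t a (g K) (X i)) + (dirvar p (v - g K) (X i))\<^sup>2 / a\<^sup>2 + 3 * a)"
  proof (intro sum_mono add_mono mu)
    fix i
    show "\<bar>ind v (X i) - ind (g K) (X i)\<bar> \<le> of_bool (strip p sg beta t a (g K) (X i)) + (dirvar p (v - g K) (X i))\<^sup>2 / a\<^sup>2"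
    proof (cases "wedge p sg beta t v (X i) = wedge p sg beta t (g K) (X i)")
      case False
      from wedge_flip[OF t False, of a] show ?thesis
      proof
        assume "\<bar>dirvar p (v - g K) (X i)\<bar> > a"
        then have "a\<^sup>2 \<le> (dirvar p (v - g K) (X i))\<^sup>2" using a by (intro abs_le_square_iff[THEN iffD1]) auto
        then have "1 \<le> (dirvar p (v - g K) (X i))\<^sup>2 / a\<^sup>2" using a by (simp add: field_simps)
        moreover have "\<bar>ind v (X i) - ind (g K) (X i)\<bar> \<le> 1" by (simp add: of_bool_def)
        moreover have "0 \<le> (of_bool (strip p sg beta t a (g K) (X i)) :: real)" by simp
        ultimately show ?thesis by linarith
      next
        assume "strip p sg beta t a (g K) (X i)"
        then have "of_bool (strip p sg beta t a (g K) (X i)) = (1 :: real)" by simp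
        moreover have "\<bar>ind v (X i) - ind (g K) (X i)\<bar> \<le> 1" by (simp add: of_bool_def)
        moreover have "0 \<le> (dirvar p (v - g K) (X i))\<^sup>2 / a\<^sup>2" by simp
        ultimately show ?thesis by linarith
      qed
    qed auto
  qed
  also have "\<dots> = (\<Sum>i\<in>I. of_bool (strip p sg beta t a (g K) (X i)))
      + (\<Sum>i\<in>I. (dirvar p (v - g K) (X i))\<^sup>2) / a\<^sup>2 + real (card I) * (3 * a)"
    by (simp add: sum.distrib sum_divide_distrib)
  also have "\<dots> \<le> 80 * real (K + 1) * (B * y\<^sup>2) + 9 * B * a + B * (3 * a)"
  proof (intro add_mono)
    show "(\<Sum>i\<in>I. of_bool (strip p sg beta t a (g K) (X i))) \<le> 80 * real (K + 1) * (B * y\<^sup>2)"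
      unfolding a_def by (rule strip[OF g(1)])
    have "supported_on S (v - g K)" using gs v by (auto simp: supported_on_def)
    from energy[OF this]
    have "(\<Sum>i\<in>I. (dirvar p (v - g K) (X i))\<^sup>2) / a\<^sup>2 \<le> 9 * B * quadf p Sg (v - g K) / a\<^sup>2"
      by (rule divide_right_mono) simp
    also have "\<dots> \<le> 9 * B * a" using mult_left_mono[OF qd, of "9 * B"] B by simp
    finally show "(\<Sum>i\<in>I. (dirvar p (v - g K) (X i))\<^sup>2) / a\<^sup>2 \<le> 9 * B * a" .
    show "real (card I) * (3 * a) \<le> B * (3 * a)" using fin a by (intro mult_right_mono) auto
  qed
  also have "80 * real (K + 1) * (B * y\<^sup>2) \<le> 40 * (B * y)"
  proof -
    \<comment> \<open>\<open>K + 1 <= 2 ^ K <= 1 / (2 * y)\<close>: the linear factor from the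
      entropy of the last net uses up one power of \<open>y\<close>.\<close>
    have "K + 1 \<le> 2 ^ K" by (simp add: Suc_leI)
    then have "real (K + 1) \<le> 2 ^ K" by (metis of_nat_le_iff of_nat_numeral of_nat_power)
    then have "real (K + 1) * y \<le> 1 / 2" using mult_right_mono[of "real (K + 1)" "2 ^ K" y] y K(1) by linarith
    then have "80 * (B * y) * (real (K + 1) * y) \<le> 80 * (B * y) * (1 / 2)"
      using B y by (intro mult_left_mono) auto
    then show ?thesis by (simp add: power2_eq_square algebra_simps)
  qed
  finally have "\<bar>Z v - Z (g K)\<bar> \<le> 60 * (B * y)" using Ba by simp
  then show ?thesis using ZK by (simp add: Z_def)
qed

text \<open>The sign \<open>c\<close> splits a two-sided deviation into two one-sided tests.\<close>

lemma signed_test_cost: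
  assumes f: "f \<in> borel_measurable (P_beta p Sg sg beta)" "\<And>w. \<bar>f w\<bar> \<le> 1"
    and V: "measure (P_beta p Sg sg beta) {w \<in> space (P_beta p Sg sg beta). f w \<noteq> 0} \<le> V"
    and lam: "0 \<le> lam" "lam \<le> 1 / 2" and c: "c \<in> {1, - 1 :: real}"
  shows "test_cost n (P_beta p Sg sg beta) (\<lambda>w. c * lam * (f w - integral\<^sup>L (P_beta p Sg sg beta) f), D)
    \<le> ennreal (exp (real n * (lam\<^sup>2 * V) - D))"
proof (rule test_cost_le)
  have "\<bar>c * lam\<bar> \<le> 1 / 2" "(c * lam)\<^sup>2 = lam\<^sup>2" using lam c by auto
  then show "(\<integral>\<^sup>+w. ennreal (exp (c * lam * (f w - integral\<^sup>L (P_beta p Sg sg beta) f))) \<partial>P_beta p Sg sg beta)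
      \<le> ennreal (exp (lam\<^sup>2 * V))"
    using P.exp_moment_bounded[OF f V, of "c * lam"] by simp
  have "0 \<le> V" using V measure_nonneg order_trans by blast
  then show "0 \<le> lam\<^sup>2 * V" by simp
qed

text \<open>Exponent 1 with \<open>exp 1 <= 3\<close>: the moment is at most
  \<open>1 + 2 * (2 * a)\<close>, so the cost per observation is proportional to the bound for the
  probability of the strip, which at level \<open>K\<close> is of order \<open>y^2\<close>.\<close>

lemma strip_test_cost:
  assumes "quadf p Sg g = 1" "0 \<le> a"
  shows "test_cost n (P_beta p Sg sg beta) (\<lambda>w. of_bool (strip p sg beta t a g w), D)
    \<le> ennreal (exp (real n * (4 * a) - D))"
proof (rule test_cost_le)
  let ?A = "{w \<in> space (P_beta p Sg sg beta). strip p sg beta t a g w}"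
  have A: "?A \<in> sets (P_beta p Sg sg beta)" by measurable
  have "measure (P_beta p Sg sg beta) ?A \<le> 2 * a"
    using P_beta_flip_strip[OF cov sg assms, of beta t] by (simp add: strip_def)
  then have PA: "emeasure (P_beta p Sg sg beta) ?A \<le> ennreal (2 * a)"
    by (simp add: P.emeasure_eq_measure ennreal_leI)
  have "(\<integral>\<^sup>+w. ennreal (exp (of_bool (strip p sg beta t a g w))) \<partial>P_beta p Sg sg beta)
      \<le> (\<integral>\<^sup>+w. 1 + ennreal 2 * indicator ?A w \<partial>P_beta p Sg sg beta)"
  proof (rule nn_integral_mono)
    fix w assume w: "w \<in> space (P_beta p Sg sg beta)"
    have "ennreal (exp 1) \<le> ennreal (1 + 2)" using exp_le by (intro ennreal_leI) simp
    also have "\<dots> = ennreal 1 + ennreal 2" by (rule ennreal_plus) auto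
    also have "\<dots> = 1 + ennreal 2" by (simp only: ennreal_1)
    finally show "ennreal (exp (of_bool (strip p sg beta t a g w))) \<le> 1 + ennreal 2 * indicator ?A w"
      using w by (auto simp: indicator_def)
  qed
  also have "\<dots> = 1 + ennreal 2 * emeasure (P_beta p Sg sg beta) ?A"
    using A P.emeasure_space_1 by (simp add: nn_integral_add nn_integral_cmult)
  also have "\<dots> \<le> 1 + ennreal 2 * ennreal (2 * a)"
    by (intro add_left_mono mult_left_mono PA) auto
  also have "\<dots> = ennreal (1 + 4 * a)"
  proof -
    have "ennreal 2 * ennreal (2 * a) = ennreal (2 * (2 * a))" using assms(2) by (intro ennreal_mult[symmetric]) auto
    also have "1 + \<dots> = ennreal (1 + 2 * (2 * a))"
      using assms(2) ennreal_plus[of 1 "2 * (2 * a)"] by simp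
    finally show ?thesis by simp
  qed
  also have "\<dots> \<le> ennreal (exp (4 * a))" by (intro ennreal_leI exp_ge_add_one_self)
  finally show "(\<integral>\<^sup>+w. ennreal (exp (of_bool (strip p sg beta t a g w))) \<partial>P_beta p Sg sg beta)
      \<le> ennreal (exp (4 * a))" .
qed (use assms in simp)

lemma energy_test_cost:
  assumes "quadf p Sg g = 1"
  shows "test_cost n (P_beta p Sg sg beta) (\<lambda>w. (dirvar p g w)\<^sup>2 / 4, D)
    \<le> ennreal (exp (real n * (1 / 2) - D))"
  by (rule test_cost_le[OF nn_integral_P_beta_exp_square[OF cov sg assms]]) simp

text \<open>Four test families: values on the coarsest nets, links, strip counts on the last nets,
  energies on the nets of level 1. Each threshold exceeds the log-size of its family plus the moment
  term by at least \<open>3 * Lam\<close>. \<open>T\<close> is chosen before \<open>I\<close> and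
  \<open>X\<close>, so the random clean indices can be inserted afterwards.\<close>

theorem uniform_wedge_deviation:
  fixes s n :: nat and y Lam :: real
  assumes s: "real s \<le> Lam" "real (card {S. S \<subseteq> {..<p} \<and> card S \<le> 2 * s}) \<le> exp (2 * Lam)"
    and Lam: "1 \<le> Lam" "real n * y\<^sup>2 = Lam" and y: "0 < y" "y \<le> 1 / 10"
  shows "\<exists>T. finite T \<and> (\<forall>(h, D)\<in>T. h \<in> borel_measurable (P_beta p Sg sg beta)) \<and>
    (\<Sum>\<tau>\<in>T. test_cost n (P_beta p Sg sg beta) \<tau>) \<le> ennreal (4 * exp (- 3 * Lam)) \<and>
    (\<forall>I X. I \<subseteq> {..<n} \<longrightarrow> (\<forall>(h, D)\<in>T. (\<Sum>i\<in>I. h (X i)) \<le> D) \<longrightarrow> (\<forall>i\<in>I. dominated p Sg (fst (X i))) \<longrightarrow>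
      (\<forall>S v. S \<subseteq> {..<p} \<longrightarrow> card S \<le> 2 * s \<longrightarrow> supported_on S v \<longrightarrow> quadf p Sg v = 1 \<longrightarrow>
         \<bar>\<Sum>i\<in>I. ind v (X i) - wedge_prob v\<bar> \<le> 200 * (real n * y)))"
proof -
  let ?P = "P_beta p Sg sg beta"
  define F where "F = {S. S \<subseteq> {..<p} \<and> card S \<le> 2 * s}"
  have finF: "finite F" unfolding F_def by (rule finite_subset[of _ "Pow {..<p}"]) auto
  define net where "net = (\<lambda>S k. SOME N. sphere_net p Sg S k N)"
  have net: "sphere_net p Sg S k (net S k)" if "S \<in> F" for S k
    unfolding net_def by (rule someI_ex[OF sphere_net_exists[OF cov]]) (use that in \<open>simp add: F_def\<close>)
  have net_unit: "quadf p Sg g = 1" if "S \<in> F" "g \<in> net S k" for S g k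
    using net[OF that(1), of k] that(2) by (auto simp: sphere_net_def)
  have net_fin: "finite (net S k)" if "S \<in> F" for S k
    using net[OF that, of k] by (auto simp: sphere_net_def)
  have net_card: "real (card (net S k)) \<le> exp (6 * real (k + 1) * Lam)" if "S \<in> F" for S k
  proof -
    have "real (card (net S k)) \<le> exp (3 * real (card S) * real (k + 1))"
      using net[OF that, of k] by (auto simp: sphere_net_def)
    also have "3 * real (card S) * real (k + 1) \<le> 3 * (2 * Lam) * real (k + 1)"
      using that s by (intro mult_right_mono mult_left_mono) (auto simp: F_def)
    finally show ?thesis by (simp add: algebra_simps)
  qed
  have card_Sigma: "real (card (SIGMA S:F. B S)) \<le> exp (2 * Lam + u)" "finite (SIGMA S:F. B S)"
    if "\<And>S. S \<in> F \<Longrightarrow> finite (B S)" "\<And>S. S \<in> F \<Longrightarrow> real (card (B S)) \<le> exp u" for B :: "nat set \<Rightarrow> 'z set" and u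
  proof -
    have "real (card (SIGMA S:F. B S)) = (\<Sum>S\<in>F. real (card (B S)))"
      using finF that by (subst card_SigmaI) auto
    also have "\<dots> \<le> real (card F) * exp u" using that by (intro sum_bounded_above) auto
    also have "\<dots> \<le> exp (2 * Lam) * exp u" using s(2) by (intro mult_right_mono) (auto simp: F_def)
    finally show "real (card (SIGMA S:F. B S)) \<le> exp (2 * Lam + u)" by (simp add: exp_add)
    show "finite (SIGMA S:F. B S)" using finF that by auto
  qed
  have exp_Lam2: "2 \<le> exp Lam" using Lam(1) exp_ge_add_one_self[of Lam] by linarith
  have wp_meas: "(\<lambda>w. ind g w) \<in> borel_measurable ?P" for g by measurable

  \<comment> \<open>The last level whose exponent \<open>2 ^ K * y\<close> stays at most 1/2;
    \<open>y <= 1 / 10\<close> excludes a first failure at level 0.\<close>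
  obtain K where K: "2 ^ K * y \<le> 1 / 2" "1 / 2 < 2 ^ (K + 1) * y"
  proof -
    have "\<exists>m. 1 / 2 < 2 ^ m * y"
      using real_arch_pow[of 2 "1 / (2 * y)"] y by (auto simp: field_simps)
    then obtain m where m: "1 / 2 < 2 ^ m * y" "\<And>k. k < m \<Longrightarrow> \<not> 1 / 2 < 2 ^ k * y"
      using exists_least_iff[of "\<lambda>m. 1 / 2 < 2 ^ m * y"] by blast
    then obtain K where "m = Suc K" using y by (cases m) auto
    then show ?thesis using m(1) m(2)[of K] that[of K] by (simp add: not_less)
  qed
  define a :: real where "a = 1 / 4 ^ K"
  have ay: "a \<le> 16 * y\<^sup>2"
    unfolding a_def using K(2) by (rule quarter_power_le)
  have a0: "0 \<le> a" by (simp add: a_def)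

  define X0 where "X0 = (SIGMA S:F. net S 0 \<times> {1, - 1 :: real})"
  \<comment> \<open>Threshold over exponent is \<open>20 * Lam / y = 20 * (n * y)\<close>. The
    budget in units of \<open>Lam\<close>: supports 2, net 6, two signs 1, moment 1.\<close>
  define f0 where "f0 = (\<lambda>(S :: nat set, g, c). (\<lambda>w. c * y * (ind g w - integral\<^sup>L ?P (\<lambda>w. ind g w)), 20 * Lam))"
  have X0: "real (card X0) \<le> exp (2 * Lam + (6 * Lam + Lam))" "finite X0"
  proof -
    have "real (card (net S 0 \<times> {1, - 1 :: real})) \<le> exp (6 * Lam + Lam)" if "S \<in> F" for S
    proof -
      have "real (card (net S 0)) * 2 \<le> exp (6 * Lam) * exp Lam"
        using net_card[OF that, of 0] exp_Lam2 by (intro mult_mono) auto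
      then show ?thesis by (simp add: card_cartesian_product flip: exp_add)
    qed
    then show "real (card X0) \<le> exp (2 * Lam + (6 * Lam + Lam))" "finite X0"
      unfolding X0_def using net_fin by (intro card_Sigma; auto)+
  qed
  have cost0: "(\<Sum>\<tau>\<in>f0 ` X0. test_cost n ?P \<tau>) \<le> ennreal (exp (- 3 * Lam))"
  proof -
    have "(\<Sum>\<tau>\<in>f0 ` X0. test_cost n ?P \<tau>) \<le> ennreal (exp ((2 * Lam + (6 * Lam + Lam)) + - 19 * Lam))"
    proof (rule test_family_cost[OF X0(2,1)])
      fix x assume "x \<in> X0"
      then obtain S g c where x: "x = (S, g, c)" "c \<in> {1, - 1}" by (auto simp: X0_def)
      have "test_cost n ?P (\<lambda>w. c * y * (ind g w - integral\<^sup>L ?P (\<lambda>w. ind g w)), 20 * Lam)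
          \<le> ennreal (exp (real n * (y\<^sup>2 * 1) - 20 * Lam))"
        using y x(2) by (intro signed_test_cost wp_meas) (auto simp: of_bool_def)
      then show "test_cost n ?P (f0 x) \<le> ennreal (exp (- 19 * Lam))"
        using Lam(2) by (simp add: x f0_def)
    qed
    also have "\<dots> \<le> ennreal (exp (- 3 * Lam))" using Lam(1) by (intro ennreal_leI) simp
    finally show ?thesis .
  qed

  define links where "links = (\<lambda>S k. {(a, b). a \<in> net S k \<and> b \<in> net S (k + 1) \<and> quadf p Sg (b - a) \<le> 3 / 64 ^ k})"
  define X1 where "X1 = (\<lambda>k. SIGMA S:F. links S k \<times> {1, - 1 :: real})"
  \<comment> \<open>A link joins two net points, with entropy \<open>(12 * k + 18) * Lam\<close>;
    supports and signs add 3, the moment 5 on every level. The factor \<open>30 * (k + 1)\<close>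
    leaves \<open>4 + 18 * k\<close>, whose linear part makes the levels summable.\<close>
  define f1 where "f1 = (\<lambda>k (S :: nat set, (a, b), c). (\<lambda>w. c * (2 ^ k * y) * ((ind b w - ind a w) - integral\<^sup>L ?P (\<lambda>w. ind b w - ind a w)), 30 * real (k + 1) * Lam))"
  have X1: "real (card (X1 k)) \<le> exp (2 * Lam + ((6 * real (k + 1) * Lam + 6 * real (k + 2) * Lam) + Lam))" "finite (X1 k)" for k
  proof -
    have sub: "links S k \<subseteq> net S k \<times> net S (k + 1)" for S
      by (auto simp: links_def)
    have "real (card (links S k \<times> {1, - 1 :: real}))
        \<le> exp ((6 * real (k + 1) * Lam + 6 * real (k + 2) * Lam) + Lam)" if "S \<in> F" for S
    proof -
      have "card (links S k) \<le> card (net S k) * card (net S (k + 1))"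
        using card_mono[OF _ sub[of S]] net_fin[OF that] by (simp add: card_cartesian_product)
      then have "real (card (links S k)) \<le> real (card (net S k)) * real (card (net S (k + 1)))"
        unfolding of_nat_mult[symmetric] of_nat_le_iff .
      also have "\<dots> \<le> exp (6 * real (k + 1) * Lam) * exp (6 * real (k + 2) * Lam)"
        using net_card[OF that, of k] net_card[OF that, of "k + 1"] by (intro mult_mono) auto
      finally show ?thesis using exp_Lam2 unfolding card_cartesian_product exp_add of_nat_mult
        by (intro mult_mono) auto
    qed
    moreover have "finite (links S k \<times> {1, - 1 :: real})"
      if "S \<in> F" for S using net_fin[OF that] finite_subset[OF sub[of S]] by auto
    ultimately show "real (card (X1 k)) \<le> exp (2 * Lam + ((6 * real (k + 1) * Lam + 6 * real (k + 2) * Lam) + Lam))" "finite (X1 k)"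
      unfolding X1_def by (intro card_Sigma; auto)+
  qed
  have cost1: "(\<Sum>\<tau>\<in>f1 k ` X1 k. test_cost n ?P \<tau>) \<le> ennreal (exp (- 3 * Lam) * (1 / 2) ^ (k + 1))" if k: "k < K" for k
  proof -
    have "(2::real) ^ k \<le> 2 ^ K" using k by (intro power_increasing) auto
    then have "2 ^ k * y \<le> 2 ^ K * y" using y by (intro mult_right_mono) auto
    from this K(1) have "2 ^ k * y \<le> 1 / 2" by (rule order_trans)
    then have lam: "0 \<le> 2 ^ k * y" "2 ^ k * y \<le> 1 / 2" using y by auto
    have "(\<Sum>\<tau>\<in>f1 k ` X1 k. test_cost n ?P \<tau>)
      \<le> ennreal (exp ((2 * Lam + ((6 * real (k + 1) * Lam + 6 * real (k + 2) * Lam) + Lam)) + (5 * Lam - 30 * real (k + 1) * Lam)))"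
    proof (rule test_family_cost[OF X1(2,1)])
      fix x assume "x \<in> X1 k"
      then obtain S a b c where x: "x = (S, (a, b), c)" "c \<in> {1, - 1}" "S \<in> F" "a \<in> net S k" 
          "quadf p Sg (b - a) \<le> 3 / 64 ^ k" by (auto simp: X1_def links_def)
      have "measure ?P {w \<in> space ?P. ind b w - ind a w \<noteq> 0} = measure ?P {w \<in> space ?P. wedge p sg beta t b w \<noteq> wedge p sg beta t a w}"
        by (rule arg_cong[where f="measure _"]) auto
      also have "\<dots> \<le> 2 * (1 / 4 ^ k) + quadf p Sg (b - a) / (1 / 4 ^ k)\<^sup>2"
        using x net_unit by (intro wedge_flip_prob) auto
      also have "\<dots> \<le> 2 * (1 / 4 ^ k) + 3 / 64 ^ k / (1 / 4 ^ k)\<^sup>2"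
        using x by (intro add_left_mono divide_right_mono) auto
      also have "3 / 64 ^ k / (1 / 4 ^ k)\<^sup>2 = 3 * (1 / (4::real) ^ k)"
      proof -
        have "(64::real) ^ k = 4 ^ k * 4 ^ k * 4 ^ k" by (simp flip: power_mult_distrib)
        then show ?thesis by (simp add: power2_eq_square)
      qed
      finally have V: "measure ?P {w \<in> space ?P. ind b w - ind a w \<noteq> 0} \<le> 5 / 4 ^ k" by simp
      have "test_cost n ?P (\<lambda>w. c * (2 ^ k * y) * ((ind b w - ind a w) - integral\<^sup>L ?P (\<lambda>w. ind b w - ind a w)), 30 * real (k + 1) * Lam)
         \<le> ennreal (exp (real n * ((2 ^ k * y)\<^sup>2 * (5 / 4 ^ k)) - 30 * real (k + 1) * Lam))"
        using wp_meas[of a] wp_meas[of b] by (intro signed_test_cost lam V x(2)) (auto simp: of_bool_def)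
      also have "real n * ((2 ^ k * y)\<^sup>2 * (5 / 4 ^ k)) = 5 * Lam"
      proof -
        have "(4::real) ^ k = 2 ^ k * 2 ^ k" by (simp flip: power_mult_distrib)
        then show ?thesis unfolding Lam(2)[symmetric] by (simp add: power2_eq_square)
      qed
      finally show "test_cost n ?P (f1 k x) \<le> ennreal (exp (5 * Lam - 30 * real (k + 1) * Lam))"
        by (simp add: x f1_def)
    qed
    also have "\<dots> \<le> ennreal (exp (- 3 * Lam + - real (k + 1)))"
    proof (intro ennreal_leI, subst exp_le_cancel_iff)
      have "(2 * Lam + ((6 * real (k + 1) * Lam + 6 * real (k + 2) * Lam) + Lam)) + (5 * Lam - 30 * real (k + 1) * Lam)
          = - 4 * Lam - 18 * (real k * Lam)" by (simp add: algebra_simps)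
      also have "\<dots> \<le> - 3 * Lam + - real (k + 1)"
      proof -
        have "real k * 1 \<le> real k * Lam" using Lam(1) by (intro mult_left_mono) auto
        then show ?thesis using Lam(1) by simp
      qed
      finally show "(2 * Lam + ((6 * real (k + 1) * Lam + 6 * real (k + 2) * Lam) + Lam)) + (5 * Lam - 30 * real (k + 1) * Lam)
          \<le> - 3 * Lam + - real (k + 1)" .
    qed
    also have "\<dots> \<le> ennreal (exp (- 3 * Lam) * (1 / 2) ^ (k + 1))"
    proof (intro ennreal_leI, unfold exp_add, intro mult_left_mono)
      have "exp (- 1) \<le> (1 / 2 :: real)" using exp_ge_add_one_self[of 1] by (simp add: exp_minus field_simps)
      then have "exp (- 1 :: real) ^ (k + 1) \<le> (1 / 2) ^ (k + 1)" by (intro power_mono) auto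
      moreover have "exp (- real (k + 1)) = exp (- 1) ^ (k + 1)"
        using exp_of_nat_mult[of "k + 1" "- 1 :: real"] by (simp only: mult_minus1_right)
      ultimately show "exp (- real (k + 1)) \<le> (1 / 2) ^ (k + 1)" by (simp only:)
    qed simp
    finally show ?thesis .
  qed

  define X2 where "X2 = (SIGMA S:F. net S K)"
  \<comment> \<open>The moment term is \<open>4 * a * n <= 64 * Lam\<close> at the last level;
    \<open>80 * (K + 1)\<close> covers it together with supports and net.\<close>
  define f2 where "f2 = (\<lambda>(S :: nat set, g). (\<lambda>w. of_bool (strip p sg beta t a g w) :: real, 80 * real (K + 1) * Lam))"
  have X2: "real (card X2) \<le> exp (2 * Lam + 6 * real (K + 1) * Lam)" "finite X2"
    unfolding X2_def using net_fin net_card by (intro card_Sigma; auto)+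
  have cost2: "(\<Sum>\<tau>\<in>f2 ` X2. test_cost n ?P \<tau>) \<le> ennreal (exp (- 3 * Lam))"
  proof -
    have "(\<Sum>\<tau>\<in>f2 ` X2. test_cost n ?P \<tau>) \<le> ennreal (exp ((2 * Lam + 6 * real (K + 1) * Lam) + (64 * Lam - 80 * real (K + 1) * Lam)))"
    proof (rule test_family_cost[OF X2(2,1)])
      fix x assume "x \<in> X2"
      then obtain S g where x: "x = (S, g)" "S \<in> F" "g \<in> net S K" by (auto simp: X2_def)
      have "test_cost n ?P (\<lambda>w. of_bool (strip p sg beta t a g w), 80 * real (K + 1) * Lam)
          \<le> ennreal (exp (real n * (4 * a) - 80 * real (K + 1) * Lam))"
        using x net_unit a0 by (intro strip_test_cost) auto
      also have "\<dots> \<le> ennreal (exp (64 * Lam - 80 * real (K + 1) * Lam))"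
        using mult_left_mono[OF ay, of "4 * real n"] Lam(2) by (intro ennreal_leI) simp
      finally show "test_cost n ?P (f2 x) \<le> ennreal (exp (64 * Lam - 80 * real (K + 1) * Lam))"
        by (simp add: x f2_def)
    qed
    also have "\<dots> \<le> ennreal (exp (- 3 * Lam))"
    proof (intro ennreal_leI, subst exp_le_cancel_iff)
      have "0 \<le> real K * Lam" using Lam(1) by simp
      moreover have "(2 * Lam + 6 * real (K + 1) * Lam) + (64 * Lam - 80 * real (K + 1) * Lam)
          = - 8 * Lam - 74 * (real K * Lam)" by (simp add: algebra_simps)
      ultimately show "(2 * Lam + 6 * real (K + 1) * Lam) + (64 * Lam - 80 * real (K + 1) * Lam) \<le> - 3 * Lam"
        using Lam(1) by linarith
    qed
    finally show ?thesis .
  qed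

  define X3 where "X3 = (SIGMA S:F. net S 1)"
  \<comment> \<open>The factor 1/4 keeps the exponential moment of the square finite. Half of the
    threshold \<open>n\<close> is left over, and \<open>n >= 100 * Lam\<close> pays for the
    \<open>14 * Lam\<close> of entropy.\<close>
  define f3 where "f3 = (\<lambda>(S :: nat set, g). (\<lambda>w. (dirvar p g w)\<^sup>2 / 4, real n))"
  have X3: "real (card X3) \<le> exp (2 * Lam + 6 * real (1 + 1) * Lam)" "finite X3"
    unfolding X3_def using net_fin net_card[of _ 1] by (intro card_Sigma; auto)+
  have n_large: "100 * Lam \<le> real n"
  proof -
    have "y\<^sup>2 \<le> (1 / 10)\<^sup>2" using y by (intro power_mono) auto
    then have "real n * y\<^sup>2 \<le> real n * (1 / 100)" by (intro mult_left_mono) (auto simp: power2_eq_square)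
    then show ?thesis using Lam(2) by simp
  qed
  have cost3: "(\<Sum>\<tau>\<in>f3 ` X3. test_cost n ?P \<tau>) \<le> ennreal (exp (- 3 * Lam))"
  proof -
    have "(\<Sum>\<tau>\<in>f3 ` X3. test_cost n ?P \<tau>) \<le> ennreal (exp ((2 * Lam + 6 * real (1 + 1) * Lam) + (real n * (1 / 2) - real n)))"
    proof (rule test_family_cost[OF X3(2,1)])
      fix x assume "x \<in> X3"
      then obtain S g where x: "x = (S, g)" "S \<in> F" "g \<in> net S 1" by (auto simp: X3_def)
      then show "test_cost n ?P (f3 x) \<le> ennreal (exp (real n * (1 / 2) - real n))"
        using net_unit energy_test_cost[of g n "real n"] by (simp add: f3_def)
    qed
    also have "\<dots> \<le> ennreal (exp (- 3 * Lam))"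
      using Lam(1) n_large by (intro ennreal_leI) simp
    finally show ?thesis .
  qed

  define T1 where "T1 = (\<Union>k<K. f1 k ` X1 k)"
  have cost_links: "(\<Sum>\<tau>\<in>T1. test_cost n ?P \<tau>) \<le> ennreal (exp (- 3 * Lam))"
  proof -
    \<comment> \<open>The partial geometric sum keeps the bound free of the number of
      levels.\<close>
    have "(\<Sum>\<tau>\<in>(\<Union>k<m. f1 k ` X1 k). test_cost n ?P \<tau>) \<le> ennreal (exp (- 3 * Lam) * (1 - (1 / 2) ^ m))" if "m \<le> K" for m
      using that
    proof (induction m)
      case (Suc m)
      have "(\<Union>k<Suc m. f1 k ` X1 k) = (\<Union>k<m. f1 k ` X1 k) \<union> f1 m ` X1 m"
        by (simp add: lessThan_Suc Un_commute)
      then have "(\<Sum>\<tau>\<in>(\<Union>k<Suc m. f1 k ` X1 k). test_cost n ?P \<tau>)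
        \<le> (\<Sum>\<tau>\<in>(\<Union>k<m. f1 k ` X1 k). test_cost n ?P \<tau>) + (\<Sum>\<tau>\<in>f1 m ` X1 m. test_cost n ?P \<tau>)"
        using test_cost_sum_Un[of "\<Union>k<m. f1 k ` X1 k" "f1 m ` X1 m"] X1(2) by simp
      also have "\<dots> \<le> ennreal (exp (- 3 * Lam) * (1 - (1 / 2) ^ m)) + ennreal (exp (- 3 * Lam) * (1 / 2) ^ (m + 1))"
        using Suc by (intro add_mono cost1) auto
      also have "\<dots> = ennreal (exp (- 3 * Lam) * (1 - (1 / 2) ^ m) + exp (- 3 * Lam) * (1 / 2) ^ (m + 1))"
        by (intro ennreal_plus[symmetric] mult_nonneg_nonneg) (auto simp: power_le_one)
      also have "exp (- 3 * Lam) * (1 - (1 / 2) ^ m) + exp (- 3 * Lam) * (1 / 2) ^ (m + 1) = exp (- 3 * Lam) * (1 - (1 / 2) ^ Suc m)"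
        by (simp add: algebra_simps)
      finally show ?case .
    qed simp
    from this[of K] have "(\<Sum>\<tau>\<in>T1. test_cost n ?P \<tau>) \<le> ennreal (exp (- 3 * Lam) * (1 - (1 / 2) ^ K))"
      by (simp add: T1_def)
    also have "\<dots> \<le> ennreal (exp (- 3 * Lam))"
      by (intro ennreal_leI mult_left_le) auto
    finally show ?thesis .
  qed
  define T where "T = f0 ` X0 \<union> T1 \<union> f2 ` X2 \<union> f3 ` X3"
  have finT1: "finite T1" unfolding T1_def using X1(2) by auto
  have Tfin: "finite T" unfolding T_def using X0 finT1 X2 X3 by auto
  have Tmeas: "\<forall>(h, D)\<in>T. h \<in> borel_measurable ?P"
  proof -
    have "(\<lambda>w. of_bool (strip p sg beta t a g w) :: real) \<in> borel_measurable ?P" for g by measurable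
    moreover have "(\<lambda>w. (dirvar p g w)\<^sup>2 / 4) \<in> borel_measurable ?P" for g by measurable
    ultimately show ?thesis unfolding T_def T1_def f0_def f1_def f2_def f3_def using wp_meas by auto
  qed
  have Tcost: "(\<Sum>\<tau>\<in>T. test_cost n ?P \<tau>) \<le> ennreal (4 * exp (- 3 * Lam))"
  proof -
    have "(\<Sum>\<tau>\<in>T. test_cost n ?P \<tau>) \<le> (\<Sum>\<tau>\<in>f0 ` X0. test_cost n ?P \<tau>) + (\<Sum>\<tau>\<in>T1. test_cost n ?P \<tau>)
        + (\<Sum>\<tau>\<in>f2 ` X2. test_cost n ?P \<tau>) + (\<Sum>\<tau>\<in>f3 ` X3. test_cost n ?P \<tau>)"
      unfolding T_def using X0 finT1 X2 X3
      by (intro order_trans[OF test_cost_sum_Un] add_right_mono order_refl) auto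
    also have "\<dots> \<le> ennreal (exp (- 3 * Lam)) + ennreal (exp (- 3 * Lam)) + ennreal (exp (- 3 * Lam)) + ennreal (exp (- 3 * Lam))"
      by (intro add_mono cost0 cost_links cost2 cost3)
    also have "\<dots> = ennreal (4 * exp (- 3 * Lam))" by (simp flip: ennreal_plus)
    finally show ?thesis .
  qed
  have dev: "\<bar>\<Sum>i\<in>I. ind v (X i) - wedge_prob v\<bar> \<le> 200 * (real n * y)"
    if I: "I \<subseteq> {..<n}" and good: "\<forall>(h, D)\<in>T. (\<Sum>i\<in>I. h (X i)) \<le> D" and dom: "\<forall>i\<in>I. dominated p Sg (fst (X i))"
      and S: "S \<subseteq> {..<p}" "card S \<le> 2 * s" and v: "supported_on S v" "quadf p Sg v = 1" for I X S v
  proof -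
    have SF: "S \<in> F" using S by (simp add: F_def)
    have finI: "finite I" using I finite_subset by blast
    have cardI: "real (card I) \<le> real n" using card_mono[OF _ I] by simp
    have abs_of_signed: "\<bar>z\<bar> \<le> d / q" if "\<And>c. c \<in> {1, - 1} \<Longrightarrow> c * q * z \<le> d" "0 < q" for z d q :: real
      using that(1)[of 1] that(1)[of "- 1"] that(2) by (simp add: field_simps abs_le_iff)
    have yLam: "c * Lam / y = c * (real n * y)" for c
      using y unfolding Lam(2)[symmetric] by (simp add: power2_eq_square)
    show ?thesis
    proof (rule chain_bound[where net="net S" and K=K and B="real n"])
      show "sphere_net p Sg S k (net S k)" for k by (rule net[OF SF])
      show "\<bar>\<Sum>i\<in>I. ind g (X i) - wedge_prob g\<bar> \<le> 20 * (real n * y)" if g: "g \<in> net S 0" for g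
      proof -
        have "\<bar>\<Sum>i\<in>I. ind g (X i) - wedge_prob g\<bar> \<le> 20 * Lam / y"
        proof (rule abs_of_signed[OF _ y(1)])
          fix c :: real assume "c \<in> {1, - 1}"
          then have "f0 (S, g, c) \<in> T" unfolding T_def X0_def using SF g by blast
          then have "(\<Sum>i\<in>I. c * y * (ind g (X i) - wedge_prob g)) \<le> 20 * Lam"
            using good by (auto simp: f0_def expectation_wedge)
          then show "c * y * (\<Sum>i\<in>I. ind g (X i) - wedge_prob g) \<le> 20 * Lam"
            by (simp only: sum_distrib_left)
        qed
        then show ?thesis by (simp only: yLam)
      qed
      show "\<bar>\<Sum>i\<in>I. (ind b (X i) - ind a (X i)) - (wedge_prob b - wedge_prob a)\<bar> \<le> 30 * (real (k + 1) / 2 ^ k) * (real n * y)"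
        if "k < K" "a \<in> net S k" "b \<in> net S (k + 1)" "quadf p Sg (b - a) \<le> 3 / 64 ^ k" for k a b
      proof -
        have mean: "integral\<^sup>L ?P (\<lambda>w. ind b w - ind a w) = wedge_prob b - wedge_prob a"
          using integrable_wedge by (simp add: expectation_wedge)
        have "\<bar>\<Sum>i\<in>I. (ind b (X i) - ind a (X i)) - (wedge_prob b - wedge_prob a)\<bar> \<le> 30 * real (k + 1) * Lam / (2 ^ k * y)"
        proof (rule abs_of_signed)
          fix c :: real assume "c \<in> {1, - 1}"
          then have "f1 k (S, (a, b), c) \<in> T" unfolding T_def T1_def X1_def links_def using SF that by blast
          then have "(\<Sum>i\<in>I. c * (2 ^ k * y) * ((ind b (X i) - ind a (X i)) - (wedge_prob b - wedge_prob a))) \<le> 30 * real (k + 1) * Lam"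
            using good unfolding mean[symmetric] by (auto simp: f1_def)
          then show "c * (2 ^ k * y) * (\<Sum>i\<in>I. (ind b (X i) - ind a (X i)) - (wedge_prob b - wedge_prob a)) \<le> 30 * real (k + 1) * Lam"
            by (simp only: sum_distrib_left)
        qed (use y in simp)
        also have "30 * real (k + 1) * Lam / (2 ^ k * y) = (30 * (real (k + 1) / 2 ^ k)) * Lam / y"
          using y by (simp add: field_simps)
        finally show ?thesis by (simp only: yLam)
      qed
      show "(\<Sum>i\<in>I. of_bool (strip p sg beta t (1 / 4 ^ K) g (X i))) \<le> 80 * real (K + 1) * (real n * y\<^sup>2)"
        if "g \<in> net S K" for g
      proof -
        have "f2 (S, g) \<in> T" unfolding T_def X2_def using SF that by blast
        then show ?thesis using good unfolding Lam(2) by (auto simp: f2_def a_def)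
      qed
      show "(\<Sum>i\<in>I. (dirvar p u (X i))\<^sup>2) \<le> 9 * real n * quadf p Sg u" if u: "supported_on S u" for u
      proof (rule energy_from_net[OF cov net[OF SF, of 1] finI _ _ _ u])
        fix g assume "g \<in> net S 1"
        then have "f3 (S, g) \<in> T" unfolding T_def X3_def using SF by blast
        then have "(\<Sum>i\<in>I. (dirvar p g (X i))\<^sup>2 / 4) \<le> real n" using good by (auto simp: f3_def)
        then show "(\<Sum>i\<in>I. (dirvar p g (X i))\<^sup>2) \<le> 4 * real n" by (simp add: sum_divide_distrib[symmetric])
      qed (use dom in auto)
    qed (use finI cardI K y v in auto)
  qed
  show ?thesis by (intro exI[of _ T] conjI allI impI Tfin Tmeas Tcost dev)
qed

end

section \<open>From uniform deviations to the depth estimator\<close>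

lemma normalize_direction:
  assumes "0 < quadf p Sg u"
  obtains v where "supported_on (supp p u) v" "quadf p Sg v = 1"
    "\<And>x. dotp p u x = sqrt (quadf p Sg u) * dotp p v x"
proof
  \<comment> \<open>\<open>u\<close> is arbitrary from coordinate \<open>p\<close> on, whereas
    \<open>supported_on\<close> speaks about all coordinates.\<close>
  define w where "w = (\<lambda>j. if j < p then u j else 0)"
  define v where "v = (\<lambda>j. 1 / sqrt (quadf p Sg u) * w j)"
  have w: "quadf p Sg w = quadf p Sg u" "dotp p w x = dotp p u x" for x
    unfolding quadf_def dotp_def by (auto simp: w_def intro!: sum.cong)
  show "supported_on (supp p u) v" by (auto simp: supported_on_def v_def w_def supp_def)
  show "quadf p Sg v = 1"
    unfolding v_def quadf_scale w(1) using assms by (simp add: power_divide)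
  show "dotp p u x = sqrt (quadf p Sg u) * dotp p v x" for x
    unfolding v_def dotp_scale w(2) using assms by simp
qed

lemma supp_subset: "supp p u \<subseteq> {..<p}"
  by (auto simp: supp_def)

lemma emp_prob_nonneg: "0 \<le> emp_prob n omega A"
  by (simp add: emp_prob_def)

lemma emp_depth_le:
  assumes "u \<in> U"
  shows "emp_depth p U n omega b \<le> emp_prob n omega {(x, y). dotp p u x * (y - dotp p x b) \<ge> 0}"
  unfolding emp_depth_def
  by (rule cINF_lower[OF _ assms]) (auto intro!: bdd_belowI[of _ 0] emp_prob_nonneg)

lemma zero_le_mult_iff_pos: "0 < c \<Longrightarrow> 0 \<le> c * z \<longleftrightarrow> (0 :: real) \<le> z"
  by (simp add: zero_le_mult_iff)

lemma resid_eq: "0 < sg \<Longrightarrow> snd w - dotp p (fst w) beta = sg * resid p sg beta w"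
  by (simp add: resid_def)

section \<open>Depth bounds for a fixed sample with its discarded indices\<close>

context
  fixes p s n :: nat and Sg :: "nat \<Rightarrow> nat \<Rightarrow> real" and sg y :: real and beta :: "nat \<Rightarrow> real"
    and omega :: "nat \<Rightarrow> (nat \<Rightarrow> real) \<times> real" and J :: "nat set"
  assumes cov: "is_cov_matrix p Sg" and sg: "0 < sg" and n: "1 \<le> n" and y: "0 < y" "y \<le> 1 / 10"
    and J: "J \<subseteq> {..<n}" "real (card J) \<le> 8 * (real n * y)"
begin

lemma card_uncontaminated: "real (card ({..<n} - J)) = real n - real (card J)"
  using J(1) card_mono[OF finite_lessThan J(1)] finite_subset[OF J(1)]
  by (simp add: card_Diff_subset of_nat_diff)

lemma emp_prob_lower:
  "emp_prob n omega {w. A w} \<ge> (\<Sum>i\<in>{..<n} - J. of_bool (A (omega i))) / real n"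
proof -
  have "(\<Sum>i\<in>{..<n} - J. of_bool (A (omega i)) :: real) = real (card {i \<in> {..<n} - J. A (omega i)})"
    by (simp add: of_bool_def sum.If_cases Int_def)
  also have "\<dots> \<le> real (card {i. i < n \<and> omega i \<in> {w. A w}})"
    by (intro of_nat_mono card_mono) auto
  finally show ?thesis unfolding emp_prob_def by (rule divide_right_mono) simp
qed

lemma emp_prob_upper:
  "emp_prob n omega {w. A w} \<le> (real (card J) + (\<Sum>i\<in>{..<n} - J. of_bool (A (omega i)))) / real n"
proof -
  have "card {i. i < n \<and> omega i \<in> {w. A w}} \<le> card (J \<union> {i \<in> {..<n} - J. A (omega i)})"
    using finite_subset[OF J(1)] by (intro card_mono) auto
  also have "\<dots> \<le> card J + card {i \<in> {..<n} - J. A (omega i)}" by (rule card_Un_le)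
  finally have "real (card {i. i < n \<and> omega i \<in> {w. A w}}) \<le> real (card J) + real (card {i \<in> {..<n} - J. A (omega i)})"
    by linarith
  also have "real (card {i \<in> {..<n} - J. A (omega i)}) = (\<Sum>i\<in>{..<n} - J. of_bool (A (omega i)))"
    by (simp add: of_bool_def sum.If_cases Int_def)
  finally show ?thesis unfolding emp_prob_def by (rule divide_right_mono) simp
qed

text \<open>204 is 200 for the deviation plus half of the 8 for discarded indices, which lose their
  expected share 1/2. In a direction with vanishing form the functional is 0 at every clean
  observation, so its event holds there trivially.\<close>

lemma depth_truth_ge:
  assumes dom: "\<And>i. i \<in> {..<n} - J \<Longrightarrow> dominated p Sg (fst (omega i))"
    and dev: "\<And>S v. S \<subseteq> {..<p} \<Longrightarrow> card S \<le> 2 * s \<Longrightarrow> supported_on S v \<Longrightarrow> quadf p Sg v = 1 \<Longrightarrow>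
      \<bar>\<Sum>i\<in>{..<n} - J. of_bool (wedge p sg beta 0 v (omega i)) - 1 / 2\<bar> \<le> 200 * (real n * y)"
    and ne: "Theta p (2 * s) \<noteq> {}"
  shows "emp_depth p (Theta p (2 * s)) n omega beta \<ge> 1 / 2 - 204 * y"
  unfolding emp_depth_def
proof (rule cINF_greatest[OF ne])
  fix u assume u: "u \<in> Theta p (2 * s)"
  define A where "A = (\<lambda>w. dotp p u (fst w) * (snd w - dotp p (fst w) beta) \<ge> 0)"
  have n0: "0 < real n" using n by simp
  have ge: "(\<Sum>i\<in>{..<n} - J. of_bool (A (omega i))) \<ge> (1 / 2 - 204 * y) * real n"
  proof (cases "quadf p Sg u = 0")
    case True
    have "A (omega i)" if i: "i \<in> {..<n} - J" for i
    proof -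
      obtain M where "(dotp p u (fst (omega i)))\<^sup>2 \<le> M * quadf p Sg u"
        using dom[OF i] by (rule dominatedD) blast
      then show ?thesis using True by (simp add: A_def)
    qed
    then have "(\<Sum>i\<in>{..<n} - J. of_bool (A (omega i)) :: real) = (\<Sum>i\<in>{..<n} - J. 1)"
      by (intro sum.cong) auto
    also have "\<dots> = real n - real (card J)" by (simp add: card_uncontaminated)
    also have "\<dots> \<ge> (1 / 2 - 204 * y) * real n"
    proof -
      have "0 \<le> real n * y" using y by simp
      then show ?thesis using J(2) n0 by (simp add: algebra_simps)
    qed
    finally show ?thesis .
  next
    case False
    moreover have "0 \<le> quadf p Sg u" using cov by (simp add: is_cov_matrix_def)
    ultimately have pos: "0 < quadf p Sg u" by simp
    then obtain v where v: "supported_on (supp p u) v" "quadf p Sg v = 1"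
      "\<And>x. dotp p u x = sqrt (quadf p Sg u) * dotp p v x" by (rule normalize_direction) blast
    have "A w \<longleftrightarrow> wedge p sg beta 0 v w" for w
    proof -
      have "dotp p u (fst w) * (snd w - dotp p (fst w) beta)
          = (sqrt (quadf p Sg u) * sg) * (dirvar p v w * resid p sg beta w)"
        unfolding v(3) resid_eq[OF sg] by (simp only: mult_ac)
      moreover have "0 \<le> (sqrt (quadf p Sg u) * sg) * z \<longleftrightarrow> 0 \<le> z" for z
        using pos sg by (intro zero_le_mult_iff_pos) simp
      ultimately show ?thesis by (simp only: A_def wedge_def) simp
    qed
    then have "(\<Sum>i\<in>{..<n} - J. of_bool (A (omega i)) - 1 / 2 :: real) \<ge> - (200 * (real n * y))"
      using dev[OF supp_subset _ v(1,2)] u by (simp add: Theta_def abs_le_iff)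
    then have "(\<Sum>i\<in>{..<n} - J. of_bool (A (omega i)) :: real) \<ge> (real n - real (card J)) / 2 - 200 * (real n * y)"
      by (simp add: sum_subtractf card_uncontaminated)
    then show ?thesis using J(2) by (simp add: algebra_simps)
  qed
  then have "1 / 2 - 204 * y \<le> (\<Sum>i\<in>{..<n} - J. of_bool (A (omega i))) / real n"
    using n0 by (simp add: field_simps)
  also have "\<dots> \<le> emp_prob n omega {w. A w}" by (rule emp_prob_lower)
  finally show "1 / 2 - 204 * y \<le> emp_prob n omega {(x, y). 0 \<le> dotp p u x * (y - dotp p x beta)}"
    by (simp add: A_def case_prod_unfold)
qed

text \<open>In the direction \<open>u = b - beta\<close> the residual of \<open>b\<close>, divided
  by \<open>sg\<close>, is \<open>r\<close> minus the multiple \<open>q / sg >= t\<close> of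
  \<open>g\<close>. So the event lies in the wedge with parameter \<open>t\<close>, and all
  distances beyond \<open>t * sg\<close> collapse to this one value. Every discarded index may count
  for \<open>b\<close>, hence \<open>208 = 200 + 8\<close>.\<close>

lemma depth_far_le:
  assumes dev: "\<And>S v. S \<subseteq> {..<p} \<Longrightarrow> card S \<le> 2 * s \<Longrightarrow> supported_on S v \<Longrightarrow> quadf p Sg v = 1 \<Longrightarrow>
      \<bar>\<Sum>i\<in>{..<n} - J. of_bool (wedge p sg beta t v (omega i)) - wedge_prob p Sg sg beta t v\<bar> \<le> 200 * (real n * y)"
    and t: "0 \<le> t" "t \<le> 1" and far: "sqrt (quadf p Sg (b - beta)) \<ge> t * sg" "0 < quadf p Sg (b - beta)"
    and b: "b - beta \<in> Theta p (2 * s)"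
  shows "emp_depth p (Theta p (2 * s)) n omega b \<le> 1 / 2 - slope_const * t + 208 * y"
proof -
  define u where "u = b - beta"
  define A where "A = (\<lambda>w. dotp p u (fst w) * (snd w - dotp p (fst w) b) \<ge> 0)"
  have n0: "0 < real n" using n by simp
  define q where "q = sqrt (quadf p Sg u)"
  have q: "0 < q" "t * sg \<le> q" using far by (auto simp: q_def u_def)
  obtain v where v: "supported_on (supp p u) v" "quadf p Sg v = 1" "\<And>x. dotp p u x = q * dotp p v x"
    using far(2) unfolding q_def u_def by (rule normalize_direction) blast
  have AW: "wedge p sg beta t v w" if "A w" for w
  proof -
    have "dotp p (fst w) b = dotp p (fst w) beta + dotp p u (fst w)"
      by (simp add: dotp_def u_def algebra_simps flip: sum.distrib)
    then have "snd w - dotp p (fst w) b = sg * resid p sg beta w - q * dirvar p v w"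
      using resid_eq[OF sg, of w p beta] by (simp add: v(3))
    then have "0 \<le> q * (dirvar p v w * (sg * resid p sg beta w - q * dirvar p v w))"
      using that by (simp add: A_def v(3) mult.assoc)
    then have "q * (dirvar p v w)\<^sup>2 \<le> sg * (dirvar p v w * resid p sg beta w)"
      using q(1) by (simp add: zero_le_mult_iff power2_eq_square algebra_simps)
    moreover have "(t * sg) * (dirvar p v w)\<^sup>2 \<le> q * (dirvar p v w)\<^sup>2"
      using q(2) by (rule mult_right_mono) simp
    ultimately have "sg * (t * (dirvar p v w)\<^sup>2) \<le> sg * (dirvar p v w * resid p sg beta w)"
      by (simp add: mult_ac)
    then show ?thesis using sg by (simp add: wedge_def)
  qed
  have "(\<Sum>i\<in>{..<n} - J. of_bool (A (omega i)) :: real) \<le> (\<Sum>i\<in>{..<n} - J. of_bool (wedge p sg beta t v (omega i)))"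
    by (intro sum_mono) (use AW in \<open>auto simp: of_bool_def\<close>)
  also have "\<dots> \<le> real (card ({..<n} - J)) * wedge_prob p Sg sg beta t v + 200 * (real n * y)"
    using dev[OF supp_subset _ v(1,2)] b by (simp add: Theta_def abs_le_iff sum_subtractf u_def)
  also have "\<dots> \<le> real n * (1 / 2 - slope_const * t) + 200 * (real n * y)"
  proof -
    \<comment> \<open>Nonnegativity allows the number of clean indices to be raised to
      \<open>n\<close>.\<close>
    have "0 \<le> wedge_prob p Sg sg beta t v"
      unfolding wedge_prob_def[OF cov sg t] by (rule measure_nonneg)
    moreover have "wedge_prob p Sg sg beta t v \<le> 1 / 2 - slope_const * t"
      unfolding wedge_prob_def[OF cov sg t] wedge_def by (rule P_beta_wedge_le[OF cov sg v(2) t])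
    ultimately show ?thesis
      by (intro add_right_mono mult_mono) (auto simp: card_uncontaminated)
  qed
  finally have "(real (card J) + (\<Sum>i\<in>{..<n} - J. of_bool (A (omega i)))) / real n \<le> 1 / 2 - slope_const * t + 208 * y"
    using J(2) n0 by (simp add: field_simps)
  moreover have "emp_depth p (Theta p (2 * s)) n omega b \<le> emp_prob n omega {w. A w}"
    using emp_depth_le[OF b, of p n omega b] by (simp add: A_def case_prod_unfold u_def)
  ultimately show ?thesis using emp_prob_upper[of A] by linarith
qed

end

section \<open>Norm comparisons for differences of sparse vectors\<close>

lemma kappa_nonneg:
  assumes "is_cov_matrix p Sg" "Theta p (2 * s) \<noteq> {}"
  shows "0 \<le> kappa p s Sg"
  unfolding kappa_def using assms
  by (intro cINF_greatest) (auto simp: Sigma_half_norm_def is_cov_matrix_def l2norm_def sum_nonneg)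

lemma kappa_l2norm_le:
  assumes cov: "is_cov_matrix p Sg" and v: "card (supp p v) \<le> 2 * s" and ne: "Theta p (2 * s) \<noteq> {}"
  shows "(kappa p s Sg)\<^sup>2 * (l2norm p v)\<^sup>2 \<le> quadf p Sg v"
proof (cases "supp p v = {}")
  case True
  then have "l2norm p v = 0" by (auto simp: l2norm_def supp_def)
  then show ?thesis using cov by (simp add: is_cov_matrix_def)
next
  case False
  then have vT: "v \<in> Theta p (2 * s)" using v by (simp add: Theta_def)
  obtain j where j: "j < p" "v j \<noteq> 0" using False by (auto simp: supp_def)
  have "0 < (\<Sum>j<p. (v j)\<^sup>2)" using j by (intro sum_pos2[of _ j]) auto
  then have l2: "0 < l2norm p v" by (simp add: l2norm_def)
  have "kappa p s Sg \<le> Sigma_half_norm p Sg v / l2norm p v"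
    unfolding kappa_def using cov
    by (intro cINF_lower vT bdd_belowI[of _ 0])
      (auto simp: Sigma_half_norm_def is_cov_matrix_def l2norm_def sum_nonneg)
  then have "kappa p s Sg * l2norm p v \<le> Sigma_half_norm p Sg v" using l2 by (simp add: field_simps)
  then have "(kappa p s Sg * l2norm p v)\<^sup>2 \<le> (Sigma_half_norm p Sg v)\<^sup>2"
    using kappa_nonneg[OF cov ne] l2 by (intro power_mono) auto
  then show ?thesis using cov by (simp add: power_mult_distrib Sigma_half_norm_def is_cov_matrix_def)
qed

lemma l1norm_le_l2norm:
  assumes "card (supp p v) \<le> m"
  shows "(l1norm p v)\<^sup>2 \<le> real m * (l2norm p v)\<^sup>2"
proof -
  have "l1norm p v = (\<Sum>j\<in>supp p v. \<bar>v j\<bar>)"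
    unfolding l1norm_def by (intro sum.mono_neutral_right) (auto simp: supp_def)
  then have "(l1norm p v)\<^sup>2 = (\<Sum>j\<in>supp p v. 1 * \<bar>v j\<bar>)\<^sup>2" by simp
  also have "\<dots> \<le> (\<Sum>j\<in>supp p v. 1\<^sup>2) * (\<Sum>j\<in>supp p v. \<bar>v j\<bar>\<^sup>2)"
    by (rule Cauchy_Schwarz_ineq_sum)
  also have "\<dots> \<le> real m * (\<Sum>j<p. (v j)\<^sup>2)"
    using assms by (intro mult_mono) (auto intro!: sum_mono2 sum_nonneg simp: supp_def)
  finally show ?thesis by (simp add: l2norm_def sum_nonneg)
qed

lemma card_supp_diff:
  assumes "a \<in> Theta p s" "b \<in> Theta p s"
  shows "card (supp p (a - b)) \<le> 2 * s"
proof -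
  have "supp p (a - b) \<subseteq> supp p a \<union> supp p b" by (auto simp: supp_def)
  then have "card (supp p (a - b)) \<le> card (supp p a \<union> supp p b)"
    by (intro card_mono) (auto simp: supp_def)
  also have "\<dots> \<le> card (supp p a) + card (supp p b)" by (rule card_Un_le)
  finally show ?thesis using assms by (simp add: Theta_def)
qed

lemma quadf_supp_empty: "supp p v = {} \<Longrightarrow> quadf p Sg v = 0"
  by (auto simp: quadf_def supp_def)

text \<open>The depth of \<open>beta\<close> is at least \<open>1/2 - 204 * y\<close>, that of a candidate at distance \<open>t * sg\<close> at most
  \<open>1/2 - slope_const * t + 208 * y\<close>; the constant makes these incompatible at \<open>t = radius_const * y\<close>.\<close>

definition radius_const :: real where
  "radius_const = 413 / slope_const"

lemma ln_exp1_ratio_ge_1: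
  fixes s p :: nat
  assumes "1 \<le> s" "s \<le> p"
  shows "1 \<le> ln (exp 1 * real p / real s)"
proof -
  have "1 \<le> real p / real s" using assms by simp
  then have "0 \<le> ln (real p / real s)" by simp
  moreover have "ln (exp 1 * (real p / real s)) = 1 + ln (real p / real s)"
    using assms by (subst ln_mult) auto
  ultimately show ?thesis by simp
qed

text \<open>The 9 counts four test families for each of the two values of \<open>t\<close>, and the
  event of too many contaminated indices.\<close>

lemma tail_bound_combine:
  fixes Lam :: real
  assumes "1 \<le> Lam"
  shows "9 * exp (- 3 * Lam) \<le> exp (- (1 / 2) * Lam)"
proof -
  have "3 \<le> exp (5 / 4 :: real)"
    using exp_lower_Taylor_quadratic[of "5 / 4"] by (simp add: power2_eq_square)
  then have "3 * 3 \<le> exp (5 / 4) * exp (5 / 4 :: real)" by (intro mult_mono) auto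
  also have "\<dots> = exp (5 / 2)" by (simp flip: exp_add)
  also have "\<dots> \<le> exp (5 / 2 * Lam)" using assms by simp
  finally have "9 * exp (- 3 * Lam) \<le> exp (5 / 2 * Lam) * exp (- 3 * Lam)"
    by (intro mult_right_mono) auto
  then show ?thesis by (simp flip: exp_add)
qed

theorem depth_estimator_sample:
  fixes p s n :: nat and Sg :: "nat \<Rightarrow> nat \<Rightarrow> real" and sg eps y Lam :: real and beta :: "nat \<Rightarrow> real"
  assumes sp: "1 \<le> s" "s \<le> p" and n: "1 \<le> n" and sg: "0 < sg" and cov: "is_cov_matrix p Sg"
    and eps: "0 \<le> eps" "eps < 1" "eps \<le> y" and Q: "prob_space Q" "sets Q = sets (XYspace p)"
    and beta: "beta \<in> Theta p s"
    and Lam: "real s * ln (exp 1 * real p / real s) \<le> Lam" "real n * y\<^sup>2 = Lam"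
    and y: "0 < y" "y \<le> 1 / 10" "radius_const * y \<le> 1"
  shows "\<exists>E \<in> sets (sample_law n (mixture eps (P_beta p Sg sg beta) Q)).
    measure (sample_law n (mixture eps (P_beta p Sg sg beta) Q)) E \<ge> 1 - exp (- (1 / 2) * Lam) \<and>
    (\<forall>omega\<in>E. \<forall>b. is_depth_max p s n omega b \<longrightarrow> quadf p Sg (b - beta) \<le> (radius_const * sg * y)\<^sup>2)"
proof -
  let ?P = "P_beta p Sg sg beta"
  define t where "t = radius_const * y"
  have t: "0 \<le> t" "t \<le> 1" using y slope_const_pos by (auto simp: t_def radius_const_def)
  have t0: "(0::real) \<le> 0" "(0::real) \<le> 1" by auto
  have sL: "real s \<le> Lam" using mult_left_mono[OF ln_exp1_ratio_ge_1[OF sp], of "real s"] Lam(1) by simp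
  have Lam1: "1 \<le> Lam" using sL sp by linarith
  have F: "real (card {S. S \<subseteq> {..<p} \<and> card S \<le> 2 * s}) \<le> exp (2 * Lam)"
    by (rule order_trans[OF card_sparse_subsets[OF sp]]) (use Lam(1) in simp)
  obtain T0 where T0: "finite T0" "\<forall>(h, D)\<in>T0. h \<in> borel_measurable ?P"
      "(\<Sum>\<tau>\<in>T0. test_cost n ?P \<tau>) \<le> ennreal (4 * exp (- 3 * Lam))"
    and dev0: "\<And>I X S v. I \<subseteq> {..<n} \<Longrightarrow> \<forall>(h, D)\<in>T0. (\<Sum>i\<in>I. h (X i)) \<le> D \<Longrightarrow> \<forall>i\<in>I. dominated p Sg (fst (X i)) \<Longrightarrow>
       S \<subseteq> {..<p} \<Longrightarrow> card S \<le> 2 * s \<Longrightarrow> supported_on S v \<Longrightarrow> quadf p Sg v = 1 \<Longrightarrow>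
       \<bar>\<Sum>i\<in>I. of_bool (wedge p sg beta 0 v (X i)) - wedge_prob p Sg sg beta 0 v\<bar> \<le> 200 * (real n * y)"
    using uniform_wedge_deviation[OF cov sg t0 sL F Lam1 Lam(2) y(1,2), of beta] by metis
  obtain T1 where T1: "finite T1" "\<forall>(h, D)\<in>T1. h \<in> borel_measurable ?P"
      "(\<Sum>\<tau>\<in>T1. test_cost n ?P \<tau>) \<le> ennreal (4 * exp (- 3 * Lam))"
    and dev1: "\<And>I X S v. I \<subseteq> {..<n} \<Longrightarrow> \<forall>(h, D)\<in>T1. (\<Sum>i\<in>I. h (X i)) \<le> D \<Longrightarrow> \<forall>i\<in>I. dominated p Sg (fst (X i)) \<Longrightarrow>
       S \<subseteq> {..<p} \<Longrightarrow> card S \<le> 2 * s \<Longrightarrow> supported_on S v \<Longrightarrow> quadf p Sg v = 1 \<Longrightarrow>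
       \<bar>\<Sum>i\<in>I. of_bool (wedge p sg beta t v (X i)) - wedge_prob p Sg sg beta t v\<bar> \<le> 200 * (real n * y)"
    using uniform_wedge_deviation[OF cov sg t sL F Lam1 Lam(2) y(1,2), of beta] by metis
  have cost: "(\<Sum>\<tau>\<in>T0 \<union> T1. test_cost n ?P \<tau>) \<le> ennreal (8 * exp (- 3 * Lam))"
  proof -
    have "(\<Sum>\<tau>\<in>T0 \<union> T1. test_cost n ?P \<tau>) \<le> ennreal (4 * exp (- 3 * Lam)) + ennreal (4 * exp (- 3 * Lam))"
      by (rule order_trans[OF test_cost_sum_Un[OF T0(1) T1(1)] add_mono[OF T0(3) T1(3)]])
    also have "\<dots> = ennreal (4 * exp (- 3 * Lam) + 4 * exp (- 3 * Lam))"
      by (rule ennreal_plus[symmetric]) auto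
    finally show ?thesis by simp
  qed
  have "\<exists>E\<in>sets (sample_law n (mixture eps ?P Q)).
    measure (sample_law n (mixture eps ?P Q)) E \<ge> 1 - 8 * exp (- 3 * Lam) - exp (2 * real n * eps - 8 * (real n * y)) \<and>
    (\<forall>\<omega>\<in>E. \<exists>J\<subseteq>{..<n}. real (card J) \<le> 8 * (real n * y) \<and> (\<forall>(h, D)\<in>T0 \<union> T1. (\<Sum>i\<in>{..<n} - J. h (\<omega> i)) \<le> D)
       \<and> (\<forall>i\<in>{..<n} - J. dominated p Sg (fst (\<omega> i))))"
  proof (rule contaminated_tests[OF prob_space_P_beta[OF cov sg] Q(1)])
    show "sets Q = sets ?P" using Q(2) by simp
    show "h \<in> borel_measurable ?P" if "(h, D) \<in> T0 \<union> T1" for h D using that T0(2) T1(2) by auto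
    show "Measurable.pred ?P (\<lambda>w. dominated p Sg (fst w))" by measurable
    show "AE w in ?P. dominated p Sg (fst w)" by (rule AE_dominated[OF cov sg])
  qed (use T0 T1 eps cost in auto)
  then obtain E where E: "E \<in> sets (sample_law n (mixture eps ?P Q))"
    "measure (sample_law n (mixture eps ?P Q)) E \<ge> 1 - 8 * exp (- 3 * Lam) - exp (2 * real n * eps - 8 * (real n * y))"
    and good: "\<And>\<omega>. \<omega> \<in> E \<Longrightarrow> \<exists>J\<subseteq>{..<n}. real (card J) \<le> 8 * (real n * y)
       \<and> (\<forall>(h, D)\<in>T0 \<union> T1. (\<Sum>i\<in>{..<n} - J. h (\<omega> i)) \<le> D) \<and> (\<forall>i\<in>{..<n} - J. dominated p Sg (fst (\<omega> i)))"
    by blast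
  \<comment> \<open>\<open>eps <= y\<close> leaves an exponent of at most
    \<open>-6 * (n * y)\<close>, and \<open>y <= 1\<close> gives
    \<open>Lam <= n * y\<close>.\<close>
  have "exp (2 * real n * eps - 8 * (real n * y)) \<le> exp (- 3 * Lam)"
  proof -
    have "real n * eps \<le> real n * y" using eps by (intro mult_left_mono) auto
    moreover have "Lam \<le> real n * y"
      unfolding Lam(2)[symmetric] power2_eq_square using y by (intro mult_left_mono mult_left_le) auto
    moreover have "0 \<le> real n * y" using y by simp
    ultimately show ?thesis using Lam1 by simp
  qed
  then have prob: "measure (sample_law n (mixture eps ?P Q)) E \<ge> 1 - exp (- (1 / 2) * Lam)"
    using E(2) tail_bound_combine[OF Lam1] by linarith
  have "quadf p Sg (b - beta) \<le> (radius_const * sg * y)\<^sup>2" if om: "omega \<in> E" and b: "is_depth_max p s n omega b" for omega b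
  proof (rule ccontr)
    assume far: "\<not> quadf p Sg (b - beta) \<le> (radius_const * sg * y)\<^sup>2"
    obtain J where J: "J \<subseteq> {..<n}" "real (card J) \<le> 8 * (real n * y)"
      and tests: "\<forall>(h, D)\<in>T0 \<union> T1. (\<Sum>i\<in>{..<n} - J. h (omega i)) \<le> D"
      and dom: "\<forall>i\<in>{..<n} - J. dominated p Sg (fst (omega i))" using good[OF om] by blast
    have tests01: "\<forall>(h, D)\<in>T0. (\<Sum>i\<in>{..<n} - J. h (omega i)) \<le> D"
      "\<forall>(h, D)\<in>T1. (\<Sum>i\<in>{..<n} - J. h (omega i)) \<le> D"
      using tests by blast+
    have bT: "b \<in> Theta p s" using b by (simp add: is_depth_max_def)
    have pos: "0 < quadf p Sg (b - beta)" using far by (smt (verit) zero_le_power2)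
    \<comment> \<open>A vector with positive form is nonzero among the first \<open>p\<close>
      coordinates, so \<open>b - beta\<close> is an admissible direction of the depth.\<close>
    then have u: "b - beta \<in> Theta p (2 * s)"
      using card_supp_diff[OF bT beta] quadf_supp_empty[of p "b - beta" Sg] by (auto simp: Theta_def)
    have "(t * sg)\<^sup>2 \<le> quadf p Sg (b - beta)" using far by (simp add: t_def mult_ac)
    then have sq: "t * sg \<le> sqrt (quadf p Sg (b - beta))" by (rule real_le_rsqrt)
    have "1 / 2 - 204 * y \<le> emp_depth p (Theta p (2 * s)) n omega beta"
    proof (rule depth_truth_ge[OF cov sg n y(1,2) J])
      show "\<bar>\<Sum>i\<in>{..<n} - J. of_bool (wedge p sg beta 0 v (omega i)) - 1 / 2\<bar> \<le> 200 * (real n * y)"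
        if "S \<subseteq> {..<p}" "card S \<le> 2 * s" "supported_on S v" "quadf p Sg v = 1" for S v
      proof -
        have "wedge_prob p Sg sg beta 0 v = 1 / 2"
          unfolding wedge_prob_def[OF cov sg t0] wedge_def
          using P_beta_wedge_zero[OF cov sg that(4), of beta] by simp
        then show ?thesis using dev0[OF _ tests01(1) dom that] by (simp only:) auto
      qed
    qed (use dom u in auto)
    also have "\<dots> \<le> emp_depth p (Theta p (2 * s)) n omega b"
      using b beta by (simp add: is_depth_max_def)
    also have "\<dots> \<le> 1 / 2 - slope_const * t + 208 * y"
      by (rule depth_far_le[OF cov sg n y(1,2) J dev1[OF _ tests01(2) dom] t sq pos u]) auto
    finally have "slope_const * t \<le> 412 * y" by simp
    moreover have "slope_const * t = 413 * y"
      using slope_const_pos by (simp add: t_def radius_const_def)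
    ultimately show False using y(1) by simp
  qed
  then show ?thesis using E(1) prob by blast
qed

theorem theorem3:
  shows "\<exists>c0>0. \<exists>C>0. \<exists>C'>0.
    \<forall>(p::nat) (s::nat) (n::nat) (sg::real) (Sg::nat \<Rightarrow> nat \<Rightarrow> real) (eps::real)
      (Q::((nat \<Rightarrow> real) \<times> real) measure) (beta::nat \<Rightarrow> real).
      1 \<le> s \<and> s \<le> p \<and> 1 \<le> n \<and> sg > 0 \<and> is_cov_matrix p Sg \<and>
      0 \<le> eps \<and> eps < 1 \<and> prob_space Q \<and> sets Q = sets (XYspace p) \<and>
      beta \<in> Theta p s \<and>
      eps^2 + real s * ln (exp 1 * real p / real s) / real n \<le> c0
      \<longrightarrow>
      (\<exists>E \<in> sets (sample_law n (mixture eps (P_beta p Sg sg beta) Q)).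
         measure (sample_law n (mixture eps (P_beta p Sg sg beta) Q)) E
           \<ge> 1 - exp (- C' * (real s * ln (exp 1 * real p / real s) + real n * eps^2)) \<and>
         (\<forall>omega\<in>E. \<forall>b. is_depth_max p s n omega b \<longrightarrow>
            (Sigma_half_norm p Sg (b - beta))^2
              \<le> C * sg^2 * max (real s * ln (exp 1 * real p / real s) / real n) (eps^2) \<and>
            (kappa p s Sg)^2 * (l2norm p (b - beta))^2
              \<le> C * sg^2 * max (real s * ln (exp 1 * real p / real s) / real n) (eps^2) \<and>
            (kappa p s Sg)^2 * (l1norm p (b - beta))^2
              \<le> C * sg^2 * max (real s^2 * ln (exp 1 * real p / real s) / real n)
                                   (real s * eps^2)))"
proof -
  \<comment> \<open>\<open>1 / 10\<close> serves the chaining; \<open>1 / radius_const\<close> keeps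
    \<open>t = radius_const * y\<close> at most 1, the range of the wedge estimate. The witness for
    \<open>c0\<close> is \<open>y0^2\<close>.\<close>
  define y0 where "y0 = min (1 / 10) (1 / radius_const)"
  have rc: "0 < radius_const" using slope_const_pos by (simp add: radius_const_def)
  then have y0: "0 < y0" by (simp add: y0_def)
  have "\<exists>E \<in> sets (sample_law n (mixture eps (P_beta p Sg sg beta) Q)).
         measure (sample_law n (mixture eps (P_beta p Sg sg beta) Q)) E
           \<ge> 1 - exp (- (1 / 2) * (real s * ln (exp 1 * real p / real s) + real n * eps^2)) \<and>
         (\<forall>omega\<in>E. \<forall>b. is_depth_max p s n omega b \<longrightarrow>
            (Sigma_half_norm p Sg (b - beta))^2
              \<le> 4 * radius_const\<^sup>2 * sg^2 * max (real s * ln (exp 1 * real p / real s) / real n) (eps^2) \<and>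
            (kappa p s Sg)^2 * (l2norm p (b - beta))^2
              \<le> 4 * radius_const\<^sup>2 * sg^2 * max (real s * ln (exp 1 * real p / real s) / real n) (eps^2) \<and>
            (kappa p s Sg)^2 * (l1norm p (b - beta))^2
              \<le> 4 * radius_const\<^sup>2 * sg^2 * max (real s^2 * ln (exp 1 * real p / real s) / real n)
                                   (real s * eps^2))"
    if sp: "1 \<le> s" "s \<le> p" and n: "1 \<le> n" and sg: "0 < sg" and cov: "is_cov_matrix p Sg"
      and eps: "0 \<le> eps" "eps < 1" and Q: "prob_space Q" "sets Q = sets (XYspace p)"
      and beta: "beta \<in> Theta p s"
      and small: "eps^2 + real s * ln (exp 1 * real p / real s) / real n \<le> y0\<^sup>2"
    for p s n :: nat and sg eps :: real and Sg :: "nat \<Rightarrow> nat \<Rightarrow> real"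
      and Q :: "((nat \<Rightarrow> real) \<times> real) measure" and beta :: "nat \<Rightarrow> real"
  proof -
    define R where "R = real s * ln (exp 1 * real p / real s)"
    define Lam where "Lam = R + real n * eps\<^sup>2"
    define y where "y = sqrt (eps\<^sup>2 + R / real n)"
    have n0: "0 < real n" using n by simp
    have "0 < ln (exp 1 * real p / real s)" using ln_exp1_ratio_ge_1[OF sp] by linarith
    then have R0: "0 < R" unfolding R_def using sp by (intro mult_pos_pos) linarith+
    have pos: "0 < eps\<^sup>2 + R / real n" using R0 n0 by (intro add_nonneg_pos) auto
    have y2: "y\<^sup>2 = eps\<^sup>2 + R / real n" using pos by (simp add: y_def)
    have y: "0 < y" using pos by (simp add: y_def)
    have "y \<le> y0" unfolding y_def using small y0 by (intro real_le_lsqrt) (auto simp: R_def)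
    then have yb: "y \<le> 1 / 10" "y \<le> 1 / radius_const" by (auto simp: y0_def)
    then have yr: "radius_const * y \<le> 1" using rc by (simp add: field_simps)
    have ey: "eps \<le> y" unfolding y_def using R0 n0 by (intro real_le_rsqrt) simp
    have Lam: "R \<le> Lam" "real n * y\<^sup>2 = Lam"
      using n0 by (auto simp: Lam_def y2 algebra_simps)
    obtain E where E: "E \<in> sets (sample_law n (mixture eps (P_beta p Sg sg beta) Q))"
        "measure (sample_law n (mixture eps (P_beta p Sg sg beta) Q)) E \<ge> 1 - exp (- (1 / 2) * Lam)"
      and est: "\<And>omega b. omega \<in> E \<Longrightarrow> is_depth_max p s n omega b \<Longrightarrow> quadf p Sg (b - beta) \<le> (radius_const * sg * y)\<^sup>2"
      using depth_estimator_sample[OF sp n sg cov eps ey Q beta Lam(1)[unfolded R_def] Lam(2) y yb(1) yr] by blast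
    define mx where "mx = max (R / real n) (eps\<^sup>2)"
    \<comment> \<open>A sum is at most twice the maximum; a second factor 2 comes from supports of
      size \<open>2 * s\<close> in the \<open>l1\<close> bound, whence the 4 in the final
      constant.\<close>
    have y_mx: "y\<^sup>2 \<le> 2 * mx" unfolding y2 mx_def by linarith
    have mx0: "0 \<le> mx" by (simp add: mx_def le_max_iff_disj)
    have mx_s: "max (real s^2 * ln (exp 1 * real p / real s) / real n) (real s * eps^2) = real s * mx"
      using sp by (simp add: mx_def R_def max_mult_distrib_left power2_eq_square mult.assoc)
    have "(Sigma_half_norm p Sg (b - beta))^2 \<le> 4 * radius_const\<^sup>2 * sg^2 * mx \<and>
          (kappa p s Sg)^2 * (l2norm p (b - beta))^2 \<le> 4 * radius_const\<^sup>2 * sg^2 * mx \<and>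
          (kappa p s Sg)^2 * (l1norm p (b - beta))^2 \<le> 4 * radius_const\<^sup>2 * sg^2 * (real s * mx)"
      if om: "omega \<in> E" and b: "is_depth_max p s n omega b" for omega b
    proof -
      have bT: "b \<in> Theta p s" using b by (simp add: is_depth_max_def)
      have ne: "Theta p (2 * s) \<noteq> {}" using beta by (auto simp: Theta_def)
      note supp = card_supp_diff[OF bT beta]
      have "quadf p Sg (b - beta) \<le> (radius_const\<^sup>2 * sg\<^sup>2) * y\<^sup>2"
        using est[OF om b] by (simp add: power_mult_distrib)
      also have "\<dots> \<le> (radius_const\<^sup>2 * sg\<^sup>2) * (2 * mx)" by (intro mult_left_mono y_mx) simp
      finally have q: "quadf p Sg (b - beta) \<le> 2 * (radius_const\<^sup>2 * sg\<^sup>2 * mx)" by (simp add: mult_ac)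
      have nn: "0 \<le> radius_const\<^sup>2 * sg\<^sup>2 * mx" using mx0 by simp
      have l2: "(kappa p s Sg)^2 * (l2norm p (b - beta))^2 \<le> 2 * (radius_const\<^sup>2 * sg\<^sup>2 * mx)"
        using kappa_l2norm_le[OF cov supp ne] q by linarith
      have "(kappa p s Sg)^2 * (l1norm p (b - beta))^2 \<le> (kappa p s Sg)^2 * (real (2 * s) * (l2norm p (b - beta))^2)"
        by (intro mult_left_mono l1norm_le_l2norm supp) simp
      also have "\<dots> = real (2 * s) * ((kappa p s Sg)^2 * (l2norm p (b - beta))^2)" by (simp only: mult_ac)
      also have "\<dots> \<le> real (2 * s) * (2 * (radius_const\<^sup>2 * sg\<^sup>2 * mx))"
        by (intro mult_left_mono l2) simp
      finally have l1: "(kappa p s Sg)^2 * (l1norm p (b - beta))^2 \<le> 4 * radius_const\<^sup>2 * sg^2 * (real s * mx)"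
        by (simp add: mult_ac)
      have "(Sigma_half_norm p Sg (b - beta))^2 = quadf p Sg (b - beta)"
        using cov by (simp add: Sigma_half_norm_def is_cov_matrix_def)
      then show ?thesis using q l2 l1 nn by simp
    qed
    then show ?thesis using E unfolding mx_s unfolding mx_def R_def Lam_def by blast
  qed
  then show ?thesis using y0 rc
    by (intro exI[of _ "y0\<^sup>2"] exI[of _ "4 * radius_const\<^sup>2"] exI[of _ "1 / 2"] conjI allI impI) auto
qed

end
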